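(* Let $n\ge 1$ and let $U$ be a domain in $\mathbb R^n$. Let $f$ be a real-analytic nonconstant (real-valued) function on $U$ with $|f|<\frac12$ on $U$, and let $v=\frac{1}{\ln|f|}$ on $U$, with $v=0$ on $f^{-1}(0)$. The following statements hold. 1) $v\in W^{1,1}_{loc}(U)$. 2) If $\operatorname{codim}_{\mathbb R} f^{-1}(0)=1$, then $v\notin W^{1,p}_{loc}(U)$ for any $p>1$.
   Context: A domain is a nonempty connected open set. $f^{-1}(0)=\{x\in U: f(x)=0\}$. Since $|f|<\frac12$, the function $v$ is well defined and continuous on $U$ with the convention $v=0$ on $f^{-1}(0)$. For $k\in\mathbb Z^+$, $p\ge1$, $W^{k,p}_{loc}(U)$ is the Sobolev space of functions on $U$ whose weak derivatives up to order $k$ exist and belong to $L^p_{loc}(U)$. $\operatorname{codim}_{\mathbb R} f^{-1}(0)$ is $n$ minus the dimension of the real-analytic set $f^{-1}(0)$, where the dimension is the largest $d$ such that $f^{-1}(0)$ contains a $d$-dimensional real-analytic submanifold (equivalently, its Hausdorff dimension); in particular codimension $1$ means that the dimension is $n-1$. *)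

theory Defs
  imports "HOL-Analysis.Analysis"
begin

section \<open>Real-analytic functions and sets\<close>

definition real_analytic_on :: "(real^'n \<Rightarrow> real) \<Rightarrow> (real^'n) set \<Rightarrow> bool"
    (infixl "(real'_analytic'_on)" 50) where
  "f real_analytic_on U \<longleftrightarrow>
     (\<forall>a\<in>U. \<exists>r>0. ball a r \<subseteq> U \<and>
       (\<exists>c :: ('n \<Rightarrow> nat) \<Rightarrow> real. \<forall>x\<in>ball a r.
          ((\<lambda>\<alpha>. c \<alpha> * (\<Prod>i\<in>UNIV. (x $ i - a $ i) ^ \<alpha> i)) has_sum f x) UNIV))"

definition real_analytic_map_on :: "(real^'n \<Rightarrow> real^'m) \<Rightarrow> (real^'n) set \<Rightarrow> bool"
    (infixl "(real'_analytic'_map'_on)" 50) where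
  "F real_analytic_map_on U \<longleftrightarrow> (\<forall>j. (\<lambda>x. F x $ j) real_analytic_on U)"

text \<open>Embedded submanifolds of pure dimension \<open>d\<close>, described by real-analytic slice charts
  \<open>\<phi>\<close> of the ambient space with inverse \<open>\<psi>\<close>.\<close>

definition real_analytic_submanifold :: "nat \<Rightarrow> (real^'n) set \<Rightarrow> bool" where
  "real_analytic_submanifold d M \<longleftrightarrow> M \<noteq> {} \<and>
     (\<forall>a\<in>M. \<exists>V W \<phi> \<psi>. \<exists>L :: (real^'n) set.
        open V \<and> open W \<and> a \<in> V \<and>
        \<phi> real_analytic_map_on V \<and> \<psi> real_analytic_map_on W \<and>
        homeomorphism V W \<phi> \<psi> \<and>
        subspace L \<and> dim L = d \<and> \<phi> ` (V \<inter> M) = W \<inter> L)"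

text \<open>The dimension is extended-real valued, so that the empty set has dimension \<open>-\<infinity>\<close> and
  codimension \<open>\<infinity>\<close>. For nonempty \<open>Z\<close> the supremum is a maximum, since \<open>d \<le> CARD('n)\<close>.\<close>

definition analytic_dim :: "(real^'n) set \<Rightarrow> ereal" where
  "analytic_dim Z = (SUP d \<in> {d. \<exists>M \<subseteq> Z. real_analytic_submanifold d M}. ereal (real d))"

definition analytic_codim :: "(real^'n) set \<Rightarrow> ereal" where
  "analytic_codim Z = ereal (real CARD('n)) - analytic_dim Z"


section \<open>Local Sobolev spaces\<close>

definition partial_deriv :: "'n \<Rightarrow> (real^'n \<Rightarrow> real) \<Rightarrow> real^'n \<Rightarrow> real" where
  "partial_deriv i f x = frechet_derivative f (at x) (axis i 1)"

text \<open>Partial derivatives of order \<open>m\<close> are indexed by lists of \<open>m\<close> coordinate directions; on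
  smooth functions the order of differentiation is irrelevant, so these are the usual
  multi-index derivatives.\<close>

primrec partial_derivs :: "'n list \<Rightarrow> (real^'n \<Rightarrow> real) \<Rightarrow> real^'n \<Rightarrow> real" where
  "partial_derivs [] f = f"
| "partial_derivs (i # is) f = partial_deriv i (partial_derivs is f)"

definition smooth :: "(real^'n \<Rightarrow> real) \<Rightarrow> bool" where
  "smooth f \<longleftrightarrow> (\<forall>is. \<forall>x. partial_derivs is f differentiable at x)"

definition test_function_on :: "(real^'n) set \<Rightarrow> (real^'n \<Rightarrow> real) \<Rightarrow> bool" where
  "test_function_on U \<phi> \<longleftrightarrow>
     smooth \<phi> \<and> compact (closure {x. \<phi> x \<noteq> 0}) \<and> closure {x. \<phi> x \<noteq> 0} \<subseteq> U"

definition Lp_loc :: "real \<Rightarrow> (real^'n) set \<Rightarrow> (real^'n \<Rightarrow> real) \<Rightarrow> bool" where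
  "Lp_loc p U g \<longleftrightarrow> g \<in> borel_measurable (lebesgue_on U) \<and>
     (\<forall>K. compact K \<and> K \<subseteq> U \<longrightarrow> integrable (lebesgue_on K) (\<lambda>x. \<bar>g x\<bar> powr p))"

definition weak_derivative ::
    "(real^'n) set \<Rightarrow> 'n list \<Rightarrow> (real^'n \<Rightarrow> real) \<Rightarrow> (real^'n \<Rightarrow> real) \<Rightarrow> bool" where
  "weak_derivative U is u g \<longleftrightarrow> Lp_loc 1 U u \<and> Lp_loc 1 U g \<and>
     (\<forall>\<phi>. test_function_on U \<phi> \<longrightarrow>
        (LINT x|lebesgue_on U. u x * partial_derivs is \<phi> x) =
        (-1) ^ length is * (LINT x|lebesgue_on U. g x * \<phi> x))"

text \<open>The empty list is included: there \<open>g = u\<close> almost everywhere on \<open>U\<close>, so it says that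
  \<open>u\<close> itself is locally in \<open>L\<^sup>p\<close>.\<close>

definition Sobolev_loc :: "nat \<Rightarrow> real \<Rightarrow> (real^'n) set \<Rightarrow> (real^'n \<Rightarrow> real) set" where
  "Sobolev_loc k p U =
     {u. \<forall>is. length is \<le> k \<longrightarrow> (\<exists>g. weak_derivative U is u g \<and> Lp_loc p U g)}"

end

theory Submission
  imports Defs
begin

text \<open>Put \<open>F(s) = 1 / ln \<bar>s\<bar>\<close>, so that \<open>v = F \<circ> f\<close> with \<open>\<partial>\<^sub>e v = F'(f) \<partial>\<^sub>e f\<close> off the zero set. Near a point \<open>a\<close>, an
  open set of directions \<open>e\<close> satisfies \<open>\<partial>\<^sub>e\<^sup>k f(a) \<noteq> 0\<close> for some \<open>k \<ge> 1\<close>, by the identity theorem. By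
  Rolle, on segments near \<open>a\<close> in such a direction \<open>f\<close> and \<open>\<partial>\<^sub>e f\<close> have at most \<open>k\<close> zeros, so the bounded
  function \<open>v\<close> has uniformly bounded variation along them, and Fubini gives \<open>\<partial>\<^sub>e v \<in> L\<^sup>1\<close> near \<open>a\<close>; such
  directions span. Integration by parts holds for \<open>C\<^sup>1\<close> truncations of \<open>v\<close> vanishing near the zero
  set, whose derivatives are dominated by that of \<open>v\<close>.

  If the zero set contains a hypersurface, choose \<open>e\<close> as above and also transversal to it. On every
  line in direction \<open>e\<close> that meets the hypersurface near \<open>a\<close>, \<open>f\<close> has a zero of finite order, where
  \<open>\<bar>\<partial>\<^sub>e v\<bar>\<close> is at least of the order of \<open>1 / (s ln\<^sup>2 s)\<close>, whose \<open>p\<close>-th power is not integrable for \<open>p > 1\<close>.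
  These lines fill a neighbourhood of \<open>a\<close>, so \<open>\<partial>\<^sub>e v \<notin> L\<^sup>p\<close> there by Fubini.\<close>

section \<open>Termwise differentiation of real-analytic functions\<close>

text \<open>The obstacle is that the zero set may be singular in any way an analytic set can be. No
  structure theory is applied to it: all estimates are made on segments, and for local integrability
  only the size of \<open>v\<close> and the number of its monotone pieces enter, never the behaviour
  of \<open>f\<close> near its zeros. That good directions contain an open set is used twice: two of
  them differ by a multiple of any prescribed direction, and one of them avoids the tangent
  hyperplane of a given hypersurface. The negative statement starts from an unknown weak derivative
  in L^p, which must first be identified almost everywhere with the classical expression
  \<open>dV\<close>. This is the reason for the uniqueness theorem for weak derivatives and for the
  explicit bump functions. Analyticity is given by unconditional multi-index sums. Over the reals
  these converge absolutely, which yields the majorants for termwise differentiation and permits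
  regrouping by total degree along a line.\<close>

lemma has_sum_to_nat:
  fixes w :: "'i::countable \<Rightarrow> real"
  assumes "(w has_sum s) UNIV"
  shows "((\<lambda>n. if n \<in> range (to_nat :: 'i \<Rightarrow> nat) then w (from_nat n) else 0) has_sum s) UNIV"
proof -
  have "((\<lambda>n. w (from_nat n)) has_sum s) (range (to_nat :: 'i \<Rightarrow> nat))"
    using assms by (subst has_sum_reindex) (auto simp: o_def)
  then show ?thesis
    by (subst has_sum_cong_neutral[where T = "range (to_nat :: 'i \<Rightarrow> nat)" and g = "\<lambda>n. w (from_nat n)"]) auto
qed

text \<open>The Weierstrass M-test: once the indices are enumerated, the tail
  \<open>m - (\<Sum>i<n. T M i)\<close> of the majorant bounds the error of the differentiated
  partial sums uniformly in \<open>x\<close>, as \<open>has_derivative_series\<close>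
  requires.\<close>

lemma has_derivative_has_sum:
  fixes u :: "'i::countable \<Rightarrow> 'a::real_normed_vector \<Rightarrow> real"
  assumes "open S" "convex S"
    and der: "\<And>i x. x \<in> S \<Longrightarrow> (u i has_derivative u' i x) (at x)"
    and bnd: "\<And>i x h. x \<in> S \<Longrightarrow> \<bar>u' i x h\<bar> \<le> M i * norm h"
    and M: "M summable_on UNIV"
    and sum: "\<And>x. x \<in> S \<Longrightarrow> ((\<lambda>i. u i x) has_sum f x) UNIV"
    and x: "x \<in> S"
  shows "(f has_derivative (\<lambda>h. \<Sum>\<^sub>\<infinity>i. u' i x h)) (at x)" "(\<lambda>i. u' i x h) summable_on UNIV"
proof -
  \<comment> \<open>Padding by zeros, since \<open>to_nat\<close> is injective but may fail to be
    onto.\<close>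
  define T :: "('i \<Rightarrow> real) \<Rightarrow> nat \<Rightarrow> real"
    where "T w n = (if n \<in> range (to_nat :: 'i \<Rightarrow> nat) then w (from_nat n) else 0)" for w n
  have T: "T w sums s" if "(w has_sum s) UNIV" for w s
    using has_sum_imp_sums[OF has_sum_to_nat[OF that]] by (simp add: T_def[abs_def])
  have summ: "(\<lambda>i. u' i x h) summable_on UNIV" if "x \<in> S" for x h
  proof -
    have "(\<lambda>i. norm (M i * norm h)) summable_on UNIV"
      by (rule iffD1[OF summable_on_iff_abs_summable_on_real summable_on_cmult_left[OF M]])
    then have "(\<lambda>i. norm (u' i x h)) summable_on UNIV"
      by (rule Infinite_Sum.abs_summable_on_comparison_test) (use bnd[OF that] order_trans[OF _ abs_ge_self] in \<open>simp, blast\<close>)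
    then show ?thesis by (rule Infinite_Sum.abs_summable_summable)
  qed
  then show "(\<lambda>i. u' i x h) summable_on UNIV" using x by blast
  define g' where "g' x h = (\<Sum>\<^sub>\<infinity>i. u' i x h)" for x h
  obtain m where m: "T M sums m" using T M unfolding summable_on_def by blast
  have est: "\<bar>(\<Sum>i<n. T (\<lambda>i. u' i x h) i) - g' x h\<bar> \<le> (m - (\<Sum>i<n. T M i)) * norm h"
    if "x \<in> S" for x h n
  proof -
    have "T (\<lambda>i. u' i x h) sums g' x h" unfolding g'_def
      by (intro T has_sum_infsum summ that)
    then have 1: "(\<lambda>i. T (\<lambda>i. u' i x h) (i + n)) sums (g' x h - (\<Sum>i<n. T (\<lambda>i. u' i x h) i))"
      by (rule sums_split_initial_segment)
    have 2: "(\<lambda>i. T M (i + n) * norm h) sums ((m - (\<Sum>i<n. T M i)) * norm h)"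
      by (intro sums_mult2 sums_split_initial_segment m)
    have b: "\<bar>T (\<lambda>i. u' i x h) j\<bar> \<le> T M j * norm h" for j
      using bnd[OF that] by (auto simp: T_def)
    have "g' x h - (\<Sum>i<n. T (\<lambda>i. u' i x h) i) \<le> (m - (\<Sum>i<n. T M i)) * norm h"
      by (rule sums_le[OF _ 1 2]) (use b abs_le_iff in blast)
    moreover have "- (g' x h - (\<Sum>i<n. T (\<lambda>i. u' i x h) i)) \<le> (m - (\<Sum>i<n. T M i)) * norm h"
      by (rule sums_le[OF _ sums_minus[OF 1] 2]) (use b abs_le_iff in blast)
    ultimately show ?thesis by linarith
  qed
  have lim: "(\<lambda>n. m - (\<Sum>i<n. T M i)) \<longlonglongrightarrow> 0"
    using m tendsto_diff[OF tendsto_const[of m], of "\<lambda>n. \<Sum>i<n. T M i" m sequentially] by (simp add: sums_def)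
  have "\<exists>g. \<forall>x\<in>S. (\<lambda>n. T (\<lambda>i. u i x) n) sums g x \<and> (g has_derivative g' x) (at x within S)"
  proof (rule has_derivative_series[where f' = "\<lambda>n x h. T (\<lambda>i. u' i x h) n" and l = "f x" and x = x])
    show "convex S" by fact
    show "((\<lambda>x. T (\<lambda>i. u i x) n) has_derivative (\<lambda>h. T (\<lambda>i. u' i x h) n)) (at x within S)"
      if "x \<in> S" for n x
      using der[OF that] by (cases "n \<in> range (to_nat :: 'i \<Rightarrow> nat)") (simp_all add: T_def has_derivative_at_withinI)
    show "x \<in> S" by fact
    show "(\<lambda>n. T (\<lambda>i. u i x) n) sums f x" using T[OF sum[OF x]] by simp
    fix e :: real assume "e > 0"
    with lim have "\<forall>\<^sub>F n in sequentially. m - (\<Sum>i<n. T M i) < e"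
      by (rule order_tendstoD)
    then show "\<forall>\<^sub>F n in sequentially. \<forall>x\<in>S. \<forall>h. norm ((\<Sum>i<n. T (\<lambda>i. u' i x h) i) - g' x h) \<le> e * norm h"
    proof eventually_elim
      case (elim n)
      then have "(m - (\<Sum>i<n. T M i)) * norm h \<le> e * norm h" for h :: 'a
        by (intro mult_right_mono) auto
      then show ?case using est[where n = n] by (auto intro: order_trans)
    qed
  qed
  then obtain g where g: "\<And>x. x \<in> S \<Longrightarrow> (\<lambda>n. T (\<lambda>i. u i x) n) sums g x"
    "\<And>x. x \<in> S \<Longrightarrow> (g has_derivative g' x) (at x within S)" by blast
  have "g y = f y" if "y \<in> S" for y
    using g(1)[OF that] T[OF sum[OF that]] sums_unique2 by blast
  moreover have "(g has_derivative g' x) (at x)" using g(2)[OF x] at_within_open[OF x \<open>open S\<close>] by metis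
  ultimately have "(f has_derivative g' x) (at x)"
    by (metis has_derivative_transform_within_open[OF _ \<open>open S\<close> x])
  then show "(f has_derivative (\<lambda>h. \<Sum>\<^sub>\<infinity>i. u' i x h)) (at x)" by (simp add: g'_def[abs_def])
qed

lemma has_sum_sum:
  fixes f :: "'j \<Rightarrow> 'i \<Rightarrow> 'a::topological_comm_monoid_add"
  assumes "\<And>j. j \<in> J \<Longrightarrow> (f j has_sum s j) A"
  shows "((\<lambda>i. \<Sum>j\<in>J. f j i) has_sum (\<Sum>j\<in>J. s j)) A"
  using assms by (induction J rule: infinite_finite_induct) (auto intro!: has_sum_add has_sum_0)

text \<open>Taken from the Frechet derivative rather than from a limit along the line, so that it is
  linear in \<open>e\<close> wherever \<open>f\<close> is differentiable.\<close>

definition dir_deriv :: "'a::real_normed_vector \<Rightarrow> ('a \<Rightarrow> real) \<Rightarrow> 'a \<Rightarrow> real"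
  where "dir_deriv e f x = frechet_derivative f (at x) e"

text \<open>Since \<open>k \<le> 2 ^ k\<close>, the factor \<open>k\<close> produced by
  differentiation is paid for by doubling the radius.\<close>

lemma half_power_bound: "real k * s ^ (k - 1) \<le> (2 * s) ^ k / s" if "s > 0"
proof (cases k)
  case (Suc n)
  have "real (Suc n) \<le> 2 ^ Suc n" by (metis less_exp nat_less_le of_nat_le_numeral_power_cancel_iff)
  then have "real (Suc n) * s ^ n \<le> 2 ^ Suc n * s ^ n" using that by (intro mult_right_mono) auto
  also have "\<dots> = (2 * s) ^ Suc n / s" using that by (simp add: field_simps)
  finally show ?thesis using Suc by simp
qed (use that in auto)

text \<open>Absolute convergence at a single point of the larger ball gives a majorant for the first
  derivatives of all terms on the smaller one. The coefficients of the result are written out, free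
  of \<open>x\<close>, because the derivative has to be recognised as analytic again.\<close>

lemma power_series_dir_deriv:
  fixes f :: "real^'n \<Rightarrow> real"
  assumes r: "r > 0"
    and f: "\<And>x. x \<in> ball a r \<Longrightarrow>
          ((\<lambda>\<alpha>. c \<alpha> * (\<Prod>i\<in>UNIV. (x $ i - a $ i) ^ \<alpha> i)) has_sum f x) UNIV"
  obtains s where "0 < s" "s \<le> r" 
    "\<And>x. x \<in> ball a s \<Longrightarrow> f differentiable at x"
    "\<And>x e. x \<in> ball a s \<Longrightarrow>
      ((\<lambda>\<alpha>. (\<Sum>i\<in>UNIV. e $ i * real (Suc (\<alpha> i)) * c (\<alpha>(i := Suc (\<alpha> i)))) * (\<Prod>i\<in>UNIV. (x $ i - a $ i) ^ \<alpha> i))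
         has_sum dir_deriv e f x) UNIV"
proof -
  \<comment> \<open>Chosen so that the corner \<open>a + (\<chi> i. 2 * s)\<close> lies in
    \<open>ball a r\<close>: its distance from \<open>a\<close> is at most
    \<open>2 * s * real CARD('n)\<close>. The doubled \<open>s\<close> is the one of
    \<open>half_power_bound\<close>.\<close>
  define s where "s = r / (2 * (real CARD('n) + 1))"
  have s0: "s > 0" using r by (simp add: s_def)
  have s2: "2 * s * real CARD('n) < r" using r by (simp add: s_def field_simps)
  have "s * 1 \<le> s * (2 * (real CARD('n) + 1))" using s0 by (intro mult_left_mono) auto
  then have sr: "s \<le> r" using r by (simp add: s_def)
  define u where "u \<alpha> x = c \<alpha> * (\<Prod>i\<in>UNIV. (x $ i - a $ i) ^ \<alpha> i)" for \<alpha> :: "'n \<Rightarrow> nat" and x :: "real^'n"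
  define P where "P i \<alpha> x = c \<alpha> * (real (\<alpha> i) * (x $ i - a $ i) ^ (\<alpha> i - 1) * (\<Prod>j\<in>UNIV - {i}. (x $ j - a $ j) ^ \<alpha> j))"
    for i and \<alpha> :: "'n \<Rightarrow> nat" and x :: "real^'n"
  define M where "M \<alpha> = \<bar>c \<alpha>\<bar> * (\<Prod>i\<in>UNIV. (2 * s) ^ \<alpha> i) / s" for \<alpha> :: "'n \<Rightarrow> nat"
  have Pbnd: "\<bar>P i \<alpha> x\<bar> \<le> M \<alpha>" if x: "x \<in> ball a s" for i \<alpha> x
  proof -
    have xi: "\<bar>x $ j - a $ j\<bar> \<le> s" for j
      using x component_le_norm_cart[of "x - a" j] by (simp add: dist_norm norm_minus_commute)
    have "\<bar>P i \<alpha> x\<bar> = \<bar>c \<alpha>\<bar> * (real (\<alpha> i) * \<bar>x $ i - a $ i\<bar> ^ (\<alpha> i - 1) * (\<Prod>j\<in>UNIV - {i}. \<bar>x $ j - a $ j\<bar> ^ \<alpha> j))"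
      by (simp add: P_def abs_mult power_abs abs_prod)
    also have "\<dots> \<le> \<bar>c \<alpha>\<bar> * ((2 * s) ^ \<alpha> i / s * (\<Prod>j\<in>UNIV - {i}. (2 * s) ^ \<alpha> j))"
    proof (intro mult_left_mono mult_mono prod_mono conjI)
      have "real (\<alpha> i) * \<bar>x $ i - a $ i\<bar> ^ (\<alpha> i - 1) \<le> real (\<alpha> i) * s ^ (\<alpha> i - 1)"
        by (intro mult_left_mono power_mono xi) auto
      then show "real (\<alpha> i) * \<bar>x $ i - a $ i\<bar> ^ (\<alpha> i - 1) \<le> (2 * s) ^ \<alpha> i / s"
        using half_power_bound[OF s0, of "\<alpha> i"] by linarith
      show "\<bar>x $ j - a $ j\<bar> ^ \<alpha> j \<le> (2 * s) ^ \<alpha> j" for j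
        using xi[of j] s0 by (intro power_mono) auto
    qed (use s0 in \<open>auto intro!: prod_nonneg\<close>)
    also have "\<dots> = M \<alpha>" unfolding M_def using prod.remove[of UNIV i "\<lambda>j. (2 * s) ^ \<alpha> j"] by simp
    finally show ?thesis .
  qed
  have M: "M summable_on UNIV"
  proof -
    have "a + (\<chi> i. 2 * s) \<in> ball a r"
    proof -
      have "norm (\<chi> i::'n. 2 * s) \<le> (\<Sum>i\<in>UNIV. \<bar>(\<chi> i::'n. 2 * s) $ i\<bar>)" by (rule norm_le_l1_cart)
      also have "\<dots> = 2 * s * real CARD('n)" using s0 by simp
      finally show ?thesis using s2 by (simp add: dist_norm)
    qed
    from f[OF this] have "(\<lambda>\<alpha>. c \<alpha> * (\<Prod>i\<in>UNIV. (2 * s) ^ \<alpha> i)) summable_on UNIV"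
      by (auto simp: summable_on_def)
    then have "(\<lambda>\<alpha>. \<bar>c \<alpha> * (\<Prod>i\<in>UNIV. (2 * s) ^ \<alpha> i)\<bar>) summable_on UNIV"
      using summable_on_iff_abs_summable_on_real by force
    from summable_on_cmult_left[OF this, of "1 / s"] show ?thesis
      unfolding M_def using s0 by (simp add: abs_mult abs_prod)
  qed
  define u' where "u' \<alpha> x h = (\<Sum>i\<in>UNIV. h $ i * P i \<alpha> x)" for \<alpha> :: "'n \<Rightarrow> nat" and x h :: "real^'n"
  have der: "(u \<alpha> has_derivative u' \<alpha> x) (at x)" for \<alpha> x
  proof -
    have "((\<lambda>x. (x $ i - a $ i) ^ \<alpha> i) has_derivative (\<lambda>h. real (\<alpha> i) * h $ i * (x $ i - a $ i) ^ (\<alpha> i - 1))) (at x)" for i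
    proof -
      have "((\<lambda>x. x $ i - a $ i) has_derivative (\<lambda>h. h $ i)) (at x)"
        by (auto intro!: derivative_eq_intros bounded_linear.has_derivative[OF bounded_linear_vec_nth])
      from has_derivative_power[OF this, of "\<alpha> i"] show ?thesis by simp
    qed
    then have "((\<lambda>x. \<Prod>i\<in>UNIV. (x $ i - a $ i) ^ \<alpha> i) has_derivative 
       (\<lambda>h. \<Sum>i\<in>UNIV. real (\<alpha> i) * h $ i * (x $ i - a $ i) ^ (\<alpha> i - 1) * (\<Prod>j\<in>UNIV - {i}. (x $ j - a $ j) ^ \<alpha> j))) (at x)"
      by (intro has_derivative_prod) auto
    from has_derivative_mult_right[OF this, of "c \<alpha>"] show ?thesis
      unfolding u_def[abs_def] u'_def[abs_def] P_def
      by (rule has_derivative_eq_rhs) (simp add: sum_distrib_left algebra_simps)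
  qed
  have bnd: "\<bar>u' \<alpha> x h\<bar> \<le> (real CARD('n) * M \<alpha>) * norm h" if "x \<in> ball a s" for \<alpha> x h
  proof -
    have "\<bar>u' \<alpha> x h\<bar> \<le> (\<Sum>i\<in>(UNIV::'n set). norm h * M \<alpha>)"
      unfolding u'_def using Pbnd[OF that]
      by (intro order_trans[OF sum_abs] sum_mono) (auto simp: abs_mult component_le_norm_cart intro!: mult_mono)
    then show ?thesis by (simp add: algebra_simps)
  qed
  have sum: "((\<lambda>\<alpha>. u \<alpha> x) has_sum f x) UNIV" if "x \<in> ball a s" for x
    using f[of x] that sr by (auto simp: u_def)
  have M': "(\<lambda>\<alpha>. real CARD('n) * M \<alpha>) summable_on UNIV" using M by (rule summable_on_cmult_right)
  have main: "(f has_derivative (\<lambda>h. \<Sum>\<^sub>\<infinity>\<alpha>. u' \<alpha> x h)) (at x)" if "x \<in> ball a s" for x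
    by (rule has_derivative_has_sum[OF open_ball convex_ball der bnd M' sum that])
  show ?thesis
  proof (rule that[OF s0 sr])
    fix x assume x: "x \<in> ball a s"
    then show "f differentiable at x" using main by (auto simp: differentiable_def)
    fix e :: "real^'n"
    have P: "((\<lambda>\<alpha>. P i \<alpha> x) has_sum (\<Sum>\<^sub>\<infinity>\<alpha>. P i \<alpha> x)) UNIV" for i
    proof -
      have "(\<lambda>\<alpha>. norm (M \<alpha>)) summable_on UNIV" by (rule iffD1[OF summable_on_iff_abs_summable_on_real M])
      then have "(\<lambda>\<alpha>. norm (P i \<alpha> x)) summable_on UNIV"
        by (rule Infinite_Sum.abs_summable_on_comparison_test) (use Pbnd[OF x] order_trans[OF _ abs_ge_self] in \<open>simp, blast\<close>)
      then show ?thesis by (intro has_sum_infsum) (rule Infinite_Sum.abs_summable_summable)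
    qed
    have "dir_deriv e f x = (\<Sum>\<^sub>\<infinity>\<alpha>. u' \<alpha> x e)"
      using frechet_derivative_at[OF main[OF x]] unfolding dir_deriv_def by metis
    also have "\<dots> = (\<Sum>i\<in>UNIV. e $ i * (\<Sum>\<^sub>\<infinity>\<alpha>. P i \<alpha> x))"
      unfolding u'_def by (intro infsumI has_sum_sum has_sum_cmult_right P)
    finally have D: "dir_deriv e f x = (\<Sum>i\<in>UNIV. e $ i * (\<Sum>\<^sub>\<infinity>\<alpha>. P i \<alpha> x))" .
    have Q: "((\<lambda>\<alpha>. real (Suc (\<alpha> i)) * c (\<alpha>(i := Suc (\<alpha> i))) * (\<Prod>i\<in>UNIV. (x $ i - a $ i) ^ \<alpha> i)) has_sum (\<Sum>\<^sub>\<infinity>\<alpha>. P i \<alpha> x)) UNIV" for i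
    proof -
      \<comment> \<open>Differentiation lowers the exponent of coordinate \<open>i\<close>, so the
        series is reindexed by raising it. The terms outside the range of \<open>?S\<close> have
        \<open>\<alpha> i = 0\<close> and vanish through the factor
        \<open>real (\<alpha> i)\<close>.\<close>
      let ?S = "\<lambda>\<alpha>::'n \<Rightarrow> nat. \<alpha>(i := Suc (\<alpha> i))"
      have inj: "inj ?S" by (rule injI) (metis fun_upd_same fun_upd_triv fun_upd_upd nat.inject)
      have "\<alpha> \<in> range ?S" if "\<alpha> i \<noteq> 0" for \<alpha>
        using that by (intro image_eqI[of _ _ "\<alpha>(i := \<alpha> i - 1)"]) auto
      then have "((\<lambda>\<alpha>. P i \<alpha> x) has_sum (\<Sum>\<^sub>\<infinity>\<alpha>. P i \<alpha> x)) (range ?S)"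
        by (subst has_sum_cong_neutral[of UNIV _ _ "\<lambda>\<alpha>. P i \<alpha> x"]) (use P in \<open>auto simp: P_def\<close>)
      then have "((\<lambda>\<alpha>. P i (?S \<alpha>) x) has_sum (\<Sum>\<^sub>\<infinity>\<alpha>. P i \<alpha> x)) UNIV"
        by (subst (asm) has_sum_reindex[OF inj]) (simp add: o_def)
      moreover have "P i (?S \<alpha>) x = real (Suc (\<alpha> i)) * c (?S \<alpha>) * (\<Prod>i\<in>UNIV. (x $ i - a $ i) ^ \<alpha> i)" for \<alpha>
        unfolding P_def using prod.remove[of UNIV i "\<lambda>j. (x $ j - a $ j) ^ \<alpha> j"] by (simp del: of_nat_Suc)
      ultimately show ?thesis by simp
    qed
    have "((\<lambda>\<alpha>. \<Sum>i\<in>UNIV. e $ i * (real (Suc (\<alpha> i)) * c (\<alpha>(i := Suc (\<alpha> i))) * (\<Prod>i\<in>UNIV. (x $ i - a $ i) ^ \<alpha> i)))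
        has_sum (\<Sum>i\<in>UNIV. e $ i * (\<Sum>\<^sub>\<infinity>\<alpha>. P i \<alpha> x))) UNIV"
      by (intro has_sum_sum has_sum_cmult_right Q)
    then show "((\<lambda>\<alpha>. (\<Sum>i\<in>UNIV. e $ i * real (Suc (\<alpha> i)) * c (\<alpha>(i := Suc (\<alpha> i)))) * (\<Prod>i\<in>UNIV. (x $ i - a $ i) ^ \<alpha> i))
         has_sum dir_deriv e f x) UNIV"
      by (simp add: D sum_distrib_right mult.assoc)
  qed
qed

lemma real_analytic_onE:
  assumes "f real_analytic_on U" "a \<in> U"
  obtains r c where "r > 0" "ball a r \<subseteq> U"
    "\<And>x. x \<in> ball a r \<Longrightarrow> ((\<lambda>\<alpha>. c \<alpha> * (\<Prod>i\<in>UNIV. (x $ i - a $ i) ^ \<alpha> i)) has_sum f x) UNIV"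
  using bspec[OF assms(1)[unfolded real_analytic_on_def] assms(2)]
  by (elim exE conjE) (rule that, assumption+, erule bspec)

lemma real_analytic_on_imp_differentiable:
  assumes "f real_analytic_on U" "x \<in> U"
  shows "f differentiable at x"
proof -
  obtain r c where r: "r > 0" "ball x r \<subseteq> U" and
    c: "\<And>y. y \<in> ball x r \<Longrightarrow> ((\<lambda>\<alpha>. c \<alpha> * (\<Prod>i\<in>UNIV. (y $ i - x $ i) ^ \<alpha> i)) has_sum f y) UNIV"
    by (rule real_analytic_onE[OF assms]) (rule that; simp)
  obtain s where "0 < s" "\<And>x'. x' \<in> ball x s \<Longrightarrow> f differentiable at x'"
    by (rule power_series_dir_deriv[OF r(1) c], assumption) (rule that; simp)
  then show ?thesis by simp
qed

lemma real_analytic_on_dir_deriv: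
  assumes "f real_analytic_on U"
  shows "dir_deriv e f real_analytic_on U"
  unfolding real_analytic_on_def
proof
  fix a assume a: "a \<in> U"
  obtain r c where r: "r > 0" "ball a r \<subseteq> U" and
    c: "\<And>x. x \<in> ball a r \<Longrightarrow> ((\<lambda>\<alpha>. c \<alpha> * (\<Prod>i\<in>UNIV. (x $ i - a $ i) ^ \<alpha> i)) has_sum f x) UNIV"
    by (rule real_analytic_onE[OF assms a]) (rule that; simp)
  obtain s where s: "0 < s" "s \<le> r" "\<And>x e. x \<in> ball a s \<Longrightarrow>
      ((\<lambda>\<alpha>. (\<Sum>i\<in>UNIV. e $ i * real (Suc (\<alpha> i)) * c (\<alpha>(i := Suc (\<alpha> i)))) * (\<Prod>i\<in>UNIV. (x $ i - a $ i) ^ \<alpha> i))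
         has_sum dir_deriv e f x) UNIV"
    by (rule power_series_dir_deriv[OF r(1) c], assumption) (rule that; simp)
  have "ball a s \<subseteq> U" using r(2) subset_ball[OF s(2), of a] by blast
  with s(1) show "\<exists>r>0. ball a r \<subseteq> U \<and> (\<exists>c. \<forall>x\<in>ball a r.
      ((\<lambda>\<alpha>. c \<alpha> * (\<Prod>i\<in>UNIV. (x $ i - a $ i) ^ \<alpha> i)) has_sum dir_deriv e f x) UNIV)"
    by (intro exI[of _ s] conjI ballI exI[where x = "\<lambda>\<alpha>. \<Sum>i\<in>UNIV. e $ i * real (Suc (\<alpha> i)) * c (\<alpha>(i := Suc (\<alpha> i)))"] s(3))
qed

section \<open>Directional derivatives and the identity theorem\<close>

lemma real_analytic_on_iter_dir_deriv:
  "f real_analytic_on U \<Longrightarrow> (dir_deriv e ^^ k) f real_analytic_on U"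
  by (induction k) (auto intro: real_analytic_on_dir_deriv)

lemma real_analytic_on_imp_continuous_on: "f real_analytic_on U \<Longrightarrow> continuous_on U f"
  by (meson continuous_at_imp_continuous_on differentiable_imp_continuous_within real_analytic_on_imp_differentiable)

lemma has_real_derivative_line:
  assumes "f differentiable at (x + t *\<^sub>R e)"
  shows "((\<lambda>t. f (x + t *\<^sub>R e)) has_real_derivative dir_deriv e f (x + t *\<^sub>R e)) (at t within S)"
proof -
  let ?D = "frechet_derivative f (at (x + t *\<^sub>R e))"
  have D: "(f has_derivative ?D) (at (x + t *\<^sub>R e))"
    using assms frechet_derivative_works by blast
  have "((\<lambda>t. x + t *\<^sub>R e) has_derivative (\<lambda>h. h *\<^sub>R e)) (at t within S)"
    by (auto intro!: derivative_eq_intros)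
  from has_derivative_compose[OF this D]
  have "((\<lambda>t. f (x + t *\<^sub>R e)) has_derivative (\<lambda>h. ?D (h *\<^sub>R e))) (at t within S)" .
  moreover have "?D (h *\<^sub>R e) = dir_deriv e f (x + t *\<^sub>R e) * h" for h
    using linear_scale[OF has_derivative_linear[OF D]] by (simp add: dir_deriv_def)
  ultimately show ?thesis unfolding has_field_derivative_def by simp
qed

lemma iter_dir_deriv_line:
  assumes "f real_analytic_on U" "x + t *\<^sub>R e \<in> U"
  shows "((\<lambda>t. (dir_deriv e ^^ k) f (x + t *\<^sub>R e)) has_real_derivative (dir_deriv e ^^ Suc k) f (x + t *\<^sub>R e)) (at t within S)"
  using has_real_derivative_line[OF real_analytic_on_imp_differentiable[OF real_analytic_on_iter_dir_deriv[OF assms(1)] assms(2)]]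
  by simp

lemma dir_deriv_locally_const:
  assumes "open S" "\<And>x. x \<in> S \<Longrightarrow> f x = c" "x \<in> S"
  shows "dir_deriv e f x = 0"
proof -
  have "(f has_derivative (\<lambda>_. 0)) (at x)"
    by (rule has_derivative_transform_within_open[OF has_derivative_const[of c] assms(1,3)]) (simp add: assms(2))
  from frechet_derivative_at[OF this] show ?thesis unfolding dir_deriv_def by metis
qed

lemma iter_dir_deriv_locally_const:
  assumes "open S" "\<And>x. x \<in> S \<Longrightarrow> f x = c" "k \<ge> 1"
  shows "\<forall>x\<in>S. (dir_deriv e ^^ k) f x = 0"
  using assms(3)
proof (induction k rule: dec_induct)
  case base
  then show ?case using dir_deriv_locally_const[OF assms(1,2)] by auto
next
  case (step k)
  then show ?case using dir_deriv_locally_const[OF assms(1), of "(dir_deriv e ^^ k) f" 0] by auto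
qed

text \<open>Uniqueness of Taylor coefficients. One differentiation shifts the family
  \<open>D\<close> and replaces \<open>b\<close> by \<open>diffs b\<close>, where
  \<open>fact n * diffs b n = fact (Suc n) * b (Suc n)\<close>.\<close>

lemma higher_deriv_power_series:
  fixes D :: "nat \<Rightarrow> real \<Rightarrow> real"
  assumes "R > 0" "\<And>n t. \<bar>t\<bar> < R \<Longrightarrow> (D n has_real_derivative D (Suc n) t) (at t)"
    and "\<And>t. \<bar>t\<bar> < R \<Longrightarrow> (\<lambda>n. b n * t ^ n) sums D 0 t"
  shows "D n 0 = fact n * b n"
  using assms(2,3)
proof (induction n arbitrary: D b)
  case 0
  from 0(2)[of 0] \<open>R > 0\<close> have "(\<lambda>n. b n * 0 ^ n) sums D 0 0" by simp
  then show ?case using powser_sums_zero_iff[of b "D 0 0"] by simp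
next
  case (Suc n)
  have "(\<lambda>n. diffs b n * t ^ n) sums D 1 t" if "\<bar>t\<bar> < R" for t
    by (rule termdiffs_sums_strong[where K = R and f = "D 0"]) (use Suc.prems that in auto)
  then have "D (Suc n) 0 = fact n * diffs b n"
    using Suc.IH[of "\<lambda>n. D (Suc n)" "diffs b"] Suc.prems(1) by simp
  then show ?case by (simp add: diffs_def)
qed

text \<open>On the segment from \<open>a\<close> to \<open>x\<close> the series becomes a power
  series in one variable whose coefficients are, up to factorials, the derivatives at
  \<open>a\<close> in the direction \<open>x - a\<close>. That only this one direction is consulted
  is what \<open>good_directions\<close> exploits.\<close>

lemma real_analytic_on_eq_centre:
  assumes "f real_analytic_on U" "a \<in> U"
  obtains r where "r > 0" "ball a r \<subseteq> U"
    "\<And>x. x \<in> ball a r \<Longrightarrow> \<forall>k\<ge>1. (dir_deriv (x - a) ^^ k) f a = 0 \<Longrightarrow> f x = f a"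
proof -
  obtain r c where r: "r > 0" "ball a r \<subseteq> U" and
    c: "\<And>x. x \<in> ball a r \<Longrightarrow> ((\<lambda>\<alpha>. c \<alpha> * (\<Prod>i\<in>UNIV. (x $ i - a $ i) ^ \<alpha> i)) has_sum f x) UNIV"
    by (rule real_analytic_onE[OF assms]) (rule that; simp)
  have "f x = f a" if x: "x \<in> ball a r" and D0: "\<forall>k\<ge>1. (dir_deriv (x - a) ^^ k) f a = 0" for x
  proof -
    define e where "e = x - a"
    have in_ball: "a + t *\<^sub>R e \<in> ball a r" if "\<bar>t\<bar> \<le> 1" for t
    proof -
      have "\<bar>t\<bar> * norm e \<le> 1 * norm e" using that by (intro mult_right_mono) auto
      then show ?thesis using x by (simp add: e_def dist_norm norm_minus_commute)
    qed
    define w where "w \<alpha> = c \<alpha> * (\<Prod>i\<in>UNIV. e $ i ^ \<alpha> i)" for \<alpha>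
    \<comment> \<open>The multi-indices of total degree \<open>m\<close>: passing from
      \<open>a + e\<close> to \<open>a + t *\<^sub>R e\<close> multiplies each of their terms by
      \<open>t ^ m\<close>.\<close>
    define B where "B m = {\<alpha> :: 'a \<Rightarrow> nat. sum \<alpha> UNIV = m}" for m
    define b where "b m = (\<Sum>\<^sub>\<infinity>\<alpha>\<in>B m. w \<alpha>)" for m
    have "(w has_sum f x) UNIV" using c[OF x] by (simp add: w_def[abs_def] e_def)
    then have "w summable_on B m" for m by (meson has_sum_imp_summable subset_UNIV summable_on_subset_banach)
    then have wb: "(w has_sum b m) (B m)" for m by (simp add: b_def)
    have ser: "(\<lambda>m. b m * t ^ m) sums f (a + t *\<^sub>R e)" if "\<bar>t\<bar> \<le> 1" for t
    proof -
      have "((\<lambda>\<alpha>. w \<alpha> * t ^ sum \<alpha> UNIV) has_sum f (a + t *\<^sub>R e)) UNIV"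
        using c[OF in_ball[OF that]] by (simp add: w_def power_mult_distrib prod.distrib power_sum mult_ac)
      then have "((\<lambda>(m, \<alpha>). w \<alpha> * t ^ m) has_sum f (a + t *\<^sub>R e)) (Sigma UNIV B)"
        by (subst has_sum_reindex_bij_witness[of _ "\<lambda>\<alpha>. (sum \<alpha> UNIV, \<alpha>)" snd UNIV "\<lambda>\<alpha>. w \<alpha> * t ^ sum \<alpha> UNIV" _ _ "f (a + t *\<^sub>R e)"])
          (auto simp: B_def)
      moreover have "((\<lambda>\<alpha>. case (m, \<alpha>) of (m, \<alpha>) \<Rightarrow> w \<alpha> * t ^ m) has_sum b m * t ^ m) (B m)" for m
        using has_sum_cmult_left[OF wb, where c = "t ^ m"] by simp
      ultimately have "((\<lambda>m. b m * t ^ m) has_sum f (a + t *\<^sub>R e)) UNIV"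
        by (rule has_sum_SigmaD)
      then show ?thesis by (rule has_sum_imp_sums)
    qed
    have "(dir_deriv e ^^ m) f (a + 0 *\<^sub>R e) = fact m * b m" for m
    proof (rule higher_deriv_power_series[where R = 1 and D = "\<lambda>m t. (dir_deriv e ^^ m) f (a + t *\<^sub>R e)"])
      fix n and t :: real assume "\<bar>t\<bar> < 1"
      then have "a + t *\<^sub>R e \<in> U" using in_ball[of t] r(2) by auto
      then show "((\<lambda>t. (dir_deriv e ^^ n) f (a + t *\<^sub>R e)) has_real_derivative (dir_deriv e ^^ Suc n) f (a + t *\<^sub>R e)) (at t)"
        by (rule iter_dir_deriv_line[OF assms(1)])
    qed (use ser in auto)
    then have "b m = 0" if "m \<ge> 1" for m using D0 that by (simp add: e_def)
    then have "(\<lambda>m. b m * t ^ m) = (\<lambda>m. if m = 0 then b 0 else 0)" for t by (auto simp: fun_eq_iff)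
    \<comment> \<open>The derivatives were compared for \<open>\<bar>t\<bar> < 1\<close> only, but
      the series itself is valid up to \<open>t = 1\<close>, which is the point
      \<open>x\<close>.\<close>
    then have "(\<lambda>m. if m = 0 then b 0 else 0) sums f (a + t *\<^sub>R e)" if "\<bar>t\<bar> \<le> 1" for t
      using ser[OF that] by simp
    from this[of 0] this[of 1] show ?thesis by (simp add: e_def) (metis sums_unique2)
  qed
  with r show ?thesis by (rule that)
qed

text \<open>The points where all derivatives of positive order vanish form a relatively closed set
  by continuity, and an open one because \<open>f\<close> is constant near each of them. If the set
  were nonempty it would be \<open>U\<close>, and \<open>f\<close> would be locally
  constant.\<close>

lemma iter_dir_deriv_nonzero_of_nonconstant:
  assumes "open U" "connected U" "f real_analytic_on U" "\<not> f constant_on U" "a \<in> U"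
  shows "\<exists>e k. k \<ge> 1 \<and> (dir_deriv e ^^ k) f a \<noteq> 0"
proof (rule ccontr)
  define S where "S = {x\<in>U. \<forall>e k. k \<ge> 1 \<longrightarrow> (dir_deriv e ^^ k) f x = 0}"
  assume "\<not> ?thesis"
  then have "a \<in> S" using assms by (auto simp: S_def)
  have loc: "\<exists>r>0. ball x r \<subseteq> S \<and> (\<forall>y\<in>ball x r. f y = f x)" if "x \<in> S" for x
  proof -
    have xU: "x \<in> U" using that by (simp add: S_def)
    obtain r where r: "r > 0" "ball x r \<subseteq> U"
      "\<And>y. y \<in> ball x r \<Longrightarrow> \<forall>k\<ge>1. (dir_deriv (y - x) ^^ k) f x = 0 \<Longrightarrow> f y = f x"
      by (rule real_analytic_on_eq_centre[OF assms(3) xU]) (rule that; simp)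
    have c: "f y = f x" if "y \<in> ball x r" for y using r(3)[OF that] \<open>x \<in> S\<close> by (simp add: S_def)
    have "\<forall>y\<in>ball x r. (dir_deriv e ^^ k) f y = 0" if "k \<ge> 1" for e k
      by (rule iter_dir_deriv_locally_const[where f = f and c = "f x", OF open_ball c that])
    with r(2) have "ball x r \<subseteq> S" by (auto simp: S_def)
    with c r(1) show ?thesis by blast
  qed
  have "open S" unfolding open_contains_ball using loc by blast
  have "closedin (top_of_set U) S"
  proof -
    have "closedin (top_of_set U) (U \<inter> (dir_deriv e ^^ k) f -` {0})" for e k
      by (intro continuous_closedin_preimage real_analytic_on_imp_continuous_on real_analytic_on_iter_dir_deriv assms closed_singleton)
    moreover have "S = (\<Inter>(e,k)\<in>UNIV \<times> {1..}. U \<inter> (dir_deriv e ^^ k) f -` {0})" by (auto simp: S_def)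
    ultimately show ?thesis by auto
  qed
  moreover have "openin (top_of_set U) S"
    using \<open>open S\<close> assms(1) by (auto simp: S_def openin_open_eq)
  ultimately have SU: "S = U" using assms(2) \<open>a \<in> S\<close> unfolding connected_clopen by blast
  have "f constant_on U"
  proof (rule locally_constant_imp_constant[OF assms(2)])
    fix x assume "x \<in> U"
    then obtain r where "r > 0" "ball x r \<subseteq> S" "\<forall>y\<in>ball x r. f y = f x" using loc[of x] SU by blast
    moreover from this have "openin (top_of_set U) (ball x r)" using SU open_subset by blast
    ultimately show "\<exists>T. openin (top_of_set U) T \<and> x \<in> T \<and> (\<forall>y\<in>T. f y = f x)"
      by (metis centre_in_ball)
  qed
  with assms show False by blast
qed

text \<open>By \<open>real_analytic_on_eq_centre\<close>, every \<open>y\<close> near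
  \<open>a\<close> with \<open>f y \<noteq> f a\<close> provides the direction \<open>y - a\<close>.
  The set of such \<open>y\<close> is open by continuity and nonempty by the identity theorem, and
  \<open>E\<close> is its translate.\<close>

lemma good_directions:
  assumes "open U" "connected U" "f real_analytic_on U" "\<not> f constant_on U" "a \<in> U"
  obtains E where "open E" "E \<noteq> {}" "\<forall>e\<in>E. \<exists>k\<ge>1. (dir_deriv e ^^ k) f a \<noteq> 0"
proof -
  obtain r where r: "r > 0" "ball a r \<subseteq> U" 
      "\<And>y. y \<in> ball a r \<Longrightarrow> \<forall>k\<ge>1. (dir_deriv (y - a) ^^ k) f a = 0 \<Longrightarrow> f y = f a"
    by (rule real_analytic_on_eq_centre[OF assms(3,5)]) (rule that; simp)
  define V where "V = {y \<in> ball a r. f y \<noteq> f a}"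
  have "open V"
  proof -
    have "continuous_on (ball a r) f"
      using real_analytic_on_imp_continuous_on[OF assms(3)] r(2) continuous_on_subset by blast
    then have "open (ball a r \<inter> f -` (- {f a}))" by (intro continuous_open_preimage) auto
    moreover have "V = ball a r \<inter> f -` (- {f a})" by (auto simp: V_def)
    ultimately show ?thesis by simp
  qed
  moreover have "V \<noteq> {}"
  proof
    assume "V = {}"
    then have c: "f y = f a" if "y \<in> ball a r" for y using that by (auto simp: V_def)
    obtain e k where "k \<ge> 1" "(dir_deriv e ^^ k) f a \<noteq> 0"
      using iter_dir_deriv_nonzero_of_nonconstant[OF assms] by blast
    with iter_dir_deriv_locally_const[OF open_ball c, where k = k and e = e] r(1) show False by simp
  qed
  moreover have "\<exists>k\<ge>1. (dir_deriv e ^^ k) f a \<noteq> 0" if "e \<in> (\<lambda>y. y - a) ` V" for e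
    using that r(3) by (auto simp: V_def)
  ultimately show ?thesis
    using that[of "(\<lambda>y. y - a) ` V"] open_translation_subtract[of V a] by auto
qed

section \<open>Rolle counting and one-dimensional total variation\<close>

text \<open>The bound \<open>Max A\<close> carries the induction: after the largest point of
  \<open>A\<close> is removed, the zeros already found stay at or below the new maximum, so the one
  in the last gap is different from all of them.\<close>

lemma rolle_finite_zeros:
  fixes h h' :: "real \<Rightarrow> real"
  assumes "\<And>s. s \<in> {a..b} \<Longrightarrow> (h has_real_derivative h' s) (at s)"
    and "card A = Suc m" "A \<subseteq> {s\<in>{a..b}. h s = 0}"
  shows "\<exists>B. card B = m \<and> finite B \<and> B \<subseteq> {s\<in>{a..Max A}. h' s = 0}"
  using assms(2,3)
proof (induction m arbitrary: A)
  case 0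
  then show ?case by (intro exI[of _ "{}"]) auto
next
  case (Suc m)
  have fin: "finite A" using Suc.prems(1) card.infinite by fastforce
  define x where "x = Max A"
  have x: "x \<in> A" "\<And>y. y \<in> A \<Longrightarrow> y \<le> x"
    using fin Suc.prems(1) by (auto simp: x_def intro!: Max_in)
  define A' where "A' = A - {x}"
  have cA': "card A' = Suc m" using x Suc.prems(1) fin by (simp add: A'_def)
  then have "A' \<noteq> {}" by auto
  have "finite A'" using fin by (simp add: A'_def)
  define y where "y = Max A'"
  have "y \<in> A'" using Max_in[OF \<open>finite A'\<close> \<open>A' \<noteq> {}\<close>] by (simp add: y_def)
  then have y: "y \<in> A" "y < x" using x(2)[of y] by (auto simp: A'_def)
  obtain B where B: "card B = m" "finite B" "B \<subseteq> {s\<in>{a..y}. h' s = 0}"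
    using Suc.IH[OF cA'] Suc.prems(2) unfolding A'_def y_def by blast
  have "\<exists>z>y. z < x \<and> h x - h y = (x - y) * h' z"
    by (rule MVT2[OF y(2) assms(1)]) (use x y Suc.prems in auto)
  then obtain z where z: "y < z" "z < x" "h x - h y = (x - y) * h' z" by blast
  have "h x = 0" "h y = 0" using x y Suc.prems(2) by auto
  then have "h' z = 0" using z by simp
  moreover have "a \<le> y" using y Suc.prems(2) by auto
  ultimately have "insert z B \<subseteq> {s\<in>{a..x}. h' s = 0}" using B(3) z y by auto
  moreover have "z \<notin> B" using B(3) z by auto
  ultimately show ?case using B by (intro exI[of _ "insert z B"]) (auto simp: x_def)
qed

lemma rolle_card_zeros:
  fixes h h' :: "real \<Rightarrow> real"
  assumes "\<And>s. s \<in> {a..b} \<Longrightarrow> (h has_real_derivative h' s) (at s)"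
    and "finite {s\<in>{a..b}. h' s = 0}" "card {s\<in>{a..b}. h' s = 0} \<le> k"
  shows "finite {s\<in>{a..b}. h s = 0} \<and> card {s\<in>{a..b}. h s = 0} \<le> Suc k"
proof (rule ccontr)
  let ?Z = "{s\<in>{a..b}. h s = 0}"
  assume "\<not> ?thesis"
  then have "\<exists>A\<subseteq>?Z. card A = Suc (Suc k)"
    by (metis (no_types, lifting) infinite_arbitrarily_large not_less_eq_eq obtain_subset_with_card_n)
  then obtain A where A: "A \<subseteq> ?Z" "card A = Suc (Suc k)" by blast
  obtain B where B: "card B = Suc k" "B \<subseteq> {s\<in>{a..Max A}. h' s = 0}"
    using rolle_finite_zeros[OF assms(1) A(2,1)] by blast
  have "Max A \<in> A" using A(2) by (intro Max_in) (auto intro: card_ge_0_finite)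
  then have "B \<subseteq> {s\<in>{a..b}. h' s = 0}" using A(1) B(2) by fastforce
  then have "card B \<le> k" using assms(2,3) card_mono le_trans by blast
  with B(1) show False by simp
qed

lemma card_zeros_of_nonzero_derivative:
  fixes D :: "nat \<Rightarrow> real \<Rightarrow> real"
  assumes "\<And>n s. s \<in> {a..b} \<Longrightarrow> (D n has_real_derivative D (Suc n) s) (at s)"
    and "\<And>s. s \<in> {a..b} \<Longrightarrow> D k s \<noteq> 0"
  shows "finite {s\<in>{a..b}. D 0 s = 0} \<and> card {s\<in>{a..b}. D 0 s = 0} \<le> k"
  using assms
proof (induction k arbitrary: D)
  case 0
  then have "{s\<in>{a..b}. D 0 s = 0} = {}" by auto
  then show ?case by (metis card.empty finite.emptyI le_refl)
next
  case (Suc k)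
  have "finite {s\<in>{a..b}. D 1 s = 0} \<and> card {s\<in>{a..b}. D 1 s = 0} \<le> k"
    using Suc.IH[of "\<lambda>n. D (Suc n)"] Suc.prems by simp
  then show ?case using rolle_card_zeros[of a b "D 0" "D 1" k] Suc.prems(1) by simp
qed

text \<open>A continuous derivative without zeros has constant sign, so the variation is the
  increment of \<open>w\<close>. Differentiability is asked only inside the interval, as the
  derivative may blow up at the ends; hence the fundamental theorem for nonnegative integrands on
  open intervals.\<close>

lemma nn_integral_abs_deriv_one_piece:
  fixes w w' :: "real \<Rightarrow> real"
  assumes ab: "a < b" and cont: "continuous_on {a..b} w"
    and der: "\<And>s. a < s \<Longrightarrow> s < b \<Longrightarrow> (w has_real_derivative w' s) (at s)"
    and cont': "\<And>s. a < s \<Longrightarrow> s < b \<Longrightarrow> isCont w' s"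
    and nz: "\<And>s. a < s \<Longrightarrow> s < b \<Longrightarrow> w' s \<noteq> 0"
  shows "(\<integral>\<^sup>+s. ennreal \<bar>w' s\<bar> * indicator {a..b} s \<partial>lborel) = ennreal \<bar>w b - w a\<bar>"
proof -
  have pos: "(\<integral>\<^sup>+s. ennreal \<bar>w' s\<bar> * indicator {a..b} s \<partial>lborel) = ennreal \<bar>w b - w a\<bar>"
    if cont: "continuous_on {a..b} w"
    and der: "\<And>s. a < s \<Longrightarrow> s < b \<Longrightarrow> (w has_real_derivative w' s) (at s)"
    and cont': "\<And>s. a < s \<Longrightarrow> s < b \<Longrightarrow> isCont w' s"
    and pos: "\<And>s. a < s \<Longrightarrow> s < b \<Longrightarrow> w' s > 0" for w w' :: "real \<Rightarrow> real"
  proof -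
    have la: "(w \<longlongrightarrow> w a) (at_right a)" and lb: "(w \<longlongrightarrow> w b) (at_left b)"
      using cont ab by (auto simp: continuous_on_Icc_at_rightD continuous_on_Icc_at_leftD)
    have si: "set_integrable lborel (einterval (ereal a) (ereal b)) w'"
      and int: "(LBINT s=ereal a..ereal b. w' s) = w b - w a"
    proof -
      have *: "AE s in lborel. ereal a < ereal s \<longrightarrow> ereal s < ereal b \<longrightarrow> 0 \<le> w' s"
        using pos by (auto intro: AE_I2 less_imp_le)
      have **: "((w \<circ> real_of_ereal) \<longlongrightarrow> w a) (at_right (ereal a))" "((w \<circ> real_of_ereal) \<longlongrightarrow> w b) (at_left (ereal b))"
        using la lb by (auto simp: ereal_tendsto_simps)
      show "set_integrable lborel (einterval (ereal a) (ereal b)) w'"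
        by (rule interval_integral_FTC_nonneg(1)[OF _ _ _ * **]) (use ab der cont' in auto)
      show "(LBINT s=ereal a..ereal b. w' s) = w b - w a"
        by (rule interval_integral_FTC_nonneg(2)[OF _ _ _ * **]) (use ab der cont' in auto)
    qed
    have ei: "einterval (ereal a) (ereal b) = {a<..<b}" by (auto simp: einterval_def)
    have eq: "(\<integral>\<^sup>+s. ennreal \<bar>w' s\<bar> * indicator {a..b} s \<partial>lborel)
        = (\<integral>\<^sup>+s. ennreal (indicator {a<..<b} s *\<^sub>R w' s) \<partial>lborel)"
    proof (rule nn_integral_cong_AE)
      have "AE s in lborel. s \<noteq> a \<and> s \<noteq> b" by (intro AE_conjI AE_lborel_singleton)
      then show "AE s in lborel. ennreal \<bar>w' s\<bar> * indicator {a..b} s = ennreal (indicator {a<..<b} s *\<^sub>R w' s)"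
        by eventually_elim (use pos in \<open>auto simp: indicator_def abs_of_pos\<close>)
    qed
    also have "\<dots> = ennreal (LBINT s:{a<..<b}. w' s)"
      unfolding set_lebesgue_integral_def
      by (rule nn_integral_eq_integral)
        (use si pos in \<open>auto simp: ei set_integrable_def indicator_def intro!: AE_I2 less_imp_le\<close>)
    also have "(LBINT s:{a<..<b}. w' s) = w b - w a"
      using int ab by (simp add: interval_lebesgue_integral_def ei)
    also have "w b - w a = \<bar>w b - w a\<bar>"
    proof -
      have "0 \<le> (LBINT s:{a<..<b}. w' s)"
        unfolding set_lebesgue_integral_def
        by (rule integral_nonneg_AE) (use pos in \<open>auto simp: indicator_def intro!: AE_I2 less_imp_le\<close>)
      then show ?thesis using int ab by (simp add: interval_lebesgue_integral_def ei)
    qed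
    finally show ?thesis .
  qed
  have contw': "continuous_on {a<..<b} w'" using cont' by (auto intro!: continuous_at_imp_continuous_on)
  then have conn: "connected (w' ` {a<..<b})" by (intro connected_continuous_image) auto
  consider "\<And>s. a < s \<Longrightarrow> s < b \<Longrightarrow> w' s > 0" | "\<And>s. a < s \<Longrightarrow> s < b \<Longrightarrow> w' s < 0"
  proof (cases "(\<forall>s. a < s \<longrightarrow> s < b \<longrightarrow> w' s > 0) \<or> (\<forall>s. a < s \<longrightarrow> s < b \<longrightarrow> w' s < 0)")
    case False
    then obtain s t where st: "a < s" "s < b" "w' s \<le> 0" "a < t" "t < b" "w' t \<ge> 0"
      by (auto simp: not_less)
    then have "0 \<in> w' ` {a<..<b}"
      using connectedD_interval[OF conn, of "w' s" "w' t" 0] by auto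
    then show ?thesis using nz by fastforce
  qed (use that in blast)
  then show ?thesis
  proof cases
    case 1
    then show ?thesis using pos[OF cont der cont'] by simp
  next
    case 2
    have "(\<integral>\<^sup>+s. ennreal \<bar>- w' s\<bar> * indicator {a..b} s \<partial>lborel) = ennreal \<bar>- w b - (- w a)\<bar>"
      by (rule pos) (use 2 cont der cont' in \<open>auto intro!: continuous_intros derivative_eq_intros\<close>)
    then show ?thesis by (simp add: abs_minus_commute)
  qed
qed

text \<open>The exceptional points inside the interval cut it into one more piece than there are
  points, and on each piece the integral is an increment of \<open>w\<close>, hence at most
  \<open>2 * M\<close>.\<close>

lemma nn_integral_abs_deriv_le:
  fixes w w' :: "real \<Rightarrow> real"
  assumes "a \<le> b" "finite Z" and meas: "w' \<in> borel_measurable borel"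
    and "continuous_on {a..b} w"
    and "\<And>s. a < s \<Longrightarrow> s < b \<Longrightarrow> s \<notin> Z \<Longrightarrow> (w has_real_derivative w' s) (at s)"
    and "\<And>s. a < s \<Longrightarrow> s < b \<Longrightarrow> s \<notin> Z \<Longrightarrow> isCont w' s"
    and "\<And>s. a < s \<Longrightarrow> s < b \<Longrightarrow> s \<notin> Z \<Longrightarrow> w' s \<noteq> 0"
    and "\<And>s. s \<in> {a..b} \<Longrightarrow> \<bar>w s\<bar> \<le> M"
  shows "(\<integral>\<^sup>+s. ennreal \<bar>w' s\<bar> * indicator {a..b} s \<partial>lborel) \<le> ennreal (2 * M * (real (card (Z \<inter> {a<..<b})) + 1))"
  using assms
proof (induction "card (Z \<inter> {a<..<b})" arbitrary: a b rule: less_induct)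
  case less
  have M: "M \<ge> 0" using less.prems(8)[of a] less.prems(1) by fastforce
  show ?case
  proof (cases "Z \<inter> {a<..<b} = {}")
    case True
    show ?thesis
    proof (cases "a = b")
      case True
      have "(\<integral>\<^sup>+s. ennreal \<bar>w' s\<bar> * indicator {a..b} s \<partial>lborel) = (\<integral>\<^sup>+s. 0 \<partial>(lborel :: real measure))"
        using AE_lborel_singleton[of a] by (intro nn_integral_cong_AE) (auto simp: True indicator_def)
      then show ?thesis by simp
    next
      case False
      with less.prems have "a < b" by simp
      moreover have nin: "s \<notin> Z" if "a < s" "s < b" for s using True that by auto
      ultimately have "(\<integral>\<^sup>+s. ennreal \<bar>w' s\<bar> * indicator {a..b} s \<partial>lborel) = ennreal \<bar>w b - w a\<bar>"
        by (intro nn_integral_abs_deriv_one_piece) (use less.prems nin in auto)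
      also have "\<bar>w b - w a\<bar> \<le> 2 * M" using less.prems(8)[of a] less.prems(8)[of b] \<open>a < b\<close> by auto
      finally show ?thesis using True by (simp add: ennreal_leI)
    qed
  next
    case False
    then obtain z where z: "z \<in> Z" "a < z" "z < b" by auto
    let ?n = "\<lambda>a b. card (Z \<inter> {a<..<b})"
    have "Z \<inter> {a<..<b} = insert z ((Z \<inter> {a<..<z}) \<union> (Z \<inter> {z<..<b}))" using z by auto
    then have "?n a b = Suc (card ((Z \<inter> {a<..<z}) \<union> (Z \<inter> {z<..<b})))" using less.prems(2) by simp
    also have "card ((Z \<inter> {a<..<z}) \<union> (Z \<inter> {z<..<b})) = ?n a z + ?n z b"
      using less.prems(2) by (intro card_Un_disjoint) auto
    finally have n: "?n a b = Suc (?n a z + ?n z b)" .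
    have "(\<integral>\<^sup>+s. ennreal \<bar>w' s\<bar> * indicator {a..b} s \<partial>lborel)
       \<le> (\<integral>\<^sup>+s. ennreal \<bar>w' s\<bar> * indicator {a..z} s + ennreal \<bar>w' s\<bar> * indicator {z..b} s \<partial>lborel)"
      by (intro nn_integral_mono) (auto simp: indicator_def)
    also have "\<dots> = (\<integral>\<^sup>+s. ennreal \<bar>w' s\<bar> * indicator {a..z} s \<partial>lborel) + (\<integral>\<^sup>+s. ennreal \<bar>w' s\<bar> * indicator {z..b} s \<partial>lborel)"
      using meas by (intro nn_integral_add) auto
    also have "\<dots> \<le> ennreal (2 * M * (real (?n a z) + 1)) + ennreal (2 * M * (real (?n z b) + 1))"
      using less.prems z n
      by (intro add_mono less.hyps) (auto intro: continuous_on_subset)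
    also have "\<dots> = ennreal (2 * M * (real (?n a b) + 1))"
      using M n by (simp add: ennreal_plus[symmetric] algebra_simps del: ennreal_plus)
    finally show ?thesis .
  qed
qed

section \<open>The reciprocal logarithm in one variable\<close>

text \<open>At \<open>0\<close> both functions take the junk value \<open>0\<close>, since \<open>ln 0 = 0\<close> and \<open>1 / 0 = 0\<close>; for \<open>invlog\<close>
  this is the convention \<open>v = 0\<close> on the zero set.\<close>
definition invlog :: "real \<Rightarrow> real" where "invlog s = 1 / ln \<bar>s\<bar>"

definition invlog' :: "real \<Rightarrow> real" where "invlog' s = - 1 / (s * (ln \<bar>s\<bar>)\<^sup>2)"

lemma invlog_0 [simp]: "invlog 0 = 0" "invlog' 0 = 0"
  by (auto simp: invlog_def invlog'_def)

lemma invlog_nonzero: 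
  assumes "s \<noteq> 0" "\<bar>s\<bar> < 1" shows "invlog s \<noteq> 0" "invlog' s \<noteq> 0"
  using assms by (auto simp: invlog_def invlog'_def)

lemma has_real_derivative_invlog:
  assumes "s \<noteq> 0" "\<bar>s\<bar> < 1" shows "(invlog has_real_derivative invlog' s) (at s)"
proof -
  have "((\<lambda>t. ln \<bar>t\<bar>) has_real_derivative 1 / s) (at s)"
  proof (cases "s > 0")
    case True
    have "(ln has_real_derivative 1 / s) (at s)" using True by (auto intro!: derivative_eq_intros)
    then show ?thesis
      by (rule has_field_derivative_transform_within_open[of _ _ _ "{0<..}"]) (use True in auto)
  next
    case False
    have "((\<lambda>t. ln (- t)) has_real_derivative 1 / s) (at s)"
      using False assms by (auto intro!: derivative_eq_intros simp: field_simps)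
    then show ?thesis
      by (rule has_field_derivative_transform_within_open[of _ _ _ "{..<0}"]) (use False assms in auto)
  qed
  from DERIV_inverse_fun[OF this] show ?thesis
    unfolding invlog_def[abs_def] invlog'_def using assms
    by (simp add: field_simps power2_eq_square)
qed

lemma invlog_nonpos: "\<bar>s\<bar> < 1 \<Longrightarrow> invlog s \<le> 0"
  by (cases "s = 0") (auto simp: invlog_def divide_le_0_iff)

lemma abs_invlog_le:
  assumes "\<bar>s\<bar> < 1 / 2" shows "\<bar>invlog s\<bar> \<le> 1 / ln 2"
proof (cases "s = 0")
  case False
  then have "ln \<bar>s\<bar> < ln (1 / 2)" using assms by (subst ln_less_cancel_iff) auto
  also have "ln (1 / 2 :: real) = - ln 2" by (simp add: ln_div)
  finally show ?thesis using False assms by (auto simp: invlog_def abs_if divide_simps)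
qed simp

lemma isCont_invlog: "\<bar>s\<bar> < 1 \<Longrightarrow> isCont invlog s"
proof (cases "s = 0")
  case True
  have "filterlim (\<lambda>s::real. \<bar>s\<bar>) (at_right 0) (at 0)"
    by (auto simp: filterlim_at eventually_at intro!: tendsto_eq_intros exI[of _ 1])
  then have "filterlim (\<lambda>s::real. ln \<bar>s\<bar>) at_bot (at 0)" by (rule filterlim_compose[OF ln_at_0])
  then have "((\<lambda>s::real. inverse (ln \<bar>s\<bar>)) \<longlongrightarrow> 0) (at 0)"
    by (rule tendsto_inverse_0[THEN filterlim_compose, OF filterlim_mono[OF _ at_bot_le_at_infinity order_refl]])
  then show ?thesis unfolding isCont_def True by (simp add: invlog_def[abs_def] divide_inverse)
qed (use DERIV_isCont has_real_derivative_invlog in blast)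

lemma isCont_invlog': "s \<noteq> 0 \<Longrightarrow> \<bar>s\<bar> < 1 \<Longrightarrow> isCont invlog' s"
  unfolding invlog'_def[abs_def] by (auto intro!: continuous_intros)

lemma borel_measurable_invlog' [measurable]: "invlog' \<in> borel_measurable borel"
  unfolding invlog'_def[abs_def] by measurable

lemma nn_integral_inverse_at_0:
  assumes "d > (0::real)" "c > 0"
  shows "(\<integral>\<^sup>+s. ennreal (c / s) * indicator {0<..d} s \<partial>lborel) = \<infinity>"
proof (rule ccontr)
  let ?I = "\<integral>\<^sup>+s. ennreal (c / s) * indicator {0<..d} s \<partial>lborel"
  assume "?I \<noteq> \<infinity>"
  then obtain r where r: "r \<ge> 0" "?I = ennreal r" by (cases ?I) auto
  \<comment> \<open>Solves \<open>c * (ln d - ln b) = r + 1\<close>, so that the part over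
    \<open>{b..d}\<close> already exceeds the supposed value \<open>r\<close>.\<close>
  define b where "b = d * exp (- ((r + 1) / c))"
  have "exp (- ((r + 1) / c)) \<le> 1" using r assms by simp
  then have b: "0 < b" "b \<le> d" using assms by (auto simp: b_def mult_le_cancel_left1)
  have "(\<integral>\<^sup>+s. ennreal (c / s) * indicator {b..d} s \<partial>lborel) = ennreal (c * ln d - c * ln b)"
    using b assms by (intro nn_integral_FTC_Icc) (auto intro!: derivative_eq_intros)
  also have "c * ln d - c * ln b = r + 1"
    using assms by (simp add: b_def ln_mult field_simps)
  finally have "(\<integral>\<^sup>+s. ennreal (c / s) * indicator {b..d} s \<partial>lborel) = ennreal (r + 1)" .
  moreover have "(\<integral>\<^sup>+s. ennreal (c / s) * indicator {b..d} s \<partial>lborel) \<le> ?I"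
    using b by (intro nn_integral_mono) (auto simp: indicator_def)
  ultimately show False using r by (simp add: ennreal_le_iff)
qed

text \<open>The order \<open>m\<close> of the zero cancels: \<open>D 0\<close> is comparable to
  \<open>s ^ m\<close> and \<open>\<bar>D 1 s\<bar>\<close> is at least of order
  \<open>s ^ (m - 1)\<close>, so their quotient is at least of order \<open>1 / s\<close> for every
  \<open>m\<close>. The squared logarithm is absorbed into a small power of
  \<open>s\<close>.\<close>

lemma nn_integral_invlog_deriv_powr:
  fixes D :: "nat \<Rightarrow> real \<Rightarrow> real"
  assumes d: "d > 0" and D: "\<And>n s. s \<in> {0..d} \<Longrightarrow> (D n has_real_derivative D (Suc n) s) (at s)"
    and zero: "D 0 0 = 0" and k: "\<And>s. s \<in> {0..d} \<Longrightarrow> D k s \<noteq> 0"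
    and bound: "\<And>s. s \<in> {0..d} \<Longrightarrow> \<bar>D 0 s\<bar> < 1"
    and p: "p > 1"
  shows "(\<integral>\<^sup>+s. ennreal (\<bar>invlog' (D 0 s) * D 1 s\<bar> powr p) * indicator {0..d} s \<partial>lborel) = \<infinity>"
proof -
  \<comment> \<open>The order of the zero at \<open>0\<close>: finite because \<open>D k\<close>
    does not vanish there, positive by \<open>zero\<close>.\<close>
  define m where "m = (LEAST m. D m 0 \<noteq> 0)"
  have "D k 0 \<noteq> 0" using k d by simp
  then have m: "D m 0 \<noteq> 0" "\<And>j. j < m \<Longrightarrow> D j 0 = 0"
    unfolding m_def by (rule LeastI, use not_less_Least in blast)
  with zero have "m > 0" by (cases m) auto
  \<comment> \<open>Near \<open>0\<close>, by continuity, \<open>\<bar>D m s\<bar>\<close> lies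
    between \<open>c\<close> and \<open>3 * c\<close>, half and three halves of its value at
    \<open>0\<close>.\<close>
  define c where "c = \<bar>D m 0\<bar> / 2"
  have c: "c > 0" using m(1) by (simp add: c_def)
  have "isCont (D m) 0" using D[of 0 m] d DERIV_isCont by auto
  then have "((\<lambda>s. \<bar>D m s\<bar>) \<longlongrightarrow> 2 * c) (at 0)" unfolding c_def isCont_def by (auto intro!: tendsto_eq_intros)
  then have "\<forall>\<^sub>F s in at 0. \<bar>D m s\<bar> > c \<and> \<bar>D m s\<bar> < 3 * c"
    using c by (intro eventually_conj order_tendstoD) auto
  then obtain e where e: "e > 0" "\<And>s. s \<noteq> 0 \<Longrightarrow> \<bar>s\<bar> < e \<Longrightarrow> \<bar>D m s\<bar> > c \<and> \<bar>D m s\<bar> < 3 * c"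
    unfolding eventually_at by (auto simp: dist_real_def)
  define h where "h = min (min d (e / 2)) 1"
  have h: "h > 0" "h \<le> d" "h < e" "h \<le> 1" using d e by (auto simp: h_def)
  define A where "A = c / fact m"
  have A: "A > 0" using c by (simp add: A_def)
  have D0: "A * s ^ m < \<bar>D 0 s\<bar>" "\<bar>D 0 s\<bar> < 3 * A * s ^ m" if s: "0 < s" "s \<le> h" for s
  proof -
    have "\<exists>t. 0 < t \<and> t < s \<and> D 0 s = (\<Sum>j<m. D j 0 / fact j * s ^ j) + D m t / fact m * s ^ m"
      by (rule Maclaurin) (use s h D \<open>m > 0\<close> in auto)
    then obtain t where t: "0 < t" "t < s" "D 0 s = D m t / fact m * s ^ m" using m(2) by auto
    have "\<bar>D m t\<bar> > c" "\<bar>D m t\<bar> < 3 * c" using e(2)[of t] t s h by auto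
    then show "A * s ^ m < \<bar>D 0 s\<bar>" "\<bar>D 0 s\<bar> < 3 * A * s ^ m"
      using s unfolding t(3) by (auto simp: A_def abs_mult power_abs field_simps)
  qed
  have D1: "A * real m * s ^ (m - 1) \<le> \<bar>D 1 s\<bar>" if s: "0 < s" "s \<le> h" for s
  proof -
    obtain n where n: "m = Suc n" using \<open>m > 0\<close> by (cases m) auto
    have "\<exists>t. 0 < t \<and> t \<le> s \<and> D 1 s = (\<Sum>j<n. D (Suc j) 0 / fact j * s ^ j) + D m t / fact n * s ^ n"
      unfolding n by (rule Maclaurin2[where diff = "\<lambda>j. D (Suc j)"]) (use s h D in auto)
    then obtain t where t: "0 < t" "t \<le> s" "D 1 s = D m t / fact n * s ^ n" using m(2) n by auto
    have "\<bar>D m t\<bar> > c" using e(2)[of t] t s h by auto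
    then have "c / fact n * s ^ n \<le> \<bar>D m t\<bar> / fact n * s ^ n"
      using s by (intro mult_right_mono divide_right_mono) auto
    moreover have "A * real m = c / fact n" by (simp add: A_def n field_simps del: of_nat_Suc)
    ultimately show ?thesis
      using s unfolding t(3) by (simp add: n abs_mult power_abs)
  qed
  \<comment> \<open>The exponent that is sacrificed to the logarithm. It has to be positive with
    \<open>(2 * a - 1) * p \<le> - 1\<close>; this choice makes the left side equal to
    \<open>- (p + 1) / 2\<close>. Here \<open>p > 1\<close> is decisive.\<close>
  define a where "a = (p - 1) / (4 * p)"
  have a: "a > 0" using p by (simp add: a_def)
  \<comment> \<open>Collects
    \<open>\<bar>ln y\<bar> \<le> \<bar>ln A\<bar> + real m * (- ln s)\<close> into a multiple of
    \<open>s powr (- a)\<close>, by \<open>- ln s \<le> s powr (- a) / a\<close> and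
    \<open>1 \<le> s powr (- a)\<close>.\<close>
  define B where "B = \<bar>ln A\<bar> + real m / a"
  have B: "B > 0" using a \<open>m > 0\<close> by (simp add: B_def add_nonneg_pos)
  have low: "(1 / (3 * B\<^sup>2)) powr p / s \<le> \<bar>invlog' (D 0 s) * D 1 s\<bar> powr p" if s: "0 < s" "s \<le> h" for s
  proof -
    define y where "y = \<bar>D 0 s\<bar>"
    have y: "0 < y" "y < 1" "A * s ^ m < y" "y < 3 * A * s ^ m"
      using D0[OF s] A s bound[of s] h by (auto simp: y_def intro: le_less_trans[OF _ D0(1)[OF s]])
    have "ln (A * s ^ m) \<le> ln y" using y A s by (intro ln_mono) auto
    then have "\<bar>ln y\<bar> \<le> - (ln A + real m * ln s)"
      using y A s by (simp add: ln_mult ln_realpow)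
    moreover have "- ln s \<le> s powr (- a) / a"
    proof -
      have "1 / s \<ge> 1" using s h by simp
      from ln_powr_bound[OF this a] show ?thesis
        using s by (simp add: ln_div powr_divide powr_minus_divide)
    qed
    then have "- (real m * ln s) \<le> real m * (s powr (- a) / a)"
      using mult_left_mono[of "- ln s" "s powr (- a) / a" "real m"] by simp
    moreover have one: "1 \<le> s powr (- a)" using s h a by (simp add: powr_minus_divide powr_le1)
    then have "\<bar>ln A\<bar> * 1 \<le> \<bar>ln A\<bar> * s powr (- a)" by (intro mult_left_mono) auto
    ultimately have lny: "\<bar>ln y\<bar> \<le> B * s powr (- a)" by (simp add: B_def algebra_simps)
    \<comment> \<open>Rewritten as a quotient for \<open>frac_le\<close>: its numerator is a lower
      bound of \<open>\<bar>D 1 s\<bar>\<close> and its denominator an upper bound of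
      \<open>y * (ln y)\<^sup>2\<close>.\<close>
    have "1 / (3 * B\<^sup>2) * s powr (2 * a - 1) = (A * s ^ (m - 1)) / (3 * A * s ^ m * (B * s powr (- a))\<^sup>2)"
    proof -
      have "s ^ m = s * s ^ (m - 1)" using \<open>m > 0\<close> by (simp add: power_eq_if)
      moreover have "s powr (2 * a - 1) = 1 / (s * (s powr (- a))\<^sup>2)"
        using s by (simp add: powr_diff powr_minus power2_eq_square powr_add[symmetric] field_simps)
      ultimately show ?thesis using s A B by (simp add: field_simps power_mult_distrib)
    qed
    also have "\<dots> \<le> \<bar>D 1 s\<bar> / (y * (ln y)\<^sup>2)"
    proof (rule frac_le)
      have "A * 1 * s ^ (m - 1) \<le> A * real m * s ^ (m - 1)"
        using A s \<open>m > 0\<close> by (intro mult_right_mono mult_left_mono) auto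
      then show "A * s ^ (m - 1) \<le> \<bar>D 1 s\<bar>" using D1[OF s] by simp
      show "0 < y * (ln y)\<^sup>2" using y by auto
      have "(ln y)\<^sup>2 \<le> (B * s powr (- a))\<^sup>2" using lny by (metis abs_ge_zero power2_abs power_mono)
      then show "y * (ln y)\<^sup>2 \<le> 3 * A * s ^ m * (B * s powr (- a))\<^sup>2"
        using y by (intro mult_mono) auto
    qed auto
    also have "\<dots> = \<bar>invlog' (D 0 s) * D 1 s\<bar>"
      by (simp add: invlog'_def y_def abs_mult)
    finally have "(1 / (3 * B\<^sup>2) * s powr (2 * a - 1)) powr p \<le> \<bar>invlog' (D 0 s) * D 1 s\<bar> powr p"
      using p B by (intro powr_mono2) auto
    moreover have "(1 / (3 * B\<^sup>2) * s powr (2 * a - 1)) powr p = (1 / (3 * B\<^sup>2)) powr p * s powr ((2 * a - 1) * p)"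
      using powr_mult[of "1 / (3 * B\<^sup>2)" "s powr (2 * a - 1)" p] by (simp add: powr_powr)
    moreover have "s powr (- 1) \<le> s powr ((2 * a - 1) * p)"
    proof -
      have "(2 * a - 1) * p = - (p + 1) / 2" using p by (simp add: a_def field_simps)
      then have "(2 * a - 1) * p \<le> - 1" using p by simp
      then show ?thesis using s h by (intro powr_mono') auto
    qed
    then have "(1 / (3 * B\<^sup>2)) powr p * s powr (- 1) \<le> (1 / (3 * B\<^sup>2)) powr p * s powr ((2 * a - 1) * p)"
      by (intro mult_left_mono) auto
    ultimately show ?thesis using s by (simp add: powr_minus_divide)
  qed
  have "(\<integral>\<^sup>+s. ennreal ((1 / (3 * B\<^sup>2)) powr p / s) * indicator {0<..h} s \<partial>lborel)
      \<le> (\<integral>\<^sup>+s. ennreal (\<bar>invlog' (D 0 s) * D 1 s\<bar> powr p) * indicator {0..d} s \<partial>lborel)"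
    using low h by (intro nn_integral_mono) (auto simp: indicator_def intro!: ennreal_leI)
  then show ?thesis using nn_integral_inverse_at_0[OF h(1), of "(1 / (3 * B\<^sup>2)) powr p"] B
    by (simp add: top_unique)
qed

section \<open>Local integrability of the derivative\<close>

lemma nn_integral_lborel_translate:
  fixes G :: "'a::euclidean_space \<Rightarrow> ennreal"
  assumes [measurable]: "G \<in> borel_measurable borel"
  shows "(\<integral>\<^sup>+x. G (x + c) \<partial>lborel) = (\<integral>\<^sup>+x. G x \<partial>lborel)"
proof -
  have "(\<integral>\<^sup>+x. G x \<partial>lborel) = (\<integral>\<^sup>+x. G x \<partial>distr lborel borel ((+) c))"
    by (simp add: lborel_distr_plus)
  also have "\<dots> = (\<integral>\<^sup>+x. G (c + x) \<partial>lborel)" by (subst nn_integral_distr) auto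
  finally show ?thesis by (simp add: add.commute)
qed

text \<open>Fubini and translation invariance. Averaging over all translates of one segment replaces
  slicing by lines parallel to \<open>e\<close>, which would call for a change of coordinates that
  makes \<open>e\<close> an axis.\<close>

lemma nn_integral_lborel_segments:
  fixes G :: "'a::euclidean_space \<Rightarrow> ennreal"
  assumes [measurable]: "G \<in> borel_measurable borel" and "a \<le> b"
  shows "(\<integral>\<^sup>+x. (\<integral>\<^sup>+s. G (x + s *\<^sub>R e) * indicator {a..b} s \<partial>lborel) \<partial>lborel) = ennreal (b - a) * (\<integral>\<^sup>+x. G x \<partial>lborel)"
proof -
  have "(\<integral>\<^sup>+x. (\<integral>\<^sup>+s. G (x + s *\<^sub>R e) * indicator {a..b} s \<partial>lborel) \<partial>lborel)
      = (\<integral>\<^sup>+s. (\<integral>\<^sup>+x. G (x + s *\<^sub>R e) * indicator {a..b} s \<partial>lborel) \<partial>(lborel :: real measure))"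
    by (rule lborel_pair.Fubini') measurable
  also have "\<dots> = (\<integral>\<^sup>+s. (\<integral>\<^sup>+x. G x \<partial>lborel) * indicator {a..b} s \<partial>lborel)"
    by (simp add: nn_integral_multc nn_integral_lborel_translate)
  also have "\<dots> = ennreal (b - a) * (\<integral>\<^sup>+x. G x \<partial>lborel)"
    using assms(2) by (simp add: nn_integral_cmult mult.commute)
  finally show ?thesis .
qed

lemma ball_borel_measurable [measurable]: "ball (a :: 'a::metric_space) r \<in> sets borel"
  by simp

locale small_analytic =
  fixes U :: "(real^'n) set" and f :: "real^'n \<Rightarrow> real"
  assumes open_U: "open U" and connected_U: "connected U"
    and analytic: "f real_analytic_on U" and nonconst: "\<not> f constant_on U"
    and small: "\<And>x. x \<in> U \<Longrightarrow> \<bar>f x\<bar> < 1/2"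
begin

text \<open>The function \<open>v\<close> extended by \<open>0\<close> off \<open>U\<close>, which
  makes it Borel on the whole space, so that integrals over \<open>U\<close> become integrals with
  respect to \<open>lborel\<close>.\<close>

definition V :: "real^'n \<Rightarrow> real" where "V x = (if x \<in> U then invlog (f x) else 0)"

text \<open>The classical derivative of \<open>V\<close> in direction \<open>e\<close> off the zero
  set, and the candidate for the weak one. On the zero set it is \<open>0\<close> by the junk value
  of \<open>invlog'\<close>.\<close>

definition dV :: "real^'n \<Rightarrow> real^'n \<Rightarrow> real"
  where "dV e x = (if x \<in> U then invlog' (f x) * dir_deriv e f x else 0)"

lemma U_borel [measurable]: "U \<in> sets borel" using open_U by simp

lemma f_cont: "continuous_on U f" using analytic by (rule real_analytic_on_imp_continuous_on)

lemma df_cont: "continuous_on U (dir_deriv e f)"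
  by (intro real_analytic_on_imp_continuous_on real_analytic_on_dir_deriv analytic)

lemma V_cont: "continuous_on U V"
proof -
  have "continuous_on U (\<lambda>x. invlog (f x))"
    by (rule continuous_on_compose2[OF _ f_cont, of "{-1<..<1}"])
      (use small in \<open>force intro!: continuous_at_imp_continuous_on isCont_invlog\<close>)+
  then show ?thesis by (rule continuous_on_eq) (simp add: V_def)
qed

lemma abs_V_le: "\<bar>V x\<bar> \<le> 1 / ln 2"
  using abs_invlog_le[OF small] by (auto simp: V_def)

lemma V_measurable [measurable]: "V \<in> borel_measurable borel"
proof -
  have "continuous_on U (\<lambda>x. invlog (f x))" using V_cont by (rule continuous_on_eq) (simp add: V_def)
  then have "(\<lambda>x. if x \<in> U then invlog (f x) else 0) \<in> borel_measurable borel"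
    by (intro borel_measurable_continuous_on_if) auto
  then show ?thesis by (simp add: V_def[abs_def])
qed

lemma dV_measurable [measurable]: "dV e \<in> borel_measurable borel"
proof -
  have [measurable]: "(\<lambda>x. if x \<in> U then f x else 0) \<in> borel_measurable borel"
     "(\<lambda>x. if x \<in> U then dir_deriv e f x else 0) \<in> borel_measurable borel"
    by (intro borel_measurable_continuous_on_if f_cont df_cont; simp)+
  have "dV e = (\<lambda>x. invlog' (if x \<in> U then f x else 0) * (if x \<in> U then dir_deriv e f x else 0))"
    by (auto simp: dV_def)
  then show ?thesis by simp
qed

text \<open>Linearity in the form in which an arbitrary direction is recovered from two good
  ones.\<close>

lemma dV_linear: "dV (c *\<^sub>R (e - e')) x = c * (dV e x - dV e' x)"
proof (cases "x \<in> U")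
  case True
  then have "linear (frechet_derivative f (at x))"
    using analytic linear_frechet_derivative real_analytic_on_imp_differentiable by blast
  then have "dir_deriv (c *\<^sub>R (e - e')) f x = c * (dir_deriv e f x - dir_deriv e' f x)"
    by (simp only: dir_deriv_def linear_scale linear_diff real_scaleR_def)
  then show ?thesis by (simp add: dV_def right_diff_distrib mult.left_commute del: scaleR_right_diff_distrib)
qed (simp add: dV_def)

lemma nn_integral_dV_segment_le:
  assumes seg: "\<And>s. s \<in> {\<alpha>..\<beta>} \<Longrightarrow> x + s *\<^sub>R e \<in> U \<and> (dir_deriv e ^^ k) f (x + s *\<^sub>R e) \<noteq> 0"
    and k: "k \<ge> 1" and "\<alpha> \<le> \<beta>"
  shows "(\<integral>\<^sup>+s. ennreal \<bar>dV e (x + s *\<^sub>R e)\<bar> * indicator {\<alpha>..\<beta>} s \<partial>lborel) \<le> ennreal (2 / ln 2 * (2 * real k + 1))"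
proof -
  define D where "D n s = (dir_deriv e ^^ n) f (x + s *\<^sub>R e)" for n s
  have D: "(D n has_real_derivative D (Suc n) s) (at s)" if "s \<in> {\<alpha>..\<beta>}" for n s
    unfolding D_def using iter_dir_deriv_line[OF analytic] seg that by blast
  have nz: "D k s \<noteq> 0" if "s \<in> {\<alpha>..\<beta>}" for s using seg that by (simp add: D_def)
  \<comment> \<open>The break points: at zeros of \<open>D 0\<close> the composite may fail to be
    differentiable, at zeros of \<open>D 1\<close> its monotonicity may change. Their number is
    bounded in terms of \<open>k\<close> alone, so the estimate does not depend on
    \<open>x\<close>.\<close>
  define Z0 where "Z0 = {s \<in> {\<alpha>..\<beta>}. D 0 s = 0}"
  define Z1 where "Z1 = {s \<in> {\<alpha>..\<beta>}. D 1 s = 0}"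
  have Z0: "finite Z0" "card Z0 \<le> k"
    using card_zeros_of_nonzero_derivative[of \<alpha> \<beta> D k] D nz by (auto simp: Z0_def)
  have Z1: "finite Z1" "card Z1 \<le> k - 1"
    using card_zeros_of_nonzero_derivative[of \<alpha> \<beta> "\<lambda>n. D (Suc n)" "k - 1"] D nz k by (auto simp: Z1_def)
  have small: "\<bar>D 0 s\<bar> < 1 / 2" if "s \<in> {\<alpha>..\<beta>}" for s
    using seg[OF that] small by (simp add: D_def)
  have w': "dV e (x + s *\<^sub>R e) = invlog' (D 0 s) * D 1 s" if "s \<in> {\<alpha>..\<beta>}" for s
    using seg[OF that] by (simp add: dV_def D_def)
  have "(\<integral>\<^sup>+s. ennreal \<bar>dV e (x + s *\<^sub>R e)\<bar> * indicator {\<alpha>..\<beta>} s \<partial>lborel)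
      \<le> ennreal (2 * (1 / ln 2) * (real (card ((Z0 \<union> Z1) \<inter> {\<alpha><..<\<beta>})) + 1))"
  proof (rule nn_integral_abs_deriv_le[where w = "\<lambda>s. invlog (D 0 s)"])
    show "(\<lambda>s. dV e (x + s *\<^sub>R e)) \<in> borel_measurable borel" by measurable
    have "isCont (\<lambda>s. invlog (D 0 s)) s" if "s \<in> {\<alpha>..\<beta>}" for s
      using small[OF that] DERIV_isCont[OF D[OF that]] by (intro isCont_o2[where g = invlog and f = "D 0"] isCont_invlog) auto
    then show "continuous_on {\<alpha>..\<beta>} (\<lambda>s. invlog (D 0 s))"
      by (intro continuous_at_imp_continuous_on) auto
    show "\<bar>invlog (D 0 s)\<bar> \<le> 1 / ln 2" if "s \<in> {\<alpha>..\<beta>}" for s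
      by (intro abs_invlog_le small that)
    fix s assume s: "\<alpha> < s" "s < \<beta>" "s \<notin> Z0 \<union> Z1"
    then have s': "s \<in> {\<alpha>..\<beta>}" "D 0 s \<noteq> 0" "D 1 s \<noteq> 0" by (auto simp: Z0_def Z1_def)
    have "((\<lambda>s. invlog (D 0 s)) has_real_derivative invlog' (D 0 s) * D 1 s) (at s)"
      using DERIV_chain2[OF has_real_derivative_invlog D[OF s'(1), of 0]] s' small[OF s'(1)] by simp
    then show "((\<lambda>s. invlog (D 0 s)) has_real_derivative dV e (x + s *\<^sub>R e)) (at s)"
      by (simp add: w'[OF s'(1)])
    show "dV e (x + s *\<^sub>R e) \<noteq> 0"
      using s' small[OF s'(1)] by (simp add: w'[OF s'(1)] invlog_nonzero)
    have "isCont (\<lambda>s. invlog' (D 0 s) * D 1 s) s"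
      using small[OF s'(1)] s' DERIV_isCont[OF D[OF s'(1)]]
      by (intro continuous_mult isCont_o2[where g = invlog' and f = "D 0"] isCont_invlog') auto
    moreover have "\<forall>\<^sub>F s in nhds s. dV e (x + s *\<^sub>R e) = invlog' (D 0 s) * D 1 s"
      using s w' by (intro eventually_nhds_in_open[of "{\<alpha><..<\<beta>}", THEN eventually_mono]) auto
    ultimately show "isCont (\<lambda>s. dV e (x + s *\<^sub>R e)) s" by (simp add: isCont_cong)
  qed (use Z0 Z1 assms in auto)
  also have "card ((Z0 \<union> Z1) \<inter> {\<alpha><..<\<beta>}) \<le> 2 * k"
  proof -
    have "card ((Z0 \<union> Z1) \<inter> {\<alpha><..<\<beta>}) \<le> card (Z0 \<union> Z1)" using Z0 Z1 by (intro card_mono) auto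
    also have "\<dots> \<le> card Z0 + card Z1" by (rule card_Un_le)
    finally show ?thesis using Z0 Z1 by linarith
  qed
  then have "ennreal (2 * (1 / ln 2) * (real (card ((Z0 \<union> Z1) \<inter> {\<alpha><..<\<beta>})) + 1)) \<le> ennreal (2 / ln 2 * (2 * real k + 1))"
    by (intro ennreal_leI) (simp add: divide_right_mono)
  finally show ?thesis .
qed

lemma iter_dir_deriv_nonzero_cball:
  assumes "a \<in> U" "(dir_deriv e ^^ k) f a \<noteq> 0"
  obtains R where "R > 0" "cball a R \<subseteq> U" "\<And>x. x \<in> cball a R \<Longrightarrow> (dir_deriv e ^^ k) f x \<noteq> 0"
proof -
  have "continuous_on U ((dir_deriv e ^^ k) f)"
    by (intro real_analytic_on_imp_continuous_on real_analytic_on_iter_dir_deriv analytic)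
  then have "open (U \<inter> (dir_deriv e ^^ k) f -` (- {0}))"
    using open_U by (intro continuous_open_preimage) auto
  then obtain R where "R > 0" "cball a R \<subseteq> U \<inter> (dir_deriv e ^^ k) f -` (- {0})"
    using assms unfolding open_contains_cball by blast
  then show ?thesis by (intro that[of R]) auto
qed

text \<open>The segment estimate is uniform in the base point, so its average over base points,
  computed by \<open>nn_integral_lborel_segments\<close>, bounds the integral over the ball.\<close>

lemma nn_integral_dV_ball_good:
  assumes a: "a \<in> U" and k: "k \<ge> 1" "(dir_deriv e ^^ k) f a \<noteq> 0"
  shows "\<exists>r>0. (\<integral>\<^sup>+x. ennreal \<bar>dV e x\<bar> * indicator (ball a r) x \<partial>lborel) < \<infinity>"
proof -
  obtain R where R: "R > 0" "cball a R \<subseteq> U" "\<And>x. x \<in> cball a R \<Longrightarrow> (dir_deriv e ^^ k) f x \<noteq> 0"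
    by (rule iter_dir_deriv_nonzero_cball[OF a k(2)]) (rule that; simp)
  \<comment> \<open>Shifts along the segments have length at most \<open>r\<close>. Hence a segment
    that meets \<open>ball a r\<close> starts in \<open>cball a (2 * r)\<close>, and a segment that
    starts there stays in \<open>cball a R\<close>.\<close>
  define r where "r = R / 3"
  define d where "d = r / (norm e + 1)"
  have r: "r > 0" "3 * r = R" using R(1) by (auto simp: r_def)
  have "0 < norm e + 1" by (simp add: add_nonneg_pos)
  then have d: "d > 0" "d * norm e \<le> r" using r by (simp_all add: d_def pos_divide_le_eq)
  have shift: "norm (s *\<^sub>R e) \<le> r" if "s \<in> {0..d}" for s
  proof -
    have "s * norm e \<le> d * norm e" using that by (intro mult_right_mono) auto
    then show ?thesis using that d by simp
  qed
  define C where "C = ennreal (2 / ln 2 * (2 * real k + 1))"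
  define I where "I = (\<integral>\<^sup>+x. ennreal \<bar>dV e x\<bar> * indicator (ball a r) x \<partial>lborel)"
  have "ennreal (d - 0) * I = (\<integral>\<^sup>+x. (\<integral>\<^sup>+s. ennreal \<bar>dV e (x + s *\<^sub>R e)\<bar> * indicator (ball a r) (x + s *\<^sub>R e) * indicator {0..d} s \<partial>lborel) \<partial>lborel)"
    unfolding I_def by (rule nn_integral_lborel_segments[symmetric]) (measurable, use d in linarith)
  also have "\<dots> \<le> (\<integral>\<^sup>+x. C * indicator (cball a (2 * r)) x \<partial>lborel)"
  proof (intro nn_integral_mono)
    fix x
    show "(\<integral>\<^sup>+s. ennreal \<bar>dV e (x + s *\<^sub>R e)\<bar> * indicator (ball a r) (x + s *\<^sub>R e) * indicator {0..d} s \<partial>lborel)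
      \<le> C * indicator (cball a (2 * r)) x"
    proof (cases "x \<in> cball a (2 * r)")
      case True
      have "x + s *\<^sub>R e \<in> cball a R" if "s \<in> {0..d}" for s
        using True shift[OF that] norm_triangle_ineq[of "x - a" "s *\<^sub>R e"] r
        by (simp add: dist_norm norm_minus_commute add_diff_eq algebra_simps)
      then have *: "x + s *\<^sub>R e \<in> U \<and> (dir_deriv e ^^ k) f (x + s *\<^sub>R e) \<noteq> 0" if "s \<in> {0..d}" for s
        using R that by blast
      have "(\<integral>\<^sup>+s. ennreal \<bar>dV e (x + s *\<^sub>R e)\<bar> * indicator (ball a r) (x + s *\<^sub>R e) * indicator {0..d} s \<partial>lborel)
         \<le> (\<integral>\<^sup>+s. ennreal \<bar>dV e (x + s *\<^sub>R e)\<bar> * indicator {0..d} s \<partial>lborel)"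
        by (intro nn_integral_mono) (auto simp: indicator_def)
      also have "\<dots> \<le> C" unfolding C_def using * k d by (intro nn_integral_dV_segment_le) auto
      finally show ?thesis using True by simp
    next
      case False
      have "x + s *\<^sub>R e \<notin> ball a r" if "s \<in> {0..d}" for s
      proof
        assume "x + s *\<^sub>R e \<in> ball a r"
        then have "norm (x + s *\<^sub>R e - a) < r" by (simp add: dist_norm norm_minus_commute)
        then have "norm (x - a) < 2 * r"
          using shift[OF that] norm_triangle_ineq4[of "x + s *\<^sub>R e - a" "s *\<^sub>R e"] by (simp add: algebra_simps)
        with False show False by (simp add: dist_norm norm_minus_commute)
      qed
      then have "(\<integral>\<^sup>+s. ennreal \<bar>dV e (x + s *\<^sub>R e)\<bar> * indicator (ball a r) (x + s *\<^sub>R e) * indicator {0..d} s \<partial>lborel)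
        = (\<integral>\<^sup>+s. 0 \<partial>(lborel::real measure))"
        by (intro nn_integral_cong) (auto simp: indicator_def)
      then show ?thesis by simp
    qed
  qed
  also have "\<dots> = C * emeasure lborel (cball a (2 * r))"
    by (rule nn_integral_cmult_indicator) simp
  also have "\<dots> < \<infinity>"
    using emeasure_bounded_finite[OF bounded_cball, of a "2 * r"] by (simp add: C_def ennreal_mult_less_top less_top)
  finally have "ennreal d * I < \<infinity>" by simp
  then have "I < \<infinity>" using d by (auto simp: ennreal_mult_less_top)
  then show ?thesis using r unfolding I_def by blast
qed

text \<open>For small \<open>c\<close> both \<open>e\<close> and \<open>e + c *\<^sub>R b\<close>
  are good directions, and \<open>b\<close> is their difference divided by \<open>c\<close>.\<close>

lemma nn_integral_dV_ball:
  assumes a: "a \<in> U"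
  shows "\<exists>r>0. (\<integral>\<^sup>+x. ennreal \<bar>dV b x\<bar> * indicator (ball a r) x \<partial>lborel) < \<infinity>"
proof -
  obtain E where E: "open E" "E \<noteq> {}" "\<forall>e\<in>E. \<exists>k\<ge>1. (dir_deriv e ^^ k) f a \<noteq> 0"
    by (rule good_directions[OF open_U connected_U analytic nonconst a])
  then obtain e t where e: "e \<in> E" "t > 0" "cball e t \<subseteq> E"
    by (meson ex_in_conv open_contains_cball)
  define c where "c = t / (norm b + 1)"
  have "0 < norm b + 1" by (simp add: add_nonneg_pos)
  then have c: "c > 0" "c * norm b \<le> t" using e(2) by (simp_all add: c_def pos_divide_le_eq)
  have e': "e + c *\<^sub>R b \<in> E" using e(3) c by (auto simp: dist_norm)
  obtain r where r: "r > 0" "(\<integral>\<^sup>+x. ennreal \<bar>dV e x\<bar> * indicator (ball a r) x \<partial>lborel) < \<infinity>"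
    using bspec[OF E(3) e(1)] nn_integral_dV_ball_good[OF a] by blast
  obtain r' where r': "r' > 0" "(\<integral>\<^sup>+x. ennreal \<bar>dV (e + c *\<^sub>R b) x\<bar> * indicator (ball a r') x \<partial>lborel) < \<infinity>"
    using bspec[OF E(3) e'] nn_integral_dV_ball_good[OF a] by blast
  let ?r = "min r r'"
  have dV: "dV b x = 1 / c * (dV (e + c *\<^sub>R b) x - dV e x)" for x
    using dV_linear[of "1 / c" "e + c *\<^sub>R b" e x] c by simp
  have "(\<integral>\<^sup>+x. ennreal \<bar>dV b x\<bar> * indicator (ball a ?r) x \<partial>lborel)
     \<le> (\<integral>\<^sup>+x. ennreal (1 / c) * (ennreal \<bar>dV (e + c *\<^sub>R b) x\<bar> * indicator (ball a r') x + ennreal \<bar>dV e x\<bar> * indicator (ball a r) x) \<partial>lborel)"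
  proof (intro nn_integral_mono)
    fix x
    have "\<bar>dV b x\<bar> \<le> 1 / c * (\<bar>dV (e + c *\<^sub>R b) x\<bar> + \<bar>dV e x\<bar>)"
      unfolding dV abs_mult using c by (intro mult_mono) auto
    then have "ennreal \<bar>dV b x\<bar> \<le> ennreal (1 / c) * (ennreal \<bar>dV (e + c *\<^sub>R b) x\<bar> + ennreal \<bar>dV e x\<bar>)"
      using c by (subst ennreal_plus[symmetric]; simp add: ennreal_mult'[symmetric] ennreal_leI del: ennreal_plus)
    then show "ennreal \<bar>dV b x\<bar> * indicator (ball a ?r) x \<le> ennreal (1 / c) * (ennreal \<bar>dV (e + c *\<^sub>R b) x\<bar> * indicator (ball a r') x + ennreal \<bar>dV e x\<bar> * indicator (ball a r) x)"
      by (simp add: indicator_def)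
  qed
  also have "\<dots> = ennreal (1 / c) * ((\<integral>\<^sup>+x. ennreal \<bar>dV (e + c *\<^sub>R b) x\<bar> * indicator (ball a r') x \<partial>lborel) + (\<integral>\<^sup>+x. ennreal \<bar>dV e x\<bar> * indicator (ball a r) x \<partial>lborel))"
    by (subst nn_integral_cmult, measurable, subst nn_integral_add, measurable)
  also have "\<dots> < \<infinity>" using r r' by (simp add: ennreal_mult_less_top)
  finally show ?thesis using r r' by (intro exI[of _ ?r]) auto
qed

lemma nn_integral_dV_compact:
  assumes K: "compact K" "K \<subseteq> U"
  shows "(\<integral>\<^sup>+x. ennreal \<bar>dV b x\<bar> * indicator K x \<partial>lborel) < \<infinity>"
proof -
  have "\<forall>a\<in>U. \<exists>r>0. (\<integral>\<^sup>+x. ennreal \<bar>dV b x\<bar> * indicator (ball a r) x \<partial>lborel) < \<infinity>"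
    using nn_integral_dV_ball by blast
  then obtain r where r: "\<And>a. a \<in> U \<Longrightarrow> r a > 0"
    "\<And>a. a \<in> U \<Longrightarrow> (\<integral>\<^sup>+x. ennreal \<bar>dV b x\<bar> * indicator (ball a (r a)) x \<partial>lborel) < \<infinity>"
    by metis
  have "K \<subseteq> (\<Union>a\<in>K. ball a (r a))" using r(1) K(2) by force
  then obtain T where T: "T \<subseteq> K" "finite T" "K \<subseteq> (\<Union>a\<in>T. ball a (r a))"
    by (rule compactE_image[OF K(1), of K "\<lambda>a. ball a (r a)", rotated]) (auto intro: that)
  have "(\<integral>\<^sup>+x. ennreal \<bar>dV b x\<bar> * indicator K x \<partial>lborel)
      \<le> (\<integral>\<^sup>+x. (\<Sum>a\<in>T. ennreal \<bar>dV b x\<bar> * indicator (ball a (r a)) x) \<partial>lborel)"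
  proof (intro nn_integral_mono)
    fix x
    show "ennreal \<bar>dV b x\<bar> * indicator K x \<le> (\<Sum>a\<in>T. ennreal \<bar>dV b x\<bar> * indicator (ball a (r a)) x)"
    proof (cases "x \<in> K")
      case True
      then obtain a where "a \<in> T" "x \<in> ball a (r a)" using T by blast
      then show ?thesis
        using member_le_sum[of a T "\<lambda>a. ennreal \<bar>dV b x\<bar> * indicator (ball a (r a)) x"] T True by simp
    qed simp
  qed
  also have "\<dots> = (\<Sum>a\<in>T. \<integral>\<^sup>+x. ennreal \<bar>dV b x\<bar> * indicator (ball a (r a)) x \<partial>lborel)"
    by (rule nn_integral_sum) measurable
  also have "\<dots> < \<infinity>" using r(2) T K by (auto simp: less_top[symmetric])
  finally show ?thesis .
qed

end

section \<open>Integration by parts\<close>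

lemma dir_deriv_eq: "(g has_derivative g') (at x) \<Longrightarrow> dir_deriv e g x = g' e"
  using frechet_derivative_at unfolding dir_deriv_def by metis

lemma integrable_continuous_compact_support:
  fixes g :: "'a::euclidean_space \<Rightarrow> real"
  assumes "compact K" "continuous_on UNIV g" "\<And>x. x \<notin> K \<Longrightarrow> g x = 0"
  shows "integrable lborel g"
proof -
  have "integrable lborel (\<lambda>x. indicator K x *\<^sub>R g x)"
    using assms by (intro borel_integrable_compact) (auto intro: continuous_on_subset)
  then show ?thesis by (rule Bochner_Integration.integrable_cong[THEN iffD1, rotated 2]) (use assms(3) in \<open>auto simp: indicator_def\<close>)
qed

lemma bounded_continuous_compact_support:
  fixes g :: "'a::euclidean_space \<Rightarrow> real"
  assumes "compact K" "continuous_on K g" "\<And>x. x \<notin> K \<Longrightarrow> g x = 0"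
  obtains B where "B \<ge> 0" "\<forall>x. \<bar>g x\<bar> \<le> B"
proof -
  have "bounded (g ` K)" by (intro compact_imp_bounded compact_continuous_image assms)
  then obtain B where "\<forall>x\<in>K. \<bar>g x\<bar> \<le> B" by (auto simp: bounded_iff)
  then have "\<bar>g x\<bar> \<le> \<bar>B\<bar>" for x using assms(3)[of x] by (cases "x \<in> K") force+
  then show ?thesis by (intro that[of "\<bar>B\<bar>"]) auto
qed

lemma integral_lborel_translate:
  fixes G :: "'a::euclidean_space \<Rightarrow> real"
  assumes [measurable]: "G \<in> borel_measurable borel"
  shows "(LINT x|lborel. G (x + c)) = (LINT x|lborel. G x)"
    and "integrable lborel G \<Longrightarrow> integrable lborel (\<lambda>x. G (x + c))"
proof -
  have "(LINT x|lborel. G x) = (LINT x|distr lborel borel ((+) c). G x)"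
    by (simp add: lborel_distr_plus)
  also have "\<dots> = (LINT x|lborel. G (c + x))" by (rule integral_distr) auto
  finally show "(LINT x|lborel. G (x + c)) = (LINT x|lborel. G x)" by (simp add: add.commute)
  assume "integrable lborel G"
  then have "integrable (distr lborel borel ((+) c)) G" by (simp add: lborel_distr_plus)
  then show "integrable lborel (\<lambda>x. G (x + c))"
    by (subst (asm) integrable_distr_eq) (auto simp: add.commute)
qed

text \<open>By translation invariance every difference quotient has integral zero. The mean value
  theorem bounds the quotients by \<open>C\<close>, so dominated convergence passes this on to the
  derivative, which is assumed bounded but not continuous.\<close>

lemma integral_dir_deriv_compact_support:
  fixes g :: "'a::euclidean_space \<Rightarrow> real"
  assumes K: "compact K" and diff: "\<And>x. g differentiable at x" and supp: "\<And>x. x \<notin> K \<Longrightarrow> g x = 0"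
    and bnd: "\<And>x. \<bar>dir_deriv e g x\<bar> \<le> C"
  shows "(LINT x|lborel. dir_deriv e g x) = 0"
proof -
  have cont: "continuous_on UNIV g"
    using diff by (intro continuous_at_imp_continuous_on) (auto simp: differentiable_imp_continuous_within)
  then have [measurable]: "g \<in> borel_measurable borel" by (rule borel_measurable_continuous_onI)
  have int: "integrable lborel g" by (rule integrable_continuous_compact_support[OF K cont supp])
  define t where "t n = 1 / real (Suc n)" for n
  have t: "t n > 0" "t n \<le> 1" for n by (auto simp: t_def)
  have t0: "t \<longlonglongrightarrow> 0" unfolding t_def by (rule LIMSEQ_Suc) (rule lim_1_over_n)
  define s where "s n x = (g (x + t n *\<^sub>R e) - g x) / t n" for n x
  have line: "((\<lambda>t. g (x + t *\<^sub>R e)) has_real_derivative dir_deriv e g (x + u *\<^sub>R e)) (at u)" for x u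
    by (rule has_real_derivative_line[OF diff])
  have lim: "(\<lambda>n. s n x) \<longlonglongrightarrow> dir_deriv e g x" for x
  proof -
    have A: "((\<lambda>h. (g (x + (0 + h) *\<^sub>R e) - g (x + 0 *\<^sub>R e)) / h) \<longlongrightarrow> dir_deriv e g (x + 0 *\<^sub>R e)) (at 0)"
      using line[of x 0] unfolding DERIV_def .
    have B: "filterlim t (at 0) sequentially"
      using t0 t by (auto simp: filterlim_at less_imp_neq[symmetric] intro!: always_eventually)
    show ?thesis using filterlim_compose[OF A B] by (simp add: s_def)
  qed
  obtain R where R: "\<And>x. x \<in> K \<Longrightarrow> norm x \<le> R"
    using compact_imp_bounded[OF K] by (auto simp: bounded_iff)
  have C: "C \<ge> 0" using bnd[of undefined] by linarith
  \<comment> \<open>Since \<open>t n \<le> 1\<close>, the quotients all vanish outside the ball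
    obtained by enlarging one around \<open>K\<close> by \<open>norm e\<close>.\<close>
  have bound: "norm (s n x) \<le> C * indicator (cball 0 (R + norm e)) x" for n x
  proof (cases "norm x \<le> R + norm e")
    case True
    obtain z where "g (x + t n *\<^sub>R e) - g (x + 0 *\<^sub>R e) = (t n - 0) * dir_deriv e g (x + z *\<^sub>R e)"
      using MVT2[OF t(1)[of n], of "\<lambda>t. g (x + t *\<^sub>R e)" "\<lambda>u. dir_deriv e g (x + u *\<^sub>R e)"] line by blast
    then have "s n x = dir_deriv e g (x + z *\<^sub>R e)" using t(1)[of n] by (simp add: s_def)
    with bnd True show ?thesis by simp
  next
    case False
    have "norm (t n *\<^sub>R e) \<le> norm e" using t[of n] by (simp add: mult_left_le_one_le)
    then have "norm (x + t n *\<^sub>R e) > R" using False norm_triangle_ineq4[of "x + t n *\<^sub>R e" "t n *\<^sub>R e"] by simp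
    then have "g (x + t n *\<^sub>R e) = 0" using R supp by (metis not_le)
    moreover have "norm x > R" using False norm_ge_zero[of e] by linarith
    then have "g x = 0" using R supp by (metis not_le)
    ultimately show ?thesis using False by (simp add: s_def)
  qed
  have [measurable]: "s n \<in> borel_measurable borel" for n unfolding s_def by measurable
  have [measurable]: "dir_deriv e g \<in> borel_measurable borel"
    by (rule borel_measurable_LIMSEQ_real[OF lim]) measurable
  have "(\<lambda>n. LINT x|lborel. s n x) \<longlonglongrightarrow> (LINT x|lborel. dir_deriv e g x)"
  proof (rule integral_dominated_convergence[where w = "\<lambda>x. C * indicator (cball 0 (R + norm e)) x"])
    show "integrable lborel (\<lambda>x::'a. C * indicator (cball 0 (R + norm e)) x)"
      using emeasure_bounded_finite[OF bounded_cball] by (intro integrable_mult_right integrable_real_indicator) (auto simp: less_top)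
  qed (use lim bound in auto)
  moreover have "(LINT x|lborel. s n x) = 0" for n
    unfolding s_def using int by (simp add: integral_lborel_translate)
  ultimately show ?thesis by (simp add: LIMSEQ_const_iff)
qed

section \<open>Truncation of the identity near zero\<close>

lemma has_real_derivative_max_0_square:
  "((\<lambda>t::real. (max 0 t)\<^sup>2) has_real_derivative 2 * max 0 t) (at t)"
proof -
  consider "t > 0" | "t < 0" | "t = 0" by linarith
  then show ?thesis
  proof cases
    case 1
    have "((\<lambda>t::real. t\<^sup>2) has_real_derivative 2 * t) (at t)" by (auto intro!: derivative_eq_intros)
    then show ?thesis
      using has_field_derivative_transform_within_open[of "\<lambda>t::real. t\<^sup>2" "2 * t" t "{0<..}" "\<lambda>t. (max 0 t)\<^sup>2"] 1 by simp
  next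
    case 2
    have "((\<lambda>t::real. 0) has_real_derivative 0) (at t)" by simp
    then show ?thesis
      using has_field_derivative_transform_within_open[of "\<lambda>t::real. 0" "0" t "{..<0}" "\<lambda>t. (max 0 t)\<^sup>2"] 2 by simp
  next
    case 3
    have "((\<lambda>h::real. (max 0 h)\<^sup>2 / h) \<longlongrightarrow> 0) (at 0)"
    proof (rule Lim_null_comparison)
      show "\<forall>\<^sub>F h::real in at 0. norm ((max 0 h)\<^sup>2 / h) \<le> \<bar>h\<bar>"
        by (intro always_eventually) (auto simp: max_def power2_eq_square)
      show "((\<lambda>h::real. \<bar>h\<bar>) \<longlongrightarrow> 0) (at 0)" by (auto intro!: tendsto_eq_intros)
    qed
    then show ?thesis unfolding 3 DERIV_def by simp
  qed
qed

text \<open>A \<open>C\<^sup>1\<close> truncation of the identity, equal to \<open>y - 2 d + d\<^sup>2 / y\<close> for \<open>y > d\<close>, with derivative in \<open>[0, 1]\<close>: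
  the truncated function is therefore dominated without any estimate on the logarithm.\<close>
definition trunc :: "real \<Rightarrow> real \<Rightarrow> real" where "trunc d y = (max 0 (y - d))\<^sup>2 / y"

definition trunc' :: "real \<Rightarrow> real \<Rightarrow> real"
  where "trunc' d y = (2 * max 0 (y - d) * y - (max 0 (y - d))\<^sup>2) / y\<^sup>2"

lemma has_real_derivative_trunc: "y > 0 \<Longrightarrow> (trunc d has_real_derivative trunc' d y) (at y)"
  unfolding trunc_def[abs_def] trunc'_def
  by (rule DERIV_cong[OF DERIV_divide[OF DERIV_chain2[OF has_real_derivative_max_0_square] DERIV_ident]])
    (auto intro!: derivative_eq_intros simp: power2_eq_square)

lemma trunc_eq_0: "y \<le> d \<Longrightarrow> trunc d y = 0" "y \<le> d \<Longrightarrow> trunc' d y = 0"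
  by (auto simp: trunc_def trunc'_def)

lemma trunc'_bounds: "d \<ge> 0 \<Longrightarrow> y \<ge> 0 \<Longrightarrow> \<bar>trunc' d y\<bar> \<le> 1"
proof (cases "y \<le> d")
  case False
  assume "d \<ge> 0" "y \<ge> 0"
  with False have y: "y > d" "y > 0" by auto
  have "trunc' d y = (y\<^sup>2 - d\<^sup>2) / y\<^sup>2"
    using y by (simp add: trunc'_def power2_eq_square algebra_simps)
  moreover have "d\<^sup>2 \<le> y\<^sup>2" using y \<open>d \<ge> 0\<close> by (intro power_mono) auto
  ultimately show ?thesis using y by (simp add: divide_le_eq)
qed (simp add: trunc_eq_0)

lemma trunc_bounds: "d \<ge> 0 \<Longrightarrow> y \<ge> 0 \<Longrightarrow> \<bar>trunc d y\<bar> \<le> y"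
proof (cases "y \<le> d")
  case False
  assume "d \<ge> 0" "y \<ge> 0"
  with False have y: "y > d" "y > 0" by auto
  then have "(y - d)\<^sup>2 \<le> y\<^sup>2" using \<open>d \<ge> 0\<close> by (intro power_mono) auto
  then show ?thesis using y by (simp add: trunc_def divide_le_eq power2_eq_square)
qed (simp add: trunc_eq_0)

lemma isCont_trunc': "y > 0 \<Longrightarrow> isCont (trunc' d) y"
  unfolding trunc'_def[abs_def] by (auto intro!: continuous_intros)

lemma tendsto_trunc:
  assumes "y > 0" "d \<longlonglongrightarrow> 0"
  shows "(\<lambda>n. trunc (d n) y) \<longlonglongrightarrow> y" "(\<lambda>n. trunc' (d n) y) \<longlonglongrightarrow> 1"
proof -
  have m: "(\<lambda>n. max 0 (y - d n)) \<longlonglongrightarrow> max 0 (y - 0)"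
    by (intro tendsto_intros assms)
  show "(\<lambda>n. trunc (d n) y) \<longlonglongrightarrow> y"
    unfolding trunc_def using assms(1) by (rule_tac tendsto_eq_rhs[OF tendsto_divide[OF tendsto_power[OF m] tendsto_const]]) (auto simp: power2_eq_square)
  show "(\<lambda>n. trunc' (d n) y) \<longlonglongrightarrow> 1"
    unfolding trunc'_def using assms(1)
    by (rule_tac tendsto_eq_rhs[OF tendsto_divide[OF tendsto_diff[OF tendsto_mult[OF tendsto_mult[OF tendsto_const m] tendsto_const] tendsto_power[OF m]] tendsto_const]])
      (auto simp: power2_eq_square)
qed

section \<open>Truncations of \<open>V\<close> and the passage to the limit\<close>

context small_analytic
begin

lemma V_nonpos: "V x \<le> 0"
  using invlog_nonpos[of "f x"] small[of x] by (auto simp: V_def)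

lemma V_eq_0_iff: "x \<in> U \<Longrightarrow> V x = 0 \<longleftrightarrow> f x = 0"
  using invlog_nonzero(1)[of "f x"] small[of x] by (auto simp: V_def)

lemma dV_eq_0: "V x = 0 \<Longrightarrow> dV e x = 0"
  using V_eq_0_iff[of x] by (cases "x \<in> U") (simp_all add: dV_def)

lemma V_has_derivative:
  assumes "x \<in> U" "f x \<noteq> 0"
  shows "(V has_derivative (\<lambda>h. dV h x)) (at x)"
proof -
  have D: "(f has_derivative frechet_derivative f (at x)) (at x)"
    using analytic assms frechet_derivative_works real_analytic_on_imp_differentiable by blast
  have "(invlog has_derivative (\<lambda>h. invlog' (f x) * h)) (at (f x))"
    using has_real_derivative_invlog[OF assms(2)] small[OF assms(1)] by (simp add: has_field_derivative_def)
  from has_derivative_compose[OF D this]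
  have "((\<lambda>x. invlog (f x)) has_derivative (\<lambda>h. dV h x)) (at x)"
    using assms(1) by (simp add: dV_def dir_deriv_def)
  then show ?thesis
    by (rule has_derivative_transform_within_open[OF _ open_U assms(1)]) (simp add: V_def)
qed

text \<open>On \<open>T\<close> the truncation at level \<open>d\<close> is identically zero, which
  makes it continuously differentiable across the zero set.\<close>

lemma trunc_V_near_zero:
  assumes "d > 0" "x \<in> U" "f x = 0"
  obtains T where "open T" "x \<in> T" "T \<subseteq> U" "\<forall>y\<in>T. - V y \<le> d"
proof -
  have "open (U \<inter> V -` {-d<..})" using V_cont open_U by (intro continuous_open_preimage) auto
  moreover have "V x = 0" using assms V_eq_0_iff by simp
  ultimately show ?thesis using assms by (intro that[of "U \<inter> V -` {-d<..}"]) auto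
qed

text \<open>One formula serves both cases: on the zero set, where \<open>V\<close> itself may have
  no derivative, the truncation is locally zero and \<open>dV\<close> is zero by
  \<open>dV_eq_0\<close>.\<close>

lemma trunc_V_has_derivative:
  assumes d: "d > 0" and x: "x \<in> U"
  shows "((\<lambda>x. - trunc d (- V x)) has_derivative (\<lambda>h. trunc' d (- V x) * dV h x)) (at x)"
proof (cases "f x = 0")
  case True
  obtain T where T: "open T" "x \<in> T" "T \<subseteq> U" "\<forall>y\<in>T. - V y \<le> d"
    by (rule trunc_V_near_zero[OF d x True])
  have "((\<lambda>x. 0::real) has_derivative (\<lambda>h. 0)) (at x)" by simp
  then have "((\<lambda>x. - trunc d (- V x)) has_derivative (\<lambda>h. 0)) (at x)"
    by (rule has_derivative_transform_within_open[OF _ T(1,2)]) (use T(4) in \<open>simp add: trunc_eq_0\<close>)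
  then show ?thesis using True x by (simp add: dV_eq_0 V_eq_0_iff)
next
  case False
  then have pos: "- V x > 0" using V_nonpos[of x] V_eq_0_iff[OF x] by simp
  have D: "((\<lambda>x. - V x) has_derivative (\<lambda>h. - dV h x)) (at x)"
    using V_has_derivative[OF x False] by (rule has_derivative_minus)
  have "(trunc d has_derivative (\<lambda>h. trunc' d (- V x) * h)) (at (- V x))"
    using has_real_derivative_trunc[OF pos] by (simp add: has_field_derivative_def)
  from has_derivative_minus[OF has_derivative_compose[OF D this]] show ?thesis by simp
qed

lemma trunc_dV_cont:
  assumes d: "d > 0"
  shows "continuous_on U (\<lambda>x. trunc' d (- V x) * dV e x)"
proof (rule continuous_at_imp_continuous_on, rule ballI)
  fix x assume x: "x \<in> U"
  show "isCont (\<lambda>x. trunc' d (- V x) * dV e x) x"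
  proof (cases "f x = 0")
    case True
    obtain T where T: "open T" "x \<in> T" "T \<subseteq> U" "\<forall>y\<in>T. - V y \<le> d"
      by (rule trunc_V_near_zero[OF d x True])
    have "\<forall>\<^sub>F y in nhds x. trunc' d (- V y) * dV e y = 0"
      by (rule eventually_mono[OF eventually_nhds_in_open[OF T(1,2)]]) (use T(4) in \<open>simp add: trunc_eq_0\<close>)
    then show ?thesis by (subst isCont_cong[where g = "\<lambda>_. 0"]) auto
  next
    case False
    then have pos: "- V x > 0" using V_nonpos[of x] V_eq_0_iff[OF x] by simp
    have fx: "isCont f x" "isCont (dir_deriv e f) x" "isCont V x"
      using f_cont df_cont V_cont open_U x by (auto simp: continuous_on_eq_continuous_at)
    have c: "isCont (\<lambda>x. trunc' d (- V x) * (invlog' (f x) * dir_deriv e f x)) x"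
    proof (intro continuous_mult fx(2))
      show "isCont (\<lambda>x. trunc' d (- V x)) x"
        by (rule isCont_o2[OF continuous_minus[OF fx(3)] isCont_trunc'[OF pos]])
      show "isCont (\<lambda>x. invlog' (f x)) x"
        using small[OF x] by (intro isCont_o2[OF fx(1) isCont_invlog'] False) auto
    qed
    have ev: "\<forall>\<^sub>F y in nhds x. trunc' d (- V y) * dV e y = trunc' d (- V y) * (invlog' (f y) * dir_deriv e f y)"
      by (rule eventually_mono[OF eventually_nhds_in_open[OF open_U x]]) (simp add: dV_def)
    show ?thesis by (rule iffD2[OF isCont_cong[OF ev] c])
  qed
qed

lemma trunc_V_parts:
  assumes d: "d > 0" and K: "compact K" "K \<subseteq> U"
    and diff: "\<And>x. \<phi> differentiable at x" and supp: "\<And>x. x \<notin> K \<Longrightarrow> \<phi> x = 0"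
    and cont: "continuous_on UNIV (dir_deriv e \<phi>)"
  shows "(LINT x|lborel. trunc' d (- V x) * dV e x * \<phi> x - trunc d (- V x) * dir_deriv e \<phi> x) = 0"
proof -
  \<comment> \<open>Two signs, because \<open>V \<le> 0\<close> whereas \<open>trunc\<close> is made
    for nonnegative arguments; \<open>v\<close> approximates \<open>V\<close>.\<close>
  define v where "v x = - trunc d (- V x)" for x
  have supp': "dir_deriv e \<phi> x = 0" if "x \<notin> K" for x
    by (rule dir_deriv_locally_const[of "- K" \<phi> 0]) (use K supp that in \<open>auto simp: compact_imp_closed open_Compl\<close>)
  have D: "((\<lambda>x. v x * \<phi> x) has_derivative
      (\<lambda>h. v x * frechet_derivative \<phi> (at x) h + trunc' d (- V x) * dV h x * \<phi> x)) (at x)" if "x \<in> U" for x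
    using has_derivative_mult[OF trunc_V_has_derivative[OF d that] diff[of x, unfolded frechet_derivative_works]]
    unfolding v_def .
  have D0: "((\<lambda>x. v x * \<phi> x) has_derivative (\<lambda>h. 0)) (at x)" if "x \<notin> K" for x
    by (rule has_derivative_transform_within_open[OF has_derivative_const[of 0], of "- K"])
       (use K supp that in \<open>auto simp: compact_imp_closed open_Compl\<close>)
  have deq: "dir_deriv e (\<lambda>x. v x * \<phi> x) x = trunc' d (- V x) * dV e x * \<phi> x + v x * dir_deriv e \<phi> x" for x
  proof (cases "x \<in> K")
    case True
    then have "x \<in> U" using K by blast
    from dir_deriv_eq[OF D[OF this], of e] show ?thesis by (simp add: dir_deriv_def)
  next
    case False
    from dir_deriv_eq[OF D0[OF False], of e] False supp supp' show ?thesis by simp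
  qed
  have "continuous_on U v"
    using trunc_V_has_derivative[OF d] unfolding v_def
    by (intro continuous_at_imp_continuous_on ballI has_derivative_continuous) 
  moreover have contphi: "continuous_on UNIV \<phi>"
    using diff by (intro continuous_at_imp_continuous_on) (auto simp: differentiable_imp_continuous_within)
  ultimately have "continuous_on K (\<lambda>x. trunc' d (- V x) * dV e x * \<phi> x + v x * dir_deriv e \<phi> x)"
    using K cont
    by (intro continuous_on_add continuous_on_mult[OF continuous_on_subset[OF trunc_dV_cont[OF d, of e]]]
        continuous_on_mult[of K v]) (auto intro: continuous_on_subset)
  then obtain C where C: "\<forall>x. \<bar>trunc' d (- V x) * dV e x * \<phi> x + v x * dir_deriv e \<phi> x\<bar> \<le> C"
    by (rule bounded_continuous_compact_support[OF K(1)]) (simp add: supp supp')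
  have "(LINT x|lborel. dir_deriv e (\<lambda>x. v x * \<phi> x) x) = 0"
  proof (rule integral_dir_deriv_compact_support[OF K(1)])
    show "(\<lambda>x. v x * \<phi> x) differentiable at x" for x
      using D[of x] D0[of x] K unfolding differentiable_def by blast
  qed (use supp C deq in auto)
  then show ?thesis unfolding deq by (simp add: v_def)
qed

lemma integrable_dV_compact:
  assumes "compact K" "K \<subseteq> U"
  shows "integrable lborel (\<lambda>x. indicator K x * \<bar>dV e x\<bar>)"
proof (rule integrableI_bounded)
  have [measurable]: "K \<in> sets borel" using assms by (simp add: compact_imp_closed)
  show "(\<lambda>x. indicator K x * \<bar>dV e x\<bar>) \<in> borel_measurable lborel" by measurable
  have "(\<integral>\<^sup>+x. ennreal (norm (indicator K x * \<bar>dV e x\<bar>)) \<partial>lborel) = (\<integral>\<^sup>+x. ennreal \<bar>dV e x\<bar> * indicator K x \<partial>lborel)"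
    by (intro nn_integral_cong) (auto simp: indicator_def)
  then show "(\<integral>\<^sup>+x. ennreal (norm (indicator K x * \<bar>dV e x\<bar>)) \<partial>lborel) < \<infinity>"
    using nn_integral_dV_compact[OF assms] by simp
qed

text \<open>The truncation level tends to \<open>0\<close> in \<open>trunc_V_parts\<close>. At
  points with \<open>V x = 0\<close> all truncated integrands and their limit vanish; elsewhere
  \<open>tendsto_trunc\<close> applies.\<close>

lemma V_integration_by_parts:
  assumes K: "compact K" "K \<subseteq> U"
    and diff: "\<And>x. \<phi> differentiable at x" and supp: "\<And>x. x \<notin> K \<Longrightarrow> \<phi> x = 0"
    and cont: "continuous_on UNIV (dir_deriv e \<phi>)"
  shows "(LINT x|lborel. V x * dir_deriv e \<phi> x) = - (LINT x|lborel. dV e x * \<phi> x)"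
proof -
  have [measurable]: "K \<in> sets borel" using K by (simp add: compact_imp_closed)
  have supp': "dir_deriv e \<phi> x = 0" if "x \<notin> K" for x
    by (rule dir_deriv_locally_const[of "- K" \<phi> 0]) (use K supp that in \<open>auto simp: compact_imp_closed open_Compl\<close>)
  have contphi: "continuous_on UNIV \<phi>"
    using diff by (intro continuous_at_imp_continuous_on) (auto simp: differentiable_imp_continuous_within)
  then have [measurable]: "\<phi> \<in> borel_measurable borel" "dir_deriv e \<phi> \<in> borel_measurable borel"
    using cont by (auto intro: borel_measurable_continuous_onI)
  obtain B where B: "B \<ge> 0" "\<forall>x. \<bar>\<phi> x\<bar> \<le> B"
    by (rule bounded_continuous_compact_support[OF K(1) continuous_on_subset[OF contphi subset_UNIV] supp], assumption)
  obtain B' where B': "B' \<ge> 0" "\<forall>x. \<bar>dir_deriv e \<phi> x\<bar> \<le> B'"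
    by (rule bounded_continuous_compact_support[OF K(1) continuous_on_subset[OF cont subset_UNIV] supp'], assumption)
  define d where "d n = 1 / real (Suc n)" for n
  have d: "d n > 0" for n by (auto simp: d_def)
  have d0: "d \<longlonglongrightarrow> 0" unfolding d_def by (rule LIMSEQ_Suc) (rule lim_1_over_n)
  \<comment> \<open>A majorant for all levels at once, from
    \<open>\<bar>trunc' d y\<bar> \<le> 1\<close> and \<open>\<bar>trunc d y\<bar> \<le> y\<close>
    with \<open>y = - V x \<le> 1 / ln 2\<close>. Its integrability is where the local integrability
    of \<open>dV\<close> enters.\<close>
  define w where "w x = B * (indicator K x * \<bar>dV e x\<bar>) + (1 / ln 2 * B') * indicator K x" for x
  have w: "integrable lborel w" unfolding w_def
    using integrable_dV_compact[OF K, of e] emeasure_compact_finite[OF K(1)]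
    by (intro Bochner_Integration.integrable_add integrable_mult_right integrable_real_indicator) auto
  have b1: "\<bar>c * dV e x * \<phi> x\<bar> \<le> B * (indicator K x * \<bar>dV e x\<bar>)" if "\<bar>c\<bar> \<le> 1" for c x
  proof (cases "x \<in> K")
    case True
    have "\<bar>c\<bar> * \<bar>dV e x\<bar> * \<bar>\<phi> x\<bar> \<le> 1 * \<bar>dV e x\<bar> * B"
      using that B by (intro mult_mono) auto
    then show ?thesis using True by (simp add: abs_mult mult_ac)
  qed (use supp in auto)
  have b2: "\<bar>c * dir_deriv e \<phi> x\<bar> \<le> (1 / ln 2 * B') * indicator K x" if "\<bar>c\<bar> \<le> 1 / ln 2" for c x
  proof (cases "x \<in> K")
    case True
    have "\<bar>c\<bar> * \<bar>dir_deriv e \<phi> x\<bar> \<le> 1 / ln 2 * B'"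
      using that B' by (intro mult_mono) auto
    then show ?thesis using True by (simp add: abs_mult)
  qed (use supp' in auto)
  have w0: "0 \<le> B * (indicator K x * \<bar>dV e x\<bar>)" "0 \<le> (1 / ln 2 * B') * indicator K x" for x
    using B B' by auto
  have b: "\<bar>dV e x * \<phi> x\<bar> \<le> \<bar>w x\<bar>" "\<bar>V x * dir_deriv e \<phi> x\<bar> \<le> \<bar>w x\<bar>" for x
    using b1[of 1 x] b2[OF abs_V_le, of x x] w0[of x] unfolding w_def by auto
  have int1: "integrable lborel (\<lambda>x. dV e x * \<phi> x)" and int2: "integrable lborel (\<lambda>x. V x * dir_deriv e \<phi> x)"
    by (rule Bochner_Integration.integrable_bound[OF w]; use b in simp)+
  have "(\<lambda>n. LINT x|lborel. trunc' (d n) (- V x) * dV e x * \<phi> x - trunc (d n) (- V x) * dir_deriv e \<phi> x)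
      \<longlonglongrightarrow> (LINT x|lborel. dV e x * \<phi> x + V x * dir_deriv e \<phi> x)"
  proof (rule integral_dominated_convergence[OF _ _ w])
    show "(\<lambda>x. trunc' (d n) (- V x) * dV e x * \<phi> x - trunc (d n) (- V x) * dir_deriv e \<phi> x) \<in> borel_measurable lborel" for n
      unfolding trunc_def trunc'_def by measurable
    have "(\<lambda>n. trunc' (d n) (- V x) * dV e x * \<phi> x - trunc (d n) (- V x) * dir_deriv e \<phi> x) \<longlonglongrightarrow> dV e x * \<phi> x + V x * dir_deriv e \<phi> x" for x
    proof (cases "V x = 0")
      case True
      then show ?thesis using d by (simp add: dV_eq_0 trunc_eq_0 less_imp_le)
    next
      case False
      then have "- V x > 0" using V_nonpos[of x] by simp
      note t = tendsto_trunc[OF this d0]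
      have "(\<lambda>n. trunc' (d n) (- V x) * dV e x * \<phi> x - trunc (d n) (- V x) * dir_deriv e \<phi> x) \<longlonglongrightarrow> 1 * dV e x * \<phi> x - (- V x) * dir_deriv e \<phi> x"
        by (intro tendsto_diff tendsto_mult t tendsto_const)
      then show ?thesis by simp
    qed
    then show "AE x in lborel. (\<lambda>n. trunc' (d n) (- V x) * dV e x * \<phi> x - trunc (d n) (- V x) * dir_deriv e \<phi> x) \<longlonglongrightarrow> dV e x * \<phi> x + V x * dir_deriv e \<phi> x"
      by simp
    show "AE x in lborel. norm (trunc' (d n) (- V x) * dV e x * \<phi> x - trunc (d n) (- V x) * dir_deriv e \<phi> x) \<le> w x" for n
    proof (rule AE_I2)
      fix x
      have "\<bar>trunc' (d n) (- V x)\<bar> \<le> 1" using d[of n] V_nonpos[of x] by (intro trunc'_bounds) auto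
      note 1 = b1[OF this, of x]
      have "\<bar>trunc (d n) (- V x)\<bar> \<le> 1 / ln 2"
        using trunc_bounds[of "d n" "- V x"] d[of n] V_nonpos[of x] abs_V_le[of x] by auto
      note 2 = b2[OF this, of x]
      show "norm (trunc' (d n) (- V x) * dV e x * \<phi> x - trunc (d n) (- V x) * dir_deriv e \<phi> x) \<le> w x"
        using 1 2 by (simp add: w_def)
    qed
    show "(\<lambda>x. dV e x * \<phi> x + V x * dir_deriv e \<phi> x) \<in> borel_measurable lborel"
      by (intro borel_measurable_add borel_measurable_integrable int1 int2)
  qed
  moreover have "(LINT x|lborel. trunc' (d n) (- V x) * dV e x * \<phi> x - trunc (d n) (- V x) * dir_deriv e \<phi> x) = 0" for n
    by (rule trunc_V_parts[OF d K diff supp cont])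
  ultimately have "(\<lambda>n. 0) \<longlonglongrightarrow> (LINT x|lborel. dV e x * \<phi> x + V x * dir_deriv e \<phi> x)"
    by (simp only:)
  then have "(LINT x|lborel. dV e x * \<phi> x + V x * dir_deriv e \<phi> x) = 0"
    by (rule LIMSEQ_unique[OF _ tendsto_const])
  then show ?thesis unfolding Bochner_Integration.integral_add[OF int1 int2] by linarith
qed

end

section \<open>Membership in the Sobolev space\<close>

text \<open>Holds for arbitrary \<open>g\<close>, so that weak derivatives, which are only Lebesgue
  measurable, can be integrated with respect to \<open>lborel\<close>.\<close>

lemma nn_integral_lebesgue_on:
  assumes "K \<in> sets borel"
  shows "(\<integral>\<^sup>+x. g x \<partial>lebesgue_on K) = (\<integral>\<^sup>+x. g x * indicator K x \<partial>lborel)"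
  using assms by (subst nn_integral_restrict_space) (auto simp: nn_integral_completion)

lemma Lp_locI:
  assumes "g \<in> borel_measurable (lebesgue_on U)"
    and "\<And>K. compact K \<Longrightarrow> K \<subseteq> U \<Longrightarrow> (\<integral>\<^sup>+x. ennreal (\<bar>g x\<bar> powr p) * indicator K x \<partial>lborel) < \<infinity>"
  shows "Lp_loc p U g"
  unfolding Lp_loc_def
proof (intro conjI allI impI assms(1))
  fix K assume K: "compact K \<and> K \<subseteq> U"
  then have [measurable]: "g \<in> borel_measurable (lebesgue_on K)"
    using assms(1) measurable_restrict_mono by blast
  have "(\<integral>\<^sup>+x. ennreal (\<bar>g x\<bar> powr p) \<partial>lebesgue_on K) < \<infinity>"
    using K assms(2) by (subst nn_integral_lebesgue_on) (auto simp: compact_imp_closed)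
  then show "integrable (lebesgue_on K) (\<lambda>x. \<bar>g x\<bar> powr p)"
    by (intro integrableI_bounded) auto
qed

lemma Lp_locD:
  assumes "Lp_loc p U g" "compact K" "K \<subseteq> U"
  shows "(\<integral>\<^sup>+x. ennreal (\<bar>g x\<bar> powr p) * indicator K x \<partial>lborel) < \<infinity>"
proof -
  have "integrable (lebesgue_on K) (\<lambda>x. \<bar>g x\<bar> powr p)" using assms by (simp add: Lp_loc_def)
  then have "(\<integral>\<^sup>+x. ennreal (\<bar>g x\<bar> powr p) \<partial>lebesgue_on K) < \<infinity>"
    by (simp add: integrable_iff_bounded)
  then show ?thesis using assms(2) by (subst (asm) nn_integral_lebesgue_on) (auto simp: compact_imp_closed)
qed

lemma borel_measurable_lebesgue_on:
  fixes g :: "'a::euclidean_space \<Rightarrow> real"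
  assumes "G \<in> borel_measurable borel" "\<And>x. x \<in> U \<Longrightarrow> g x = G x"
  shows "g \<in> borel_measurable (lebesgue_on U)"
proof -
  have "G \<in> borel_measurable (lebesgue_on U)"
    by (intro measurable_restrict_space1 measurable_completion) (use assms(1) in simp)
  then show ?thesis using assms(2) by (subst measurable_cong[where g = G]) auto
qed

lemma integral_lebesgue_on:
  fixes h :: "'a::euclidean_space \<Rightarrow> real"
  assumes "open U" "H \<in> borel_measurable borel" "\<And>x. x \<in> U \<Longrightarrow> h x = H x" "\<And>x. x \<notin> U \<Longrightarrow> H x = 0"
  shows "(LINT x|lebesgue_on U. h x) = (LINT x|lborel. H x)"
proof -
  have "(LINT x|lebesgue_on U. h x) = (LINT x|lebesgue. indicator U x *\<^sub>R h x)"
    using assms(1) by (intro integral_restrict_space) auto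
  also have "\<dots> = (LINT x|lebesgue. H x)"
    using assms(3,4) by (intro Bochner_Integration.integral_cong) (auto simp: indicator_def)
  also have "\<dots> = (LINT x|lborel. H x)" using assms(2) by (intro integral_completion) simp
  finally show ?thesis .
qed

lemma partial_deriv_eq_dir_deriv: "partial_deriv i = dir_deriv (axis i 1)"
  by (simp add: partial_deriv_def dir_deriv_def fun_eq_iff)

lemma smooth_imp_differentiable: "smooth \<phi> \<Longrightarrow> \<phi> differentiable at x"
  unfolding smooth_def by (metis partial_derivs.simps(1))

lemma smooth_imp_continuous_on_partial:
  assumes "smooth \<phi>" shows "continuous_on UNIV (dir_deriv (axis i 1) \<phi>)"
proof -
  have "partial_derivs [i] \<phi> differentiable at x" for x using assms unfolding smooth_def by blast
  then have "dir_deriv (axis i 1) \<phi> differentiable at x" for x by (simp add: partial_deriv_eq_dir_deriv)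
  then show ?thesis
    by (intro continuous_at_imp_continuous_on) (auto simp: differentiable_imp_continuous_within)
qed

context small_analytic
begin

lemma Lp_loc_V: 
  assumes "\<And>x. x \<in> U \<Longrightarrow> v x = V x" "p > 0"
  shows "Lp_loc p U v"
proof (rule Lp_locI)
  show "v \<in> borel_measurable (lebesgue_on U)"
    by (rule borel_measurable_lebesgue_on[OF V_measurable]) (rule assms)
  fix K assume K: "compact K" "K \<subseteq> U"
  have "(\<integral>\<^sup>+x. ennreal (\<bar>v x\<bar> powr p) * indicator K x \<partial>lborel) \<le> (\<integral>\<^sup>+x. ennreal ((1 / ln 2) powr p) * indicator K x \<partial>lborel)"
  proof (intro nn_integral_mono)
    fix x
    have "\<bar>v x\<bar> powr p \<le> (1 / ln 2) powr p" if "x \<in> K"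
      using that K assms abs_V_le[of x] by (intro powr_mono2) auto
    then show "ennreal (\<bar>v x\<bar> powr p) * indicator K x \<le> ennreal ((1 / ln 2) powr p) * indicator K x"
      by (auto simp: indicator_def intro!: ennreal_leI)
  qed
  also have "\<dots> = ennreal ((1 / ln 2) powr p) * emeasure lborel K"
    using K by (intro nn_integral_cmult_indicator) (auto simp: compact_imp_closed)
  also have "\<dots> < \<infinity>" using emeasure_compact_finite[OF K(1)] by (simp add: ennreal_mult_less_top less_top)
  finally show "(\<integral>\<^sup>+x. ennreal (\<bar>v x\<bar> powr p) * indicator K x \<partial>lborel) < \<infinity>" .
qed

lemma Lp_loc_dV: "Lp_loc 1 U (dV e)"
proof (rule Lp_locI)
  show "dV e \<in> borel_measurable (lebesgue_on U)"
    by (rule borel_measurable_lebesgue_on[OF dV_measurable]) simp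
qed (use nn_integral_dV_compact in simp)

lemma weak_derivative_dV:
  assumes v: "\<And>x. x \<in> U \<Longrightarrow> v x = V x"
  shows "weak_derivative U [i] v (dV (axis i 1))"
  unfolding weak_derivative_def
proof (intro conjI allI impI)
  show "Lp_loc 1 U v" by (rule Lp_loc_V) (use v in auto)
  show "Lp_loc 1 U (dV (axis i 1))" by (rule Lp_loc_dV)
  fix \<phi> :: "real^'n \<Rightarrow> real" assume "test_function_on U \<phi>"
  then have sm: "smooth \<phi>" and K: "compact (closure {x. \<phi> x \<noteq> 0})" "closure {x. \<phi> x \<noteq> 0} \<subseteq> U"
    by (auto simp: test_function_on_def)
  note diff = smooth_imp_differentiable[OF sm] and cont = smooth_imp_continuous_on_partial[OF sm, of i]
  have supp: "\<phi> x = 0" if "x \<notin> closure {x. \<phi> x \<noteq> 0}" for x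
    using that closure_subset[of "{x. \<phi> x \<noteq> 0}"] by blast
  have "continuous_on UNIV \<phi>"
    using diff by (intro continuous_at_imp_continuous_on) (auto simp: differentiable_imp_continuous_within)
  then have [measurable]: "\<phi> \<in> borel_measurable borel" "dir_deriv (axis i 1) \<phi> \<in> borel_measurable borel"
    using cont by (auto intro: borel_measurable_continuous_onI)
  have "(LINT x|lebesgue_on U. v x * partial_derivs [i] \<phi> x) = (LINT x|lborel. V x * dir_deriv (axis i 1) \<phi> x)"
    by (rule integral_lebesgue_on[OF open_U], measurable) (auto simp: v partial_deriv_eq_dir_deriv V_def)
  also have "\<dots> = - (LINT x|lborel. dV (axis i 1) x * \<phi> x)"
    by (rule V_integration_by_parts[OF K diff supp cont])
  also have "(LINT x|lborel. dV (axis i 1) x * \<phi> x) = (LINT x|lebesgue_on U. dV (axis i 1) x * \<phi> x)"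
    by (rule integral_lebesgue_on[OF open_U, symmetric], measurable) (auto simp: dV_def)
  finally show "(LINT x|lebesgue_on U. v x * partial_derivs [i] \<phi> x) =
    (- 1) ^ length [i] * (LINT x|lebesgue_on U. dV (axis i 1) x * \<phi> x)" by simp
qed

lemma V_in_Sobolev_loc_1_1:
  assumes v: "\<And>x. x \<in> U \<Longrightarrow> v x = V x"
  shows "v \<in> Sobolev_loc 1 1 U"
  unfolding Sobolev_loc_def
proof (intro CollectI allI impI)
  fix "is" :: "'n list" assume "length is \<le> 1"
  then consider "is = []" | i where "is = [i]" by (cases "is") auto
  then show "\<exists>g. weak_derivative U is v g \<and> Lp_loc 1 U g"
  proof cases
    case 1
    have "Lp_loc 1 U v" by (rule Lp_loc_V) (use v in auto)
    then show ?thesis using 1 by (intro exI[of _ v]) (simp add: weak_derivative_def)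
  next
    case 2
    then show ?thesis using weak_derivative_dV[OF v] Lp_loc_dV by blast
  qed
qed

end

section \<open>Smooth bump functions\<close>

definition exp_inverse :: "real \<Rightarrow> nat \<Rightarrow> real \<Rightarrow> real"
  where "exp_inverse c m t = (if t > 0 then (1 / t) ^ m * exp (- c / t) else 0)"

lemma exp_inverse_tendsto_0:
  assumes "c > 0"
  shows "(exp_inverse c m \<longlongrightarrow> 0) (at 0)"
proof -
  have "filterlim (\<lambda>t. c * inverse t) at_top (at_right (0::real))"
    using assms by (intro filterlim_tendsto_pos_mult_at_top[OF tendsto_const] filterlim_inverse_at_top_right) auto
  from filterlim_compose[OF tendsto_power_div_exp_0 this, of m]
  have "((\<lambda>t. (1 / c) ^ m * ((c * inverse t) ^ m / exp (c * inverse t))) \<longlongrightarrow> (1 / c) ^ m * 0) (at_right 0)"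
    by (intro tendsto_mult tendsto_const)
  then have lim: "((\<lambda>t. (1 / c) ^ m * ((c * inverse t) ^ m / exp (c * inverse t))) \<longlongrightarrow> 0) (at_right 0)"
    by simp
  have "(exp_inverse c m \<longlongrightarrow> 0) (at_right 0)"
  proof (rule Lim_transform_eventually[OF lim])
    show "\<forall>\<^sub>F t in at_right 0. (1 / c) ^ m * ((c * inverse t) ^ m / exp (c * inverse t)) = exp_inverse c m t"
      using assms by (intro eventually_at_rightI[of 0 1])
        (auto simp: exp_inverse_def exp_minus field_simps power_mult_distrib)
  qed
  moreover have "(exp_inverse c m \<longlongrightarrow> 0) (at_left 0)"
    by (rule Lim_transform_eventually[OF tendsto_const])
       (auto simp: exp_inverse_def intro!: eventually_at_leftI[of "-1"])
  ultimately show ?thesis by (simp add: filterlim_split_at)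
qed

text \<open>The powers \<open>(1 / t) ^ m\<close> are carried along so that derivatives stay in the
  linear span of the family.\<close>

lemma has_real_derivative_exp_inverse:
  assumes "c > 0"
  shows "(exp_inverse c m has_real_derivative c * exp_inverse c (m + 2) t - real m * exp_inverse c (m + 1) t) (at t)"
proof -
  consider "t > 0" | "t < 0" | "t = 0" by linarith
  then show ?thesis
  proof cases
    case 1
    have "((\<lambda>t. (inverse t) ^ m * exp (- c * inverse t)) has_real_derivative
        real m * (inverse t) ^ (m - 1) * (- (inverse t)\<^sup>2) * exp (- c * inverse t) + (inverse t) ^ m * (exp (- c * inverse t) * (c * (inverse t)\<^sup>2))) (at t)"
      using 1 by (auto intro!: derivative_eq_intros simp: power2_eq_square)
    moreover have "real m * (inverse t) ^ (m - 1) * (- (inverse t)\<^sup>2) * exp (- c * inverse t) + (inverse t) ^ m * (exp (- c * inverse t) * (c * (inverse t)\<^sup>2))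
       = c * exp_inverse c (m + 2) t - real m * exp_inverse c (m + 1) t"
      using 1 by (cases m) (simp_all add: exp_inverse_def inverse_eq_divide power2_eq_square algebra_simps add_divide_distrib)
    ultimately have "((\<lambda>t. (inverse t) ^ m * exp (- c * inverse t)) has_real_derivative c * exp_inverse c (m + 2) t - real m * exp_inverse c (m + 1) t) (at t)"
      by simp
    then show ?thesis
      by (rule has_field_derivative_transform_within_open[of _ _ _ "{0<..}"])
        (use 1 in \<open>auto simp: exp_inverse_def inverse_eq_divide\<close>)
  next
    case 2
    have "((\<lambda>t::real. 0) has_real_derivative c * exp_inverse c (m + 2) t - real m * exp_inverse c (m + 1) t) (at t)"
      using 2 by (simp add: exp_inverse_def)
    then show ?thesis
      by (rule has_field_derivative_transform_within_open[of _ _ _ "{..<0}"]) (use 2 in \<open>auto simp: exp_inverse_def\<close>)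
  next
    case 3
    \<comment> \<open>At \<open>0\<close> the difference quotient is the next member of the family,
      as division by \<open>h\<close> raises \<open>m\<close> by one.\<close>
    have "(\<lambda>h. (exp_inverse c m (0 + h) - exp_inverse c m 0) / h) = exp_inverse c (m + 1)"
      by (auto simp: exp_inverse_def fun_eq_iff)
    then show ?thesis
      using exp_inverse_tendsto_0[OF assms, of "m + 1"] unfolding 3 DERIV_def by (simp add: exp_inverse_def)
  qed
qed

text \<open>Closed under partial derivatives, which makes smoothness in the sense of iterated partial
  derivatives an induction.\<close>
inductive bump_algebra :: "(real^'n \<Rightarrow> real) \<Rightarrow> bool" where
  const: "bump_algebra (\<lambda>_. k)"
| coord: "c > 0 \<Longrightarrow> bump_algebra (\<lambda>x. exp_inverse c m (s * x $ i + b))"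
| add: "bump_algebra F \<Longrightarrow> bump_algebra G \<Longrightarrow> bump_algebra (\<lambda>x. F x + G x)"
| mult: "bump_algebra F \<Longrightarrow> bump_algebra G \<Longrightarrow> bump_algebra (\<lambda>x. F x * G x)"

text \<open>Names the partial derivatives as functions, so that they can be required to lie in
  \<open>bump_algebra\<close> themselves.\<close>

definition has_partials :: "(real^'n \<Rightarrow> real) \<Rightarrow> ('n \<Rightarrow> real^'n \<Rightarrow> real) \<Rightarrow> bool"
  where "has_partials F F' \<longleftrightarrow> (\<forall>x. (F has_derivative (\<lambda>h. \<Sum>i\<in>UNIV. h $ i * F' i x)) (at x))"

lemma bump_algebra_has_derivative:
  fixes F :: "real^'n \<Rightarrow> real"
  assumes "bump_algebra F"
  shows "\<exists>F'. (\<forall>i. bump_algebra (F' i)) \<and> has_partials F F'"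
  using assms
proof induction
  case (const k)
  then show ?case by (intro exI[of _ "\<lambda>_ _. 0"]) (auto intro: bump_algebra.const simp: has_partials_def)
next
  case (coord c m s i b)
  let ?D = "\<lambda>x::real^'n. s * (c * exp_inverse c (m + 2) (s * x $ i + b) + (- real m) * exp_inverse c (m + 1) (s * x $ i + b))"
  have "bump_algebra ?D" using coord by (intro bump_algebra.intros)
  define F' where "F' j = (if j = i then ?D else (\<lambda>_. 0))" for j
  have "((\<lambda>x. exp_inverse c m (s * x $ i + b)) has_derivative (\<lambda>h. \<Sum>j\<in>UNIV. h $ j * F' j x)) (at x)" for x :: "real^'n"
  proof -
    have "(\<Sum>j\<in>UNIV. h $ j * F' j x) = (\<Sum>j\<in>UNIV. if j = i then h $ j * ?D x else 0)" for h :: "real^'n"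
      by (intro sum.cong) (auto simp: F'_def)
    then have sum: "(\<Sum>j\<in>UNIV. h $ j * F' j x) = h $ i * ?D x" for h :: "real^'n" by simp
    have "((\<lambda>x::real^'n. s * x $ i + b) has_derivative (\<lambda>h. s * h $ i)) (at x)"
      by (auto intro!: derivative_eq_intros bounded_linear.has_derivative[OF bounded_linear_vec_nth])
    from has_derivative_compose[OF this has_real_derivative_exp_inverse[OF coord, unfolded has_field_derivative_def]]
    show ?thesis unfolding sum by (rule has_derivative_eq_rhs) (simp add: fun_eq_iff algebra_simps)
  qed
  moreover have "bump_algebra (F' j)" for j
    using \<open>bump_algebra ?D\<close> bump_algebra.const[of 0] by (cases "j = i") (simp_all add: F'_def)
  ultimately show ?case unfolding has_partials_def by (intro exI[of _ F'] conjI allI)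
next
  case (add F G)
  then obtain F' G' where *: "\<And>i. bump_algebra (F' i)" "\<And>i. bump_algebra (G' i)"
    "has_partials F F'" "has_partials G G'" by metis
  have "has_partials (\<lambda>x. F x + G x) (\<lambda>i x. F' i x + G' i x)"
    unfolding has_partials_def
  proof
    fix x
    show "((\<lambda>x. F x + G x) has_derivative (\<lambda>h. \<Sum>i\<in>UNIV. h $ i * (F' i x + G' i x))) (at x)"
      using has_derivative_add[OF *(3,4)[unfolded has_partials_def, rule_format]]
      by (simp add: sum.distrib distrib_left)
  qed
  moreover have "bump_algebra (\<lambda>x. F' i x + G' i x)" for i
    by (intro bump_algebra.add *)
  ultimately show ?case by (intro exI[of _ "\<lambda>i x. F' i x + G' i x"] conjI allI)
next
  case (mult F G)
  then obtain F' G' where *: "\<And>i. bump_algebra (F' i)" "\<And>i. bump_algebra (G' i)"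
    "has_partials F F'" "has_partials G G'" by metis
  have "has_partials (\<lambda>x. F x * G x) (\<lambda>i x. F x * G' i x + F' i x * G x)"
    unfolding has_partials_def
  proof
    fix x
    show "((\<lambda>x. F x * G x) has_derivative (\<lambda>h. \<Sum>i\<in>UNIV. h $ i * (F x * G' i x + F' i x * G x))) (at x)"
      using has_derivative_mult[OF *(3,4)[unfolded has_partials_def, rule_format]]
      by (rule has_derivative_eq_rhs)
        (simp add: sum.distrib distrib_left sum_distrib_left sum_distrib_right mult_ac)
  qed
  moreover have "bump_algebra (\<lambda>x. F x * G' i x + F' i x * G x)" for i
    by (intro bump_algebra.add bump_algebra.mult * mult.hyps)
  ultimately show ?case by (intro exI[of _ "\<lambda>i x. F x * G' i x + F' i x * G x"] conjI allI)
qed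

lemma bump_algebra_partial_deriv:
  assumes "bump_algebra F" shows "bump_algebra (partial_deriv i F)"
proof -
  obtain F' where F': "\<And>i. bump_algebra (F' i)" "has_partials F F'"
    using bump_algebra_has_derivative[OF assms] by metis
  have "partial_deriv i F x = F' i x" for x
  proof -
    have "partial_deriv i F x = (\<Sum>j\<in>UNIV. axis i 1 $ j * F' j x)"
      unfolding partial_deriv_eq_dir_deriv
      by (rule dir_deriv_eq[OF F'(2)[unfolded has_partials_def, rule_format]])
    also have "\<dots> = (\<Sum>j\<in>UNIV. if j = i then F' j x else 0)"
      by (intro sum.cong) (auto simp: axis_def)
    finally show ?thesis by simp
  qed
  then have "partial_deriv i F = F' i" by (simp add: fun_eq_iff)
  then show ?thesis using F'(1) by simp
qed

lemma bump_algebra_imp_differentiable: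
  assumes "bump_algebra F" shows "F differentiable at x"
proof -
  obtain F' where "has_partials F F'" using bump_algebra_has_derivative[OF assms] by metis
  then show ?thesis unfolding has_partials_def by (intro differentiableI) (rule spec)
qed

lemma bump_algebra_imp_smooth:
  assumes "bump_algebra F" shows "smooth F"
proof -
  have "bump_algebra (partial_derivs is F)" for "is"
    by (induction "is") (auto intro: assms bump_algebra_partial_deriv)
  then show ?thesis unfolding smooth_def by (auto intro: bump_algebra_imp_differentiable)
qed

text \<open>The factors \<open>1 *\<close> and \<open>(- 1) *\<close> match the shape
  \<open>s * x $ i + b\<close> of the rule \<open>coord\<close>. As \<open>c\<close> tends to
  \<open>0\<close> the bumps tend to the indicator of \<open>box a b\<close> and stay bounded by
  \<open>1\<close>, which takes the place of mollification.\<close>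

definition bump :: "real \<Rightarrow> real^'n \<Rightarrow> real^'n \<Rightarrow> real^'n \<Rightarrow> real"
  where "bump c a b x = (\<Prod>i\<in>UNIV. exp_inverse c 0 (1 * x $ i + (- a $ i)) * exp_inverse c 0 ((- 1) * x $ i + b $ i))"

lemma bump_algebra_bump: "c > 0 \<Longrightarrow> bump_algebra (bump c a b)"
proof -
  assume "c > 0"
  have "bump_algebra (\<lambda>x. \<Prod>i\<in>I. exp_inverse c 0 (1 * x $ i + (- a $ i)) * exp_inverse c 0 ((- 1) * x $ i + b $ i))"
    if "finite I" for I
    using that
  proof induction
    case empty
    then show ?case by (simp add: bump_algebra.const)
  next
    case (insert j I)
    show ?case unfolding prod.insert[OF insert(1,2)]
      by (intro bump_algebra.mult bump_algebra.coord insert \<open>c > 0\<close>)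
  qed
  then show ?thesis unfolding bump_def[abs_def] by simp
qed

lemma bump_eq_0: "x \<notin> box a b \<Longrightarrow> bump c a b x = 0"
proof -
  assume "x \<notin> box a b"
  then obtain i where "x $ i \<le> a $ i \<or> b $ i \<le> x $ i" by (auto simp: mem_box_cart not_less)
  then show ?thesis unfolding bump_def by (intro prod_zero bexI[of _ i]) (auto simp: exp_inverse_def)
qed

lemma bump_bounds: "c > 0 \<Longrightarrow> \<bar>bump c a b x\<bar> \<le> 1"
  unfolding bump_def abs_prod
  by (intro prod_le_1) (auto simp: exp_inverse_def abs_mult intro!: mult_le_one)

lemma bump_tendsto:
  assumes "c \<longlonglongrightarrow> 0"
  shows "(\<lambda>n. bump (c n) a b x) \<longlonglongrightarrow> indicator (box a b) x"
proof (cases "x \<in> box a b")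
  case True
  have *: "(\<lambda>n. exp_inverse (c n) 0 t) \<longlonglongrightarrow> 1" if "t > 0" for t
    using that assms by (auto simp: exp_inverse_def intro!: tendsto_eq_intros)
  have "(\<lambda>n. bump (c n) a b x) \<longlonglongrightarrow> (\<Prod>i\<in>(UNIV::'a set). 1 * 1)"
    unfolding bump_def using True by (intro tendsto_prod tendsto_mult *) (auto simp: mem_box_cart)
  then show ?thesis using True by simp
qed (simp add: bump_eq_0)

section \<open>Failure of higher integrability in codimension one\<close>

lemma Int_stable_boxes: "Int_stable (range (\<lambda>(a, b). box a b :: (real^'n) set))"
proof (rule Int_stableI)
  fix A B :: "(real^'n) set"
  assume "A \<in> range (\<lambda>(a, b). box a b)" "B \<in> range (\<lambda>(a, b). box a b)"
  then obtain a b c d where "A = box a b" "B = box c d" by auto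
  then have "A \<inter> B = box (\<chi> i. max (a $ i) (c $ i)) (\<chi> i. min (b $ i) (d $ i))"
    by (auto simp: mem_box_cart)
  then show "A \<inter> B \<in> range (\<lambda>(a, b). box a b)" by auto
qed

text \<open>Boxes are an intersection-stable generator of the Borel sets, so vanishing integrals
  extend from boxes to all Borel sets. The assumption \<open>total\<close> serves the complement
  step, since the whole space is not a box.\<close>

lemma AE_eq_0_of_integral_box_0:
  fixes h :: "real^'n \<Rightarrow> real"
  assumes h: "integrable lborel h" and total: "(LINT x|lborel. h x) = 0"
    and box: "\<And>a b. (LINT x:box a b|lborel. h x) = 0"
  shows "AE x in lborel. h x = 0"
proof (rule sigma_finite_measure.density_zero[OF sigma_finite_lborel h])
  have si: "set_integrable lborel A h" if "A \<in> sets borel" for A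
    using h that unfolding set_integrable_def by (intro integrable_mult_indicator) auto
  fix A :: "(real^'n) set" assume "A \<in> sets lborel"
  then have A: "A \<in> sigma_sets UNIV (range (\<lambda>(a, b). box a b))"
    by (simp add: borel_eq_box)
  show "(LINT x:A|lborel. h x) = 0"
    using Int_stable_boxes subset_UNIV[of "range (\<lambda>(a, b). box a b :: (real^'n) set)", folded Pow_UNIV] A
  proof (induction rule: sigma_sets_induct_disjoint)
    case (compl A)
    then have A: "A \<in> sets borel" by (simp add: borel_eq_box)
    then have "(LINT x:A \<union> (UNIV - A)|lborel. h x) = (LINT x:A|lborel. h x) + (LINT x:UNIV - A|lborel. h x)"
      by (intro set_integral_Un si) auto
    then show ?case using compl total by (simp add: set_lebesgue_integral_def)
  next
    case (union A)
    then have A: "A i \<in> sets borel" for i by (auto simp: borel_eq_box)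
    have "(LINT x:(\<Union>i. A i)|lborel. h x) = (\<Sum>i. (LINT x:A i|lborel. h x))"
      using union A by (intro lebesgue_integral_countable_add si) (auto simp: disjoint_family_on_def)
    then show ?case using union by simp
  qed (use box in \<open>auto simp: set_lebesgue_integral_def\<close>)
qed

lemma Lp_loc_1_integrable:
  assumes "Lp_loc 1 U g" "compact K" "K \<subseteq> U"
  shows "integrable lebesgue (\<lambda>x. indicator K x * g x)"
proof -
  have "g \<in> borel_measurable (lebesgue_on K)"
    using assms(1) by (intro measurable_restrict_mono[OF _ assms(3)]) (simp add: Lp_loc_def)
  moreover have "integrable (lebesgue_on K) (\<lambda>x. \<bar>g x\<bar>)"
    using assms by (simp add: Lp_loc_def)
  ultimately have "integrable (lebesgue_on K) g" by (rule integrable_abs_cancel[rotated])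
  then show ?thesis using assms(2)
    by (subst (asm) integrable_restrict_space) (auto simp: compact_imp_closed)
qed

lemma closure_support_bump: "closure {x. bump c a b x * F x \<noteq> 0} \<subseteq> cbox a b"
proof (rule closure_minimal)
  show "{x. bump c a b x * F x \<noteq> 0} \<subseteq> cbox a b"
    using bump_eq_0[of _ a b c] box_subset_cbox[of a b] by auto
qed (rule closed_cbox)

text \<open>The two factors have different tasks: the first keeps the support inside
  \<open>cbox a b\<close> and thus inside \<open>U\<close>, the second approximates the indicator of
  a box \<open>box c d\<close> that may lie anywhere.\<close>

lemma integral_bump_box_eq:
  fixes g :: "real^'n \<Rightarrow> real"
  assumes g: "Lp_loc 1 U g" "cbox a b \<subseteq> U" and U: "open U"
  shows "(\<lambda>n. LINT x|lebesgue_on U. g x * (bump (1 / real (Suc n)) a b x * bump (1 / real (Suc n)) c d x))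
    \<longlonglongrightarrow> (LINT x|lebesgue. (indicator (box a b) x * g x) * indicator (box c d) x)"
    and "test_function_on U (\<lambda>x. bump (1 / real (Suc n)) a b x * bump (1 / real (Suc n)) c d x)"
proof -
  define t where "t n = 1 / real (Suc n)" for n
  have t: "t n > 0" for n by (simp add: t_def)
  have t0: "t \<longlonglongrightarrow> 0" unfolding t_def by (rule LIMSEQ_Suc) (rule lim_1_over_n)
  define \<phi> where "\<phi> n x = bump (t n) a b x * bump (t n) c d x" for n x
  have alg: "bump_algebra (\<phi> n)" for n
    unfolding \<phi>_def by (intro bump_algebra.mult bump_algebra_bump t)
  have cl: "closure {x. \<phi> n x \<noteq> 0} \<subseteq> cbox a b" for n
    unfolding \<phi>_def by (rule closure_support_bump)
  then have "compact (closure {x. \<phi> n x \<noteq> 0})" for n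
    by (meson bounded_cbox bounded_subset closed_closure compact_eq_bounded_closed)
  then show "test_function_on U (\<lambda>x. bump (1 / real (Suc n)) a b x * bump (1 / real (Suc n)) c d x)"
    unfolding t_def[symmetric] \<phi>_def[symmetric] test_function_on_def
    using bump_algebra_imp_smooth[OF alg] g(2) cl by (meson order_trans)
  have "continuous_on UNIV (\<phi> n)" for n
    using bump_algebra_imp_differentiable[OF alg]
    by (intro continuous_at_imp_continuous_on) (auto simp: differentiable_imp_continuous_within)
  then have [measurable]: "\<phi> n \<in> borel_measurable borel" for n by (intro borel_measurable_continuous_onI)
  then have [measurable]: "\<phi> n \<in> borel_measurable lebesgue" for n by (intro measurable_completion) simp
  define H where "H x = indicator (cbox a b) x * g x" for x
  have H: "integrable lebesgue H" unfolding H_def by (rule Lp_loc_1_integrable[OF g(1) compact_cbox g(2)])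
  then have [measurable]: "H \<in> borel_measurable lebesgue" by simp
  have supp: "\<phi> n x = 0" if "x \<notin> cbox a b" for n x
    using that bump_eq_0 box_subset_cbox unfolding \<phi>_def by force
  have "(LINT x|lebesgue_on U. g x * \<phi> n x) = (LINT x|lebesgue. H x * \<phi> n x)" for n
  proof -
    have "(LINT x|lebesgue_on U. g x * \<phi> n x) = (LINT x|lebesgue. indicator U x *\<^sub>R (g x * \<phi> n x))"
      using U by (intro integral_restrict_space) auto
    also have "\<dots> = (LINT x|lebesgue. H x * \<phi> n x)"
      using supp g(2) by (intro Bochner_Integration.integral_cong) (auto simp: H_def indicator_def)
    finally show ?thesis .
  qed
  moreover have "(\<lambda>n. LINT x|lebesgue. H x * \<phi> n x) \<longlonglongrightarrow> (LINT x|lebesgue. H x * (indicator (box a b) x * indicator (box c d) x))"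
  proof (rule integral_dominated_convergence[where w = "\<lambda>x. \<bar>H x\<bar>"])
    have *: "box p q \<in> sets lebesgue" for p q :: "real^'n" by simp
    show "(\<lambda>x. H x * (indicator (box a b) x * indicator (box c d) x)) \<in> borel_measurable lebesgue"
      using * by (intro borel_measurable_times borel_measurable_indicator) auto
    show "integrable lebesgue (\<lambda>x. \<bar>H x\<bar>)" using H by simp
    show "AE x in lebesgue. (\<lambda>n. H x * \<phi> n x) \<longlonglongrightarrow> H x * (indicator (box a b) x * indicator (box c d) x)"
      unfolding \<phi>_def by (intro AE_I2 tendsto_mult tendsto_const bump_tendsto t0)
    have "\<bar>\<phi> n x\<bar> \<le> 1" for n x
      unfolding \<phi>_def abs_mult using bump_bounds[OF t] by (intro mult_le_one) auto
    then show "AE x in lebesgue. norm (H x * \<phi> n x) \<le> \<bar>H x\<bar>" for n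
      by (intro AE_I2) (simp add: abs_mult mult_left_le)
  qed measurable
  moreover have "(LINT x|lebesgue. H x * (indicator (box a b) x * indicator (box c d) x))
     = (LINT x|lebesgue. (indicator (box a b) x * g x) * indicator (box c d) x)"
    using box_subset_cbox[of a b] by (intro Bochner_Integration.integral_cong) (auto simp: H_def indicator_def)
  ultimately show "(\<lambda>n. LINT x|lebesgue_on U. g x * (bump (1 / real (Suc n)) a b x * bump (1 / real (Suc n)) c d x))
    \<longlonglongrightarrow> (LINT x|lebesgue. (indicator (box a b) x * g x) * indicator (box c d) x)"
    unfolding t_def[symmetric] \<phi>_def[symmetric] by simp
qed

text \<open>Test functions that tend to indicators of boxes show that the difference of the two
  derivatives, cut off to \<open>box a b\<close>, has integral zero over every box.\<close>

lemma weak_derivative_unique_AE: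
  fixes u :: "real^'n \<Rightarrow> real"
  assumes U: "open U" and g: "weak_derivative U is u g" and g': "weak_derivative U is u g'"
    and ab: "cbox a b \<subseteq> U"
  shows "AE x in lborel. x \<in> box a b \<longrightarrow> g x = g' x"
proof -
  have L: "Lp_loc 1 U g" "Lp_loc 1 U g'" using g g' by (auto simp: weak_derivative_def)
  have eq: "(LINT x|lebesgue_on U. g x * \<phi> x) = (LINT x|lebesgue_on U. g' x * \<phi> x)" if "test_function_on U \<phi>" for \<phi>
  proof -
    have "(- 1) ^ length is * (LINT x|lebesgue_on U. g x * \<phi> x) = (- 1) ^ length is * (LINT x|lebesgue_on U. g' x * \<phi> x)"
      using g[unfolded weak_derivative_def, THEN conjunct2, THEN conjunct2, rule_format, OF that]
        g'[unfolded weak_derivative_def, THEN conjunct2, THEN conjunct2, rule_format, OF that]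
      by (rule trans[OF sym])
    then show ?thesis by simp
  qed
  define B where "B g x = indicator (box a b) x * g x" for g :: "real^'n \<Rightarrow> real" and x
  have int: "integrable lebesgue (B g)" if "Lp_loc 1 U g" for g
  proof -
    have "integrable lebesgue (\<lambda>x. indicator (box a b) x *\<^sub>R (indicator (cbox a b) x * g x))"
      by (intro integrable_mult_indicator Lp_loc_1_integrable[OF that compact_cbox ab]) simp
    then show ?thesis
      by (rule Bochner_Integration.integrable_cong[THEN iffD1, rotated 2])
        (use box_subset_cbox[of a b] in \<open>auto simp: B_def indicator_def\<close>)
  qed
  have box_eq: "(LINT x|lebesgue. B g x * indicator (box c d) x) = (LINT x|lebesgue. B g' x * indicator (box c d) x)" for c d
  proof (rule LIMSEQ_unique)
    show "(\<lambda>n. LINT x|lebesgue_on U. g x * (bump (1 / real (Suc n)) a b x * bump (1 / real (Suc n)) c d x))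
      \<longlonglongrightarrow> (LINT x|lebesgue. B g x * indicator (box c d) x)"
      unfolding B_def by (rule integral_bump_box_eq(1)[OF L(1) ab U])
    show "(\<lambda>n. LINT x|lebesgue_on U. g x * (bump (1 / real (Suc n)) a b x * bump (1 / real (Suc n)) c d x))
      \<longlonglongrightarrow> (LINT x|lebesgue. B g' x * indicator (box c d) x)"
      unfolding B_def eq[OF integral_bump_box_eq(2)[OF L(1) ab U]] by (rule integral_bump_box_eq(1)[OF L(2) ab U])
  qed
  define h where "h x = B g x - B g' x" for x
  have h: "integrable lebesgue h" unfolding h_def by (intro Bochner_Integration.integrable_diff int L)
  have hbox: "(LINT x|lebesgue. h x * indicator (box c d) x) = 0" for c d
  proof -
    have "integrable lebesgue (\<lambda>x. B g x * indicator (box c d) x)" if "Lp_loc 1 U g" for g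
      using integrable_mult_indicator[OF _ int[OF that], of "box c d"] by (simp add: mult.commute)
    then show ?thesis using L box_eq[of c d]
      by (simp add: h_def left_diff_distrib Bochner_Integration.integral_diff)
  qed
  \<comment> \<open>A Borel version of \<open>h\<close>, which is only Lebesgue measurable, while
    \<open>AE_eq_0_of_integral_box_0\<close> works with \<open>lborel\<close>.\<close>
  obtain k where k: "k \<in> borel_measurable lborel" "AE x in lborel. h x = k x"
    using completion_ex_borel_measurable_real[of h lborel] h by auto
  then have kc: "AE x in lebesgue. h x = k x" by (intro AE_completion)
  have km: "k \<in> borel_measurable lebesgue" using k(1) by (rule measurable_completion)
  have "integrable lebesgue k"
    using integrable_cong_AE[OF _ km kc] h by auto
  then have ki: "integrable lborel k" using integrable_completion[OF k(1)] by simp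
  have kint: "(LINT x:A|lborel. k x) = (LINT x|lebesgue. h x * indicator A x)" if [measurable]: "A \<in> sets borel" for A
  proof -
    have [measurable]: "k \<in> borel_measurable borel" using k(1) by simp
    have "(LINT x:A|lborel. k x) = (LINT x|lebesgue. indicator A x *\<^sub>R k x)"
      unfolding set_lebesgue_integral_def by (rule integral_completion[symmetric]) measurable
    also have "\<dots> = (LINT x|lebesgue. h x * indicator A x)"
    proof (rule integral_cong_AE)
      show "(\<lambda>x. indicator A x *\<^sub>R k x) \<in> borel_measurable lebesgue" by (rule measurable_completion) measurable
      show "(\<lambda>x. h x * indicator A x) \<in> borel_measurable lebesgue"
        by (intro borel_measurable_times borel_measurable_integrable[OF h] borel_measurable_indicator) simp
      show "AE x in lebesgue. indicator A x *\<^sub>R k x = h x * indicator A x"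
        using kc by eventually_elim simp
    qed
    finally show ?thesis .
  qed
  \<comment> \<open>The total integral is the one over \<open>box a b\<close>, off which
    \<open>h\<close> vanishes, so \<open>hbox\<close> covers it too.\<close>
  have "(LINT x|lborel. k x) = (LINT x:UNIV|lborel. k x)" by (simp add: set_lebesgue_integral_def)
  also have "\<dots> = (LINT x|lebesgue. h x * indicator (box a b) x)"
    unfolding kint[OF space_in_borel]
    by (intro Bochner_Integration.integral_cong) (auto simp: h_def B_def indicator_def)
  also have "\<dots> = 0" by (rule hbox)
  finally have "AE x in lborel. k x = 0"
    by (intro AE_eq_0_of_integral_box_0 ki) (simp_all add: kint hbox)
  with k(2) show ?thesis
    by eventually_elim (simp add: h_def B_def indicator_def split: if_splits)
qed

section \<open>Hypersurfaces and their transversal sweeps\<close>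

lemma hypersurface_of_codim_1:
  fixes Z :: "(real^'n) set"
  assumes "analytic_codim Z = 1"
  obtains M where "M \<subseteq> Z" "real_analytic_submanifold (CARD('n) - 1) M"
proof -
  let ?D = "{d. \<exists>M\<subseteq>Z. real_analytic_submanifold d M}"
  have n: "CARD('n) \<ge> 1" by (simp add: Suc_leI)
  have sup: "analytic_dim Z = ereal (real CARD('n) - 1)"
    using assms unfolding analytic_codim_def by (cases "analytic_dim Z") auto
  \<comment> \<open>The supremum is attained: \<open>CARD('n) - 1\<close> is the only integer above
    \<open>CARD('n) - 3 / 2\<close> that does not exceed the supremum.\<close>
  then have "ereal (real CARD('n) - 3 / 2) < (SUP d\<in>?D. ereal (real d))"
    by (simp add: analytic_dim_def)
  then obtain d where d: "d \<in> ?D" "real CARD('n) - 3 / 2 < real d" by (auto simp: less_SUP_iff)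
  have "ereal (real d) \<le> ereal (real CARD('n) - 1)"
    unfolding sup[symmetric] analytic_dim_def using d(1) by (rule SUP_upper)
  then have "d = CARD('n) - 1" using d(2) n by simp
  with d(1) that show ?thesis by blast
qed

lemma real_analytic_map_has_derivative:
  fixes F :: "real^'n \<Rightarrow> real^'m"
  assumes "F real_analytic_map_on U" "x \<in> U"
  obtains F' where "(F has_derivative F') (at x)"
proof -
  have "\<exists>F'. ((\<lambda>x. F x $ j) has_derivative F') (at x)" for j
    using assms real_analytic_on_imp_differentiable unfolding real_analytic_map_on_def differentiable_def by blast
  then obtain G where G: "\<And>j. ((\<lambda>x. F x $ j) has_derivative G j) (at x)" by metis
  have "(F has_derivative (\<lambda>h. \<chi> j. G j h)) (at x)"
    unfolding has_derivative_componentwise_within[of F] using G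
    by (auto simp: Basis_vec_def inner_axis)
  then show ?thesis by (rule that)
qed

text \<open>With \<open>\<nu>\<close> normal to \<open>L\<close>, the map \<open>\<Phi>\<close> extends the slice chart by translation along a transversal
  direction; its derivative at one point is invertible, which suffices for the open mapping argument.\<close>
lemma hypersurface_sweep:
  fixes M :: "(real^'n) set"
  assumes M: "real_analytic_submanifold (CARD('n) - 1) M" and a: "a \<in> M" and E: "open E" "E \<noteq> {}"
  obtains e where "e \<in> E" "\<forall>d>0. a \<in> interior {m + s *\<^sub>R e |m s. m \<in> M \<and> \<bar>s\<bar> < d}"
proof -
  obtain V W \<phi> \<psi> and L :: "(real^'n) set" where
    VW: "open V" "open W" "a \<in> V" and an: "\<phi> real_analytic_map_on V" "\<psi> real_analytic_map_on W"
    and hom: "homeomorphism V W \<phi> \<psi>" and L: "subspace L" "dim L = CARD('n) - 1" and img: "\<phi> ` (V \<inter> M) = W \<inter> L"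
    using M a unfolding real_analytic_submanifold_def by metis
  define z where "z = \<phi> a"
  have z: "z \<in> W" "z \<in> L" "\<psi> z = a"
    using VW(3) a img hom unfolding z_def by (auto simp: homeomorphism_def)
  obtain \<phi>' where \<phi>': "(\<phi> has_derivative \<phi>') (at a)" by (rule real_analytic_map_has_derivative[OF an(1) VW(3)])
  obtain \<psi>' where \<psi>': "(\<psi> has_derivative \<psi>') (at z)" by (rule real_analytic_map_has_derivative[OF an(2) z(1)])
  have "((\<lambda>x. \<phi> (\<psi> x)) has_derivative (\<lambda>h. \<phi>' (\<psi>' h))) (at z)"
    using has_derivative_compose[OF \<psi>'] \<phi>' z(3) by simp
  moreover have "((\<lambda>x. \<phi> (\<psi> x)) has_derivative (\<lambda>h. h)) (at z)"
    by (rule has_derivative_transform_within_open[OF has_derivative_ident VW(2) z(1)])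
      (use hom in \<open>simp add: homeomorphism_def\<close>)
  ultimately have inv: "(\<lambda>h. \<phi>' (\<psi>' h)) = (\<lambda>h. h)" by (rule has_derivative_unique)
  have lin: "linear \<psi>'" using \<psi>' by (rule has_derivative_linear)
  have inj: "inj \<psi>'" using inv by (metis injI)
  have n: "CARD('n) \<ge> 1" by (simp add: Suc_leI)
  have "dim (\<psi>' ` L) = dim L" using inj lin by (intro dim_image_eq) (auto intro: inj_on_subset)
  then have "dim (\<psi>' ` L) < DIM(real^'n)" using L(2) n by simp
  then have "interior (\<psi>' ` L) = {}" by (rule empty_interior_lowdim)
  \<comment> \<open>The image of \<open>L\<close> under \<open>\<psi>'\<close> is the tangent space
    of \<open>M\<close> at \<open>a\<close>. It has empty interior, so the open set \<open>E\<close>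
    contains a transversal direction.\<close>
  then obtain e where e: "e \<in> E" "e \<notin> \<psi>' ` L"
    using E interior_maximal[of E "\<psi>' ` L"] by blast
  have "dim L < DIM(real^'n)" using L(2) n by simp
  then obtain \<nu> where \<nu>: "\<nu> \<noteq> 0" "span L \<subseteq> {x. \<nu> \<bullet> x = 0}" using lowdim_subset_hyperplane by blast
  have L_eq: "L = {x. \<nu> \<bullet> x = 0}"
    using \<nu> L by (intro subspace_dim_equal subspace_hyperplane) (auto simp: dim_hyperplane span_eq_iff[THEN iffD2])
  \<comment> \<open>The coordinate along \<open>\<nu>\<close>: subtracting
    \<open>l x *\<^sub>R \<nu>\<close> projects \<open>x\<close> orthogonally to \<open>L\<close>,
    and \<open>l x\<close> becomes the parameter along \<open>e\<close>.\<close>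
  define l where "l x = (\<nu> \<bullet> x) / (\<nu> \<bullet> \<nu>)" for x
  have bl: "bounded_linear l"
    unfolding l_def[abs_def] divide_inverse by (intro bounded_linear_mult_left bounded_linear_compose[OF bounded_linear_mult_left] bounded_linear_inner_right)
  have l: "x - l x *\<^sub>R \<nu> \<in> L" for x using \<nu>(1) by (simp add: L_eq l_def inner_diff_right)
  have lz: "l z = 0" using z(2) by (simp add: L_eq l_def)
  define \<Phi> where "\<Phi> x = \<psi> (x - l x *\<^sub>R \<nu>) + l x *\<^sub>R e" for x
  define \<Phi>' where "\<Phi>' h = \<psi>' (h - l h *\<^sub>R \<nu>) + l h *\<^sub>R e" for h
  define P where "P x = x - l x *\<^sub>R \<nu>" for x
  have dl: "(l has_derivative l) (at x)" for x using bl by (rule bounded_linear_imp_has_derivative)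
  have dP: "(P has_derivative P) (at x)" for x
    unfolding P_def[abs_def] by (intro has_derivative_diff has_derivative_ident has_derivative_scaleR_left dl)
  have d\<Phi>: "(\<Phi> has_derivative \<Phi>') (at z)"
    unfolding \<Phi>_def[abs_def] \<Phi>'_def[abs_def] P_def[symmetric]
  proof (intro has_derivative_add has_derivative_scaleR_left dl)
    have "P z = z" by (simp add: P_def lz)
    then have "(\<psi> has_derivative \<psi>') (at (P z))" using \<psi>' by simp
    with dP show "((\<lambda>x. \<psi> (P x)) has_derivative (\<lambda>h. \<psi>' (P h))) (at z)"
      by (rule has_derivative_compose)
  qed
  have "linear \<Phi>'" using d\<Phi> by (rule has_derivative_linear)
  moreover have "inj \<Phi>'"
    unfolding linear_injective_0[OF \<open>linear \<Phi>'\<close>]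
  proof (intro allI impI)
    fix h assume h: "\<Phi>' h = 0"
    have "l h = 0"
    proof (rule ccontr)
      assume "l h \<noteq> 0"
      have eq: "l h *\<^sub>R e = - \<psi>' (h - l h *\<^sub>R \<nu>)"
        using h by (simp add: \<Phi>'_def add_eq_0_iff)
      have "e = (1 / l h) *\<^sub>R (l h *\<^sub>R e)" using \<open>l h \<noteq> 0\<close> by simp
      also have "\<dots> = (- 1 / l h) *\<^sub>R \<psi>' (h - l h *\<^sub>R \<nu>)" unfolding eq by simp
      also have "\<dots> = \<psi>' ((- 1 / l h) *\<^sub>R (h - l h *\<^sub>R \<nu>))" by (rule linear_scale[OF lin, symmetric])
      finally show False using e(2) subspace_scale[OF L(1) l] by blast
    qed
    then have "\<psi>' h = \<psi>' 0" using h lin by (simp add: \<Phi>'_def linear_0)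
    then show "h = 0" using inj by (simp add: inj_eq)
  qed
  ultimately obtain g where g: "linear g" "\<forall>x. \<Phi>' (g x) = x" using linear_injective_isomorphism by blast
  define S where "S = P -` W"
  have contP: "continuous_on UNIV P"
    using dP by (intro continuous_at_imp_continuous_on ballI has_derivative_continuous)
  have S: "open S" unfolding S_def using VW(2) contP by (rule open_vimage)
  have contl: "continuous_on UNIV l"
    using dl by (intro continuous_at_imp_continuous_on ballI has_derivative_continuous)
  have cont: "continuous_on S \<Phi>"
  proof -
    have "continuous_on W \<psi>" using hom by (simp add: homeomorphism_def)
    then have "continuous_on S (\<lambda>x. \<psi> (P x))"
      by (rule continuous_on_compose2) (use contP in \<open>auto simp: S_def intro: continuous_on_subset\<close>)
    then show ?thesis unfolding \<Phi>_def[abs_def] P_def[symmetric]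
      by (intro continuous_on_add continuous_on_scaleR) (auto intro: continuous_on_subset[OF contl])
  qed
  show ?thesis
  proof (rule that[OF e(1)], intro allI impI)
    fix d :: real assume d: "d > 0"
    define T where "T = S \<inter> l -` {-d<..<d}"
    have "open T" unfolding T_def using S contl by (intro open_Int open_vimage) auto
    have zS: "z \<in> S" "z \<in> T" using z lz d by (auto simp: S_def T_def P_def)
    have "\<Phi> z \<in> interior (\<Phi> ` T)"
    proof (rule sussmann_open_mapping[OF S cont zS(1) d\<Phi>])
      show "bounded_linear g" using g(1) by (rule linear_conv_bounded_linear[THEN iffD1])
      show "\<Phi>' \<circ> g = id" using g(2) by (auto simp: fun_eq_iff)
      show "T \<subseteq> S" by (auto simp: T_def)
      show "z \<in> interior T" using \<open>open T\<close> zS by (simp add: interior_open)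
    qed
    moreover have "\<Phi> ` T \<subseteq> {m + s *\<^sub>R e |m s. m \<in> M \<and> \<bar>s\<bar> < d}"
    proof
      fix y assume "y \<in> \<Phi> ` T"
      then obtain x where x: "x \<in> T" "y = \<Phi> x" by blast
      then have "P x \<in> W \<inter> L" using l by (auto simp: T_def S_def P_def)
      then obtain m where m: "m \<in> V \<inter> M" "P x = \<phi> m" using img by blast
      then have "\<psi> (P x) = m" using hom by (simp add: homeomorphism_def)
      then have "y = m + l x *\<^sub>R e" using x by (simp add: \<Phi>_def P_def)
      moreover have "\<bar>l x\<bar> < d" using x by (auto simp: T_def)
      ultimately show "y \<in> {m + s *\<^sub>R e |m s. m \<in> M \<and> \<bar>s\<bar> < d}" using m by blast
    qed
    moreover have "\<Phi> z = a" using z lz by (simp add: \<Phi>_def)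
    ultimately show "a \<in> interior {m + s *\<^sub>R e |m s. m \<in> M \<and> \<bar>s\<bar> < d}" using interior_mono by blast
  qed
qed

section \<open>Divergence along segments through the hypersurface\<close>

context small_analytic
begin

text \<open>The parameter is shifted so that the zero sits at \<open>0\<close>. Only the part of the
  segment after it is kept; its length \<open>d - s0\<close> is positive and the integral over it
  already diverges.\<close>

lemma nn_integral_dV_powr_segment:
  assumes d: "d > 0" and p: "p > 1"
    and seg: "\<And>s. s \<in> {-d..d} \<Longrightarrow> x + s *\<^sub>R e \<in> U \<and> (dir_deriv e ^^ k) f (x + s *\<^sub>R e) \<noteq> 0"
    and s0: "\<bar>s0\<bar> < d" "f (x + s0 *\<^sub>R e) = 0"
  shows "(\<integral>\<^sup>+s. ennreal (\<bar>dV e (x + s *\<^sub>R e)\<bar> powr p) * indicator {-d..d} s \<partial>lborel) = \<infinity>"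
proof -
  define y where "y = x + s0 *\<^sub>R e"
  have y: "y + s *\<^sub>R e = x + (s + s0) *\<^sub>R e" for s by (simp add: y_def algebra_simps)
  define D where "D n s = (dir_deriv e ^^ n) f (y + s *\<^sub>R e)" for n s
  have sub: "s + s0 \<in> {-d..d}" if "s \<in> {0..d - s0}" for s using that s0 by auto
  have in_U: "y + s *\<^sub>R e \<in> U" if "s \<in> {0..d - s0}" for s
    using seg[OF sub[OF that]] by (simp add: y)
  have inf: "(\<integral>\<^sup>+s. ennreal (\<bar>invlog' (D 0 s) * D 1 s\<bar> powr p) * indicator {0..d - s0} s \<partial>lborel) = \<infinity>"
  proof (rule nn_integral_invlog_deriv_powr[OF _ _ _ _ _ p])
    show "(D n has_real_derivative D (Suc n) s) (at s)" if "s \<in> {0..d - s0}" for n s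
      unfolding D_def by (rule iter_dir_deriv_line[OF analytic in_U[OF that]])
    show "D 0 0 = 0" using s0 by (simp add: D_def y_def)
    show "D k s \<noteq> 0" if "s \<in> {0..d - s0}" for s
      using seg[OF sub[OF that]] by (simp add: D_def y)
    show "\<bar>D 0 s\<bar> < 1" if "s \<in> {0..d - s0}" for s
      using small[OF in_U[OF that]] by (simp add: D_def)
  qed (use s0 in auto)
  have "(\<integral>\<^sup>+s. ennreal (\<bar>invlog' (D 0 s) * D 1 s\<bar> powr p) * indicator {0..d - s0} s \<partial>lborel)
      \<le> (\<integral>\<^sup>+s. ennreal (\<bar>dV e (x + (s + s0) *\<^sub>R e)\<bar> powr p) * indicator {-d..d} (s + s0) \<partial>lborel)"
  proof (intro nn_integral_mono)
    fix s :: real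
    show "ennreal (\<bar>invlog' (D 0 s) * D 1 s\<bar> powr p) * indicator {0..d - s0} s
      \<le> ennreal (\<bar>dV e (x + (s + s0) *\<^sub>R e)\<bar> powr p) * indicator {-d..d} (s + s0)"
    proof (cases "s \<in> {0..d - s0}")
      case True
      then show ?thesis using sub[OF True] in_U[OF True] by (simp add: dV_def D_def y)
    qed simp
  qed
  also have "\<dots> = (\<integral>\<^sup>+s. ennreal (\<bar>dV e (x + s *\<^sub>R e)\<bar> powr p) * indicator {-d..d} s \<partial>lborel)"
    by (rule nn_integral_lborel_translate) measurable
  finally show ?thesis unfolding inf by (simp add: top_unique)
qed

lemma dV_sum_axis: "dV e x = (\<Sum>i\<in>UNIV. e $ i * dV (axis i 1) x)"
proof (cases "x \<in> U")
  case True
  then have lin: "linear (frechet_derivative f (at x))"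
    using analytic linear_frechet_derivative real_analytic_on_imp_differentiable by blast
  have "frechet_derivative f (at x) e = frechet_derivative f (at x) (\<Sum>i\<in>UNIV. e $ i *\<^sub>R axis i 1)"
    by (simp add: basis_expansion flip: scalar_mult_eq_scaleR)
  also have "\<dots> = (\<Sum>i\<in>UNIV. e $ i * frechet_derivative f (at x) (axis i 1))"
    by (simp add: linear_sum[OF lin] linear_scale[OF lin])
  finally show ?thesis using True by (simp add: dV_def dir_deriv_def sum_distrib_left mult_ac)
qed (simp add: dV_def)

text \<open>By uniqueness, each \<open>dV (axis i 1)\<close> agrees almost everywhere in the box
  with the L^p derivative that \<open>S\<close> supplies; other directions are linear combinations
  of the axes.\<close>

lemma nn_integral_dV_powr_box:
  assumes v: "\<And>x. x \<in> U \<Longrightarrow> v x = V x" and S: "v \<in> Sobolev_loc 1 p U" and p: "p \<ge> 1" and ab: "cbox a b \<subseteq> U"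
  shows "(\<integral>\<^sup>+x. ennreal (\<bar>dV e x\<bar> powr p) * indicator (box a b) x \<partial>lborel) < \<infinity>"
proof -
  have part: "(\<integral>\<^sup>+x. ennreal (\<bar>dV (axis i 1) x\<bar> powr p) * indicator (box a b) x \<partial>lborel) < \<infinity>" for i
  proof -
    have "\<exists>g. weak_derivative U [i] v g \<and> Lp_loc p U g" using S by (simp add: Sobolev_loc_def)
    then obtain g where g: "weak_derivative U [i] v g" "Lp_loc p U g" by blast
    have "AE x in lborel. x \<in> box a b \<longrightarrow> dV (axis i 1) x = g x"
      by (rule weak_derivative_unique_AE[OF open_U weak_derivative_dV[OF v] g(1) ab])
    then have "(\<integral>\<^sup>+x. ennreal (\<bar>dV (axis i 1) x\<bar> powr p) * indicator (box a b) x \<partial>lborel)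
      = (\<integral>\<^sup>+x. ennreal (\<bar>g x\<bar> powr p) * indicator (box a b) x \<partial>lborel)"
      by (intro nn_integral_cong_AE) (auto elim!: eventually_mono simp: indicator_def)
    also have "\<dots> \<le> (\<integral>\<^sup>+x. ennreal (\<bar>g x\<bar> powr p) * indicator (cbox a b) x \<partial>lborel)"
      using box_subset_cbox[of a b] by (intro nn_integral_mono) (auto simp: indicator_def)
    also have "\<dots> < \<infinity>" by (rule Lp_locD[OF g(2) compact_cbox ab])
    finally show ?thesis .
  qed
  define C where "C = (norm e * real CARD('n)) powr p"
  have bound: "\<bar>dV e x\<bar> powr p \<le> C * (\<Sum>i\<in>UNIV. \<bar>dV (axis i 1) x\<bar> powr p)" for x
  proof -
    \<comment> \<open>Estimating by the largest coordinate replaces a convexity inequality: the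
      power of \<open>m\<close> is one of the summands.\<close>
    define m where "m = Max (range (\<lambda>i. \<bar>dV (axis i 1) x\<bar>))"
    have m: "\<bar>dV (axis i 1) x\<bar> \<le> m" for i unfolding m_def by (intro Max_ge) auto
    have "m \<in> range (\<lambda>i. \<bar>dV (axis i 1) x\<bar>)" unfolding m_def by (intro Max_in) auto
    then obtain j where j: "m = \<bar>dV (axis j 1) x\<bar>" by blast
    have "\<bar>dV e x\<bar> \<le> (\<Sum>i\<in>(UNIV::'n set). norm e * m)"
      unfolding dV_sum_axis[of e x] using m
      by (intro order_trans[OF sum_abs] sum_mono) (auto simp: abs_mult component_le_norm_cart intro!: mult_mono)
    then have "\<bar>dV e x\<bar> powr p \<le> ((norm e * real CARD('n)) * m) powr p"
      using p by (intro powr_mono2) (auto simp: mult_ac)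
    also have "\<dots> = C * \<bar>dV (axis j 1) x\<bar> powr p" by (simp add: powr_mult C_def j)
    also have "\<dots> \<le> C * (\<Sum>i\<in>UNIV. \<bar>dV (axis i 1) x\<bar> powr p)"
      using member_le_sum[of j UNIV "\<lambda>i. \<bar>dV (axis i 1) x\<bar> powr p"]
      by (intro mult_left_mono) (auto simp: C_def)
    finally show ?thesis .
  qed
  have "(\<integral>\<^sup>+x. ennreal (\<bar>dV e x\<bar> powr p) * indicator (box a b) x \<partial>lborel)
      \<le> (\<integral>\<^sup>+x. ennreal C * (\<Sum>i\<in>UNIV. ennreal (\<bar>dV (axis i 1) x\<bar> powr p) * indicator (box a b) x) \<partial>lborel)"
  proof (intro nn_integral_mono)
    fix x
    have "ennreal (\<bar>dV e x\<bar> powr p) \<le> ennreal C * (\<Sum>i\<in>UNIV. ennreal (\<bar>dV (axis i 1) x\<bar> powr p))"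
      using ennreal_leI[OF bound[of x]] by (simp add: ennreal_mult' sum_nonneg C_def)
    then show "ennreal (\<bar>dV e x\<bar> powr p) * indicator (box a b) x
      \<le> ennreal C * (\<Sum>i\<in>UNIV. ennreal (\<bar>dV (axis i 1) x\<bar> powr p) * indicator (box a b) x)"
      by (simp add: indicator_def)
  qed
  also have "\<dots> = ennreal C * (\<Sum>i\<in>UNIV. \<integral>\<^sup>+x. ennreal (\<bar>dV (axis i 1) x\<bar> powr p) * indicator (box a b) x \<partial>lborel)"
    by (subst nn_integral_cmult, measurable, subst nn_integral_sum, measurable)
  also have "\<dots> < \<infinity>"
  proof -
    have "(\<Sum>i\<in>UNIV. \<integral>\<^sup>+x. ennreal (\<bar>dV (axis i 1) x\<bar> powr p) * indicator (box a b) x \<partial>lborel) < \<infinity>"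
      using part by (simp add: less_top[symmetric])
    then show ?thesis by (simp add: ennreal_mult_less_top)
  qed
  finally show ?thesis .
qed

text \<open>The averaging identity over segments is now read in the other direction: the inner
  integral is infinite for all base points in an open set, which has positive measure, whereas
  membership in the Sobolev space makes the average finite.\<close>

lemma V_notin_Sobolev_loc:
  assumes v: "\<And>x. x \<in> U \<Longrightarrow> v x = V x" and p: "p > 1"
    and codim: "analytic_codim {x\<in>U. f x = 0} = 1"
  shows "v \<notin> Sobolev_loc 1 p U"
proof
  assume S: "v \<in> Sobolev_loc 1 p U"
  obtain M where M: "M \<subseteq> {x\<in>U. f x = 0}" "real_analytic_submanifold (CARD('n) - 1) M"
    by (rule hypersurface_of_codim_1[OF codim])
  then obtain a where a: "a \<in> M" unfolding real_analytic_submanifold_def by blast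
  then have aU: "a \<in> U" using M(1) by blast
  obtain E where E: "open E" "E \<noteq> {}" "\<forall>e\<in>E. \<exists>k\<ge>1. (dir_deriv e ^^ k) f a \<noteq> 0"
    by (rule good_directions[OF open_U connected_U analytic nonconst aU])
  obtain e where e: "e \<in> E" "\<forall>d>0. a \<in> interior {m + s *\<^sub>R e |m s. m \<in> M \<and> \<bar>s\<bar> < d}"
    by (rule hypersurface_sweep[OF M(2) a E(1,2)])
  obtain k where k: "(dir_deriv e ^^ k) f a \<noteq> 0" using E(3) e(1) by blast
  obtain \<alpha> \<beta> where box: "a \<in> box \<alpha> \<beta>" "cbox \<alpha> \<beta> \<subseteq> U"
    using open_contains_cbox[OF open_U aU] by metis
  obtain R where R: "R > 0" "cball a R \<subseteq> U" "\<And>x. x \<in> cball a R \<Longrightarrow> (dir_deriv e ^^ k) f x \<noteq> 0"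
    by (rule iter_dir_deriv_nonzero_cball[OF aU k]) (rule that; simp)
  obtain R' where R': "R' > 0" "cball a R' \<subseteq> box \<alpha> \<beta>"
    using open_box box(1) unfolding open_contains_cball by metis
  \<comment> \<open>Halving leaves room for shifts of length \<open>r\<close>: segments based in
    \<open>N\<close> stay in \<open>cball a (2 * r)\<close>, hence in both \<open>cball a R\<close>
    and \<open>box \<alpha> \<beta>\<close>.\<close>
  define r where "r = min R R' / 2"
  define d where "d = r / (norm e + 1)"
  have r: "r > 0" "2 * r \<le> R" "2 * r \<le> R'" using R(1) R'(1) by (auto simp: r_def)
  have "0 < norm e + 1" by (simp add: add_nonneg_pos)
  then have d: "d > 0" "d * norm e \<le> r" using r by (simp_all add: d_def pos_divide_le_eq)
  define N where "N = ball a r \<inter> interior {m + s *\<^sub>R e |m s. m \<in> M \<and> \<bar>s\<bar> < d}"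
  have N: "open N" "a \<in> N" using e(2) d r by (auto simp: N_def)
  have near: "x + s *\<^sub>R e \<in> cball a (2 * r)" if "x \<in> N" "s \<in> {-d..d}" for x s
  proof -
    have "\<bar>s\<bar> * norm e \<le> d * norm e" using that by (intro mult_right_mono) auto
    then have "norm (s *\<^sub>R e) \<le> r" using d by simp
    moreover have "norm (x - a) < r" using that by (simp add: N_def dist_norm norm_minus_commute)
    ultimately have "norm (x - a + s *\<^sub>R e) \<le> 2 * r" using norm_triangle_ineq[of "x - a" "s *\<^sub>R e"] by linarith
    then show ?thesis by (simp add: dist_norm norm_minus_commute algebra_simps)
  qed
  define G where "G x = ennreal (\<bar>dV e x\<bar> powr p) * indicator (box \<alpha> \<beta>) x" for x
  have [measurable]: "G \<in> borel_measurable borel" unfolding G_def by measurable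
  have inf: "(\<integral>\<^sup>+s. G (x + s *\<^sub>R e) * indicator {-d..d} s \<partial>lborel) = \<infinity>" if x: "x \<in> N" for x
  proof -
    have "x \<in> {m + s *\<^sub>R e |m s. m \<in> M \<and> \<bar>s\<bar> < d}" using x interior_subset by (auto simp: N_def)
    then obtain m s where ms: "x = m + s *\<^sub>R e" "m \<in> M" "\<bar>s\<bar> < d" by blast
    have "(\<integral>\<^sup>+s. ennreal (\<bar>dV e (x + s *\<^sub>R e)\<bar> powr p) * indicator {-d..d} s \<partial>lborel) = \<infinity>"
    \<comment> \<open>As \<open>x = m + s *\<^sub>R e\<close>, the zero \<open>m\<close> sits at the
      parameter \<open>- s\<close> of the segment based at \<open>x\<close>.\<close>
    proof (rule nn_integral_dV_powr_segment[OF d(1) p, where k = k and ?s0.0 = "- s"])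
      show "x + s *\<^sub>R e \<in> U \<and> (dir_deriv e ^^ k) f (x + s *\<^sub>R e) \<noteq> 0" if "s \<in> {-d..d}" for s
        using near[OF x that] r R subset_cball[OF r(2), of a] by blast
      show "f (x + (- s) *\<^sub>R e) = 0" using ms M(1) by auto
    qed (use ms in simp)
    also have "(\<integral>\<^sup>+s. ennreal (\<bar>dV e (x + s *\<^sub>R e)\<bar> powr p) * indicator {-d..d} s \<partial>lborel)
      = (\<integral>\<^sup>+s. G (x + s *\<^sub>R e) * indicator {-d..d} s \<partial>lborel)"
    proof (intro nn_integral_cong)
      fix s :: real
      have "x + s *\<^sub>R e \<in> box \<alpha> \<beta>" if "s \<in> {-d..d}"
        using near[OF x that] R'(2) subset_cball[OF r(3), of a] by blast
      then show "ennreal (\<bar>dV e (x + s *\<^sub>R e)\<bar> powr p) * indicator {-d..d} s = G (x + s *\<^sub>R e) * indicator {-d..d} s"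
        by (auto simp: G_def indicator_def)
    qed
    finally show ?thesis .
  qed
  have "emeasure lborel N \<noteq> 0"
  proof
    assume "emeasure lborel N = 0"
    then have "N \<in> null_sets lborel" using N(1) by auto
    then have "negligible N" unfolding negligible_iff_null_sets by (rule null_sets_completionI)
    then show False using open_not_negligible N by blast
  qed
  then have "\<infinity> = \<infinity> * emeasure lborel N" by (simp add: ennreal_top_mult)
  also have "\<dots> = (\<integral>\<^sup>+x. \<infinity> * indicator N x \<partial>lborel)" using N by (intro nn_integral_cmult_indicator[symmetric]) auto
  also have "\<dots> \<le> (\<integral>\<^sup>+x. (\<integral>\<^sup>+s. G (x + s *\<^sub>R e) * indicator {-d..d} s \<partial>lborel) \<partial>lborel)"
    using inf by (intro nn_integral_mono) (auto simp: indicator_def)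
  also have "\<dots> = ennreal (d - (- d)) * (\<integral>\<^sup>+x. G x \<partial>lborel)"
    by (rule nn_integral_lborel_segments) (use d in auto)
  also have "\<dots> < \<infinity>"
    using nn_integral_dV_powr_box[OF v S less_imp_le[OF p] box(2), of e] by (simp add: G_def ennreal_mult_less_top)
  finally show False by simp
qed

end

theorem theorem1p1:
  fixes U :: "(real^'n) set" and f v :: "real^'n \<Rightarrow> real"
  assumes "open U" and "connected U" and "U \<noteq> {}"
    and "f real_analytic_on U"
    and "\<not> f constant_on U"
    and "\<And>x. x \<in> U \<Longrightarrow> \<bar>f x\<bar> < 1/2"
    and "\<And>x. x \<in> U \<Longrightarrow> v x = (if f x = 0 then 0 else 1 / ln \<bar>f x\<bar>)"
  shows "v \<in> Sobolev_loc 1 1 U \<and>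
    (analytic_codim {x\<in>U. f x = 0} = 1 \<longrightarrow> (\<forall>p>1. v \<notin> Sobolev_loc 1 p U))"
proof -
  interpret small_analytic U f
    by unfold_locales (fact assms)+
  have v: "v x = V x" if "x \<in> U" for x
    using assms(7)[OF that] that by (simp add: V_def invlog_def)
  show ?thesis using V_in_Sobolev_loc_1_1[OF v] V_notin_Sobolev_loc[OF v] by blast
qed

end
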